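(* Let $k$ be a field of characteristic $p>0$, $n\ge 1$, $\mathbf t=(t_1,\ldots,t_n)$ indeterminates, and let $f,g\in k[[\mathbf t]]$ be two algebraic power series of degree $d$ and $d'$, total height $h$ and $h'$, and partial height $(h_1,\ldots,h_n)$ and $(h'_1,\ldots,h'_n)$, respectively. Set $$N_1:=(d+1)\cdot\min\left\{\prod_{i=1}^n(h_i+1),\ \binom{n+h}{n}\right\},\qquad N_2:=(d'+1)\cdot\min\left\{\prod_{i=1}^n(h'_i+1),\ \binom{n+h'}{n}\right\}.$$ Then the Hadamard product $f\odot g$ is an algebraic power series of degree at most $p^{N_1N_2}-1$ over $k(\mathbf t)$.
   Context: A power series in $k[[\mathbf t]]$ is algebraic if it is algebraic over $k(\mathbf t)$. The degree of $f$ is $[k(\mathbf t)(f):k(\mathbf t)]$; its partial height $(h_1,\ldots,h_n)$ is given by letting $h_i$ be the minimal degree in $t_i$ of a nonzero polynomial $A(\mathbf t,y)\in k[\mathbf t,y]$ with $A(\mathbf t,f)=0$; its total height is the minimal total degree in $\mathbf t$ of a nonzero polynomial $A(\mathbf t,y)\in k[\mathbf t,y]$ with $A(\mathbf t,f)=0$. For $f=\sum_{\mathbf i\in\mathbb N^n}a(\mathbf i)\mathbf t^{\mathbf i}$ and $g=\sum_{\mathbf i\in\mathbb N^n}b(\mathbf i)\mathbf t^{\mathbf i}$ in $k[[\mathbf t]]$, the Hadamard product is $f\odot g=\sum_{\mathbf i\in\mathbb N^n}a(\mathbf i)b(\mathbf i)\mathbf t^{\mathbf i}$, where $\mathbf t^{\mathbf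 i}=t_1^{i_1}\cdots t_n^{i_n}$. *)

theory Defs
  imports
    "HOL-Library.Poly_Mapping"
    "HOL-Computational_Algebra.Computational_Algebra"
    "HOL-Algebra.Generated_Fields"
    "HOL-Algebra.Algebraic_Closure_Type"
begin

section \<open>Power series in several variables\<close>

text \<open>
  The variables are indexed by the type \<open>'n\<close>. A monomial is its exponent vector
  \<open>m :: 'n \<Rightarrow>\<^sub>0 nat\<close>, and \<open>('n \<Rightarrow>\<^sub>0 nat) \<Rightarrow>\<^sub>0 'a\<close> with the convolution product of Poly_Mapping is the
  polynomial ring. Power series drop the finiteness of the support.
\<close>

type_synonym ('n, 'a) mpoly = "('n \<Rightarrow>\<^sub>0 nat) \<Rightarrow>\<^sub>0 'a"

typedef ('n, 'a) mfps = "UNIV :: (('n \<Rightarrow>\<^sub>0 nat) \<Rightarrow> 'a) set"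
  morphisms mfps_nth Abs_mfps
  by simp

lemma mfps_nth_Abs_mfps [simp]: "mfps_nth (Abs_mfps c) = c"
  by (simp add: Abs_mfps_inverse)

lemma mfps_eqI: "(\<And>m. mfps_nth f m = mfps_nth g m) \<Longrightarrow> f = g"
  by (metis ext mfps_nth_inject)

lemma finite_add_decomp: "finite {(a, b). a + b = (m :: 'n \<Rightarrow>\<^sub>0 nat)}"
proof -
  let ?H = "{h. \<forall>x. (x \<in> Poly_Mapping.keys m \<longrightarrow> h x \<in> {..Max (Poly_Mapping.lookup m ` Poly_Mapping.keys m)}) \<and>
      (x \<notin> Poly_Mapping.keys m \<longrightarrow> h x = 0)}"
  have "finite ?H"
    by (rule finite_set_of_finite_funs) auto
  moreover have "Poly_Mapping.lookup ` fst ` {(a, b). a + b = m} \<subseteq> ?H"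
  proof
    fix h assume "h \<in> Poly_Mapping.lookup ` fst ` {(a, b). a + b = m}"
    then obtain a b where h: "h = Poly_Mapping.lookup a" and m: "a + b = m"
      by auto
    have le: "h x \<le> Poly_Mapping.lookup m x" for x
      by (simp add: h m[symmetric] lookup_add)
    have "h x \<in> {..Max (Poly_Mapping.lookup m ` Poly_Mapping.keys m)}"
      if "x \<in> Poly_Mapping.keys m" for x
    proof -
      have "Poly_Mapping.lookup m x \<le> Max (Poly_Mapping.lookup m ` Poly_Mapping.keys m)"
        using that by (intro Max_ge) auto
      with le[of x] show ?thesis
        unfolding atMost_iff by (rule order.trans)
    qed
    moreover have "h x = 0" if "x \<notin> Poly_Mapping.keys m" for x
      using le[of x] that by (simp add: in_keys_iff)
    ultimately show "h \<in> ?H"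
      by simp
  qed
  ultimately have "finite (Poly_Mapping.lookup ` fst ` {(a, b). a + b = m})"
    by (rule finite_subset[rotated])
  moreover have "inj_on Poly_Mapping.lookup A" for A :: "('n \<Rightarrow>\<^sub>0 nat) set"
    by (rule inj_onI) (simp only: lookup_inject)
  ultimately have "finite (fst ` {(a, b). a + b = m})"
    by (rule finite_imageD)
  moreover have "inj_on fst {(a, b). a + b = m}"
    by (rule inj_onI) auto
  ultimately show ?thesis
    by (rule finite_imageD)
qed

instantiation mfps :: (type, comm_ring_1) comm_ring_1
begin

definition "0 = Abs_mfps (\<lambda>m. 0)"
definition "1 = Abs_mfps (\<lambda>m. if m = 0 then 1 else 0)"
definition "f + g = Abs_mfps (\<lambda>m. mfps_nth f m + mfps_nth g m)"
definition "f - g = Abs_mfps (\<lambda>m. mfps_nth f m - mfps_nth g m)"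
definition "- f = Abs_mfps (\<lambda>m. - mfps_nth f m)"
definition "f * g = Abs_mfps (\<lambda>m. \<Sum>(a, b) | a + b = m. mfps_nth f a * mfps_nth g b)"

lemma mfps_nth_zero [simp]: "mfps_nth 0 m = 0"
  and mfps_nth_one: "mfps_nth 1 m = (if m = 0 then 1 else 0)"
  and mfps_nth_add [simp]: "mfps_nth (f + g) m = mfps_nth f m + mfps_nth g m"
  and mfps_nth_diff [simp]: "mfps_nth (f - g) m = mfps_nth f m - mfps_nth g m"
  and mfps_nth_uminus [simp]: "mfps_nth (- f) m = - mfps_nth f m"
  and mfps_nth_mult: "mfps_nth (f * g) m = (\<Sum>(a, b) | a + b = m. mfps_nth f a * mfps_nth g b)"
  by (simp_all add: zero_mfps_def one_mfps_def plus_mfps_def minus_mfps_def uminus_mfps_def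
      times_mfps_def)

instance
proof
  fix f g h :: "('a, 'b) mfps"
  show "f * g * h = f * (g * h)"
  proof (rule mfps_eqI)
    fix m
    have "mfps_nth (f * g * h) m =
      (\<Sum>x\<in>{(a, b). a + b = m}. \<Sum>y\<in>{(c, d). c + d = fst x}.
         mfps_nth f (fst y) * mfps_nth g (snd y) * mfps_nth h (snd x))"
      by (simp add: mfps_nth_mult sum_distrib_right case_prod_unfold)
    also have "\<dots> = (\<Sum>(x, y)\<in>(SIGMA x:{(a, b). a + b = m}. {(c, d). c + d = fst x}).
         mfps_nth f (fst y) * mfps_nth g (snd y) * mfps_nth h (snd x))"
      by (rule sum.Sigma) (use finite_add_decomp in auto)
    also have "\<dots> = (\<Sum>(x, y)\<in>(SIGMA x:{(a, b). a + b = m}. {(c, d). c + d = snd x}).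
         mfps_nth f (fst x) * mfps_nth g (fst y) * mfps_nth h (snd y))"
      by (rule sum.reindex_bij_witness
          [where j = "\<lambda>((ab, c), (a, b)). ((a, b + c), (b, c))"
             and i = "\<lambda>((a, bc), (b, c)). ((a + b, c), (a, b))"])
         (auto simp: add.assoc)
    also have "\<dots> = (\<Sum>x\<in>{(a, b). a + b = m}. \<Sum>y\<in>{(c, d). c + d = snd x}.
         mfps_nth f (fst x) * mfps_nth g (fst y) * mfps_nth h (snd y))"
      by (rule sum.Sigma[symmetric]) (use finite_add_decomp in auto)
    also have "\<dots> = mfps_nth (f * (g * h)) m"
      by (simp add: mfps_nth_mult sum_distrib_left case_prod_unfold mult.assoc)
    finally show "mfps_nth (f * g * h) m = mfps_nth (f * (g * h)) m" .
  qed
  show "f * g = g * f"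
  proof (rule mfps_eqI)
    fix m
    show "mfps_nth (f * g) m = mfps_nth (g * f) m"
      unfolding mfps_nth_mult
      by (rule sum.reindex_bij_witness[where i = prod.swap and j = prod.swap])
         (auto simp: add.commute mult.commute)
  qed
  show "1 * f = f"
  proof (rule mfps_eqI)
    fix m
    have "mfps_nth (1 * f) m = (\<Sum>x\<in>{(a, b). a + b = m}. if x = (0, m) then mfps_nth f m else 0)"
      unfolding mfps_nth_mult by (rule sum.cong) (auto simp: mfps_nth_one split: if_splits)
    also have "\<dots> = mfps_nth f m"
      using finite_add_decomp[of m] by (subst sum.delta) auto
    finally show "mfps_nth (1 * f) m = mfps_nth f m" .
  qed
  show "(f + g) * h = f * h + g * h"
    by (rule mfps_eqI) (simp add: mfps_nth_mult case_prod_unfold distrib_right sum.distrib)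
  show "(0 :: ('a, 'b) mfps) \<noteq> 1"
    by (metis mfps_nth_one mfps_nth_zero zero_neq_one)
qed (rule mfps_eqI; simp)+

end

text \<open>
  For any two nonempty sets of exponents, some sum \<open>a + b\<close> is attained only once (take the
  lexicographically least elements).
\<close>

lemma ex_unique_sum:
  fixes F G :: "('n \<Rightarrow> nat) set"
  assumes "finite S" "F \<noteq> {}" "G \<noteq> {}"
  shows "\<exists>a b. a \<in> F \<and> b \<in> G \<and> (\<forall>a' b'. a' \<in> F \<longrightarrow> b' \<in> G \<longrightarrow>
    (\<forall>i\<in>S. a' i + b' i = a i + b i) \<longrightarrow> (\<forall>i\<in>S. a' i = a i \<and> b' i = b i))"
  using assms
proof (induction S arbitrary: F G rule: finite_induct)
  case empty
  then obtain a b where "a \<in> F" "b \<in> G" by auto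
  thus ?case by (intro exI[of _ a] exI[of _ b]) simp
next
  case (insert x S)
  have exists_least: "\<exists>a. a \<in> H \<and> (\<forall>a'. a' \<in> H \<longrightarrow> a x \<le> a' x)" if "H \<noteq> {}" for H :: "('n \<Rightarrow> nat) set"
  proof -
    from that obtain a1 where "a1 \<in> H" by auto
    thus ?thesis by (rule ex_has_least_nat[of "\<lambda>a. a \<in> H" _ "\<lambda>a. a x"])
  qed
  obtain a0 where a0: "a0 \<in> F" "\<forall>a'. a' \<in> F \<longrightarrow> a0 x \<le> a' x"
    using exists_least[OF insert.prems(1)] by (elim exE conjE)
  obtain b0 where b0: "b0 \<in> G" "\<forall>b'. b' \<in> G \<longrightarrow> b0 x \<le> b' x"
    using exists_least[OF insert.prems(2)] by (elim exE conjE)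
  let ?F = "{a. a \<in> F \<and> a x = a0 x}" and ?G = "{b. b \<in> G \<and> b x = b0 x}"
  have "a0 \<in> ?F" "b0 \<in> ?G"
    using a0 b0 by simp_all
  hence "?F \<noteq> {}" "?G \<noteq> {}"
    by (simp_all only: ex_in_conv[symmetric]) (rule exI, assumption)+
  from insert.IH[OF this] obtain a b where ab: "a \<in> ?F" "b \<in> ?G"
    and u: "\<forall>a' b'. a' \<in> ?F \<longrightarrow> b' \<in> ?G \<longrightarrow>
      (\<forall>i\<in>S. a' i + b' i = a i + b i) \<longrightarrow> (\<forall>i\<in>S. a' i = a i \<and> b' i = b i)"
    by (elim exE conjE)
  show ?case
  proof (intro exI conjI allI impI)
    show "a \<in> F" "b \<in> G" using ab by simp_all
  next
    fix a' b'
    assume *: "a' \<in> F" "b' \<in> G" "\<forall>i\<in>insert x S. a' i + b' i = a i + b i"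
    have "a0 x \<le> a' x" "b0 x \<le> b' x"
      using a0(2) b0(2) *(1,2) by simp_all
    moreover have "a' x + b' x = a0 x + b0 x"
      using *(3) ab by simp
    ultimately have x: "a' x = a0 x" "b' x = b0 x"
      by linarith+
    have "\<forall>i\<in>S. a' i = a i \<and> b' i = b i"
      using u[rule_format, of a' b'] * x by simp
    thus "\<forall>i\<in>insert x S. a' i = a i \<and> b' i = b i"
      using x ab by simp
  qed
qed

lemma mfps_eq_0_iff: "f = 0 \<longleftrightarrow> (\<forall>m. mfps_nth f m = 0)" for f :: "('n, 'a::comm_ring_1) mfps"
proof
  assume "\<forall>m. mfps_nth f m = 0"
  thus "f = 0" by (intro mfps_eqI) simp
qed simp

instance mfps :: (finite, idom) idom
proof
  fix f g :: "('a, 'b) mfps"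
  let ?F = "Poly_Mapping.lookup ` {m. mfps_nth f m \<noteq> 0}"
    and ?G = "Poly_Mapping.lookup ` {m. mfps_nth g m \<noteq> 0}"
  assume "f \<noteq> 0" "g \<noteq> 0"
  hence "?F \<noteq> {}" "?G \<noteq> {}"
    by (simp_all add: mfps_eq_0_iff)
  from ex_unique_sum[OF finite_class.finite_UNIV this] obtain a' b' where
    "a' \<in> ?F" "b' \<in> ?G" and u: "\<forall>c d. c \<in> ?F \<longrightarrow> d \<in> ?G \<longrightarrow>
      (\<forall>i\<in>UNIV. c i + d i = a' i + b' i) \<longrightarrow> (\<forall>i\<in>UNIV. c i = a' i \<and> d i = b' i)"
    by (elim exE conjE)
  then obtain a b where ab: "mfps_nth f a \<noteq> 0" "mfps_nth g b \<noteq> 0"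
    and a'b': "a' = Poly_Mapping.lookup a" "b' = Poly_Mapping.lookup b"
    by (elim imageE) (simp only: mem_Collect_eq)
  have unique: "c = a \<and> d = b"
    if cd: "mfps_nth f c \<noteq> 0" "mfps_nth g d \<noteq> 0" and sum: "c + d = a + b" for c d
  proof -
    have "Poly_Mapping.lookup c \<in> ?F" "Poly_Mapping.lookup d \<in> ?G"
      using cd by (auto intro: imageI)
    moreover have "\<forall>i\<in>UNIV. Poly_Mapping.lookup c i + Poly_Mapping.lookup d i = a' i + b' i"
      by (simp only: a'b' lookup_add[symmetric] sum) simp
    ultimately have "\<forall>i\<in>UNIV. Poly_Mapping.lookup c i = a' i \<and> Poly_Mapping.lookup d i = b' i"
      by (rule u[THEN spec, THEN spec, THEN mp, THEN mp, THEN mp])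
    thus ?thesis
      by (simp add: poly_mapping_eq_iff fun_eq_iff a'b')
  qed
  have "mfps_nth (f * g) (a + b) =
      (\<Sum>x\<in>{(c, d). c + d = a + b}. if x = (a, b) then mfps_nth f a * mfps_nth g b else 0)"
    unfolding mfps_nth_mult
  proof (rule sum.cong[OF refl])
    fix x assume "x \<in> {(c, d). c + d = a + b}"
    then obtain c d where "x = (c, d)" "c + d = a + b" by auto
    thus "(case x of (c, d) \<Rightarrow> mfps_nth f c * mfps_nth g d) =
        (if x = (a, b) then mfps_nth f a * mfps_nth g b else 0)"
      using unique[of c d] by (cases "mfps_nth f c = 0 \<or> mfps_nth g d = 0") auto
  qed
  also have "\<dots> = mfps_nth f a * mfps_nth g b"
    using finite_add_decomp[of "a + b"] by (subst sum.delta) auto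
  finally have "mfps_nth (f * g) (a + b) \<noteq> 0"
    using ab by simp
  thus "f * g \<noteq> 0"
    by (auto simp: mfps_eq_0_iff)
qed

definition hadamard :: "('n, 'a::times) mfps \<Rightarrow> ('n, 'a) mfps \<Rightarrow> ('n, 'a) mfps" where
  "hadamard f g = Abs_mfps (\<lambda>m. mfps_nth f m * mfps_nth g m)"

definition mfps_of_mpoly :: "('n, 'a::zero) mpoly \<Rightarrow> ('n, 'a) mfps" where
  "mfps_of_mpoly A = Abs_mfps (Poly_Mapping.lookup A)"


section \<open>Algebraic power series, degree and height\<close>

text \<open>
  \<open>k(t)\<close> and \<open>k(t)(f)\<close> are taken inside the field of fractions of \<open>k[[t]]\<close>, viewed as a HOL-Algebra
  ring so that its theory of algebraic elements and dimensions applies.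
\<close>

abbreviation mfps_field :: "('n::finite, 'k::field) mfps fract ring" where
  "mfps_field \<equiv> ring_of_type_algebra"

definition ratfuns :: "('n::finite, 'k::field) mfps fract set" where
  "ratfuns = {Fract (mfps_of_mpoly a) (mfps_of_mpoly b) | a b. b \<noteq> 0}"

definition adjoin :: "('n::finite, 'k::field) mfps \<Rightarrow> ('n, 'k) mfps fract set" where
  "adjoin f = generate_field mfps_field (ratfuns \<union> {Fract f 1})"

definition mfps_algebraic :: "('n::finite, 'k::field) mfps \<Rightarrow> bool" where
  "mfps_algebraic f \<longleftrightarrow> ring.algebraic mfps_field ratfuns (Fract f 1)"

text \<open>\<open>ring.dim\<close> is a definite description: it is meaningful only for a finite extension, that is, for algebraic \<open>f\<close>.\<close>

definition alg_degree :: "('n::finite, 'k::field) mfps \<Rightarrow> nat" where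
  "alg_degree f = ring.dim mfps_field ratfuns (adjoin f)"

text \<open>\<open>k[t,y]\<close> is rendered as \<open>k[t][y]\<close>.\<close>

definition annihilates :: "('n, 'k::field) mpoly poly \<Rightarrow> ('n, 'k) mfps \<Rightarrow> bool" where
  "annihilates A f \<longleftrightarrow> poly (map_poly mfps_of_mpoly A) f = 0"

definition t_monomials :: "('n, 'k::zero) mpoly poly \<Rightarrow> ('n \<Rightarrow>\<^sub>0 nat) set" where
  "t_monomials A = (\<Union>j. Poly_Mapping.keys (Polynomial.coeff A j))"

definition degree_in :: "'n \<Rightarrow> ('n, 'k::zero) mpoly poly \<Rightarrow> nat" where
  "degree_in i A = Max (insert 0 ((\<lambda>m. Poly_Mapping.lookup m i) ` t_monomials A))"

definition total_degree :: "('n::finite, 'k::zero) mpoly poly \<Rightarrow> nat" where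
  "total_degree A = Max (insert 0 ((\<lambda>m. \<Sum>i\<in>UNIV. Poly_Mapping.lookup m i) ` t_monomials A))"

definition partial_height :: "('n, 'k::field) mfps \<Rightarrow> 'n \<Rightarrow> nat" where
  "partial_height f i = (LEAST h. \<exists>A. A \<noteq> 0 \<and> annihilates A f \<and> degree_in i A = h)"

definition total_height :: "('n::finite, 'k::field) mfps \<Rightarrow> nat" where
  "total_height f = (LEAST h. \<exists>A. A \<noteq> 0 \<and> annihilates A f \<and> total_degree A = h)"

lemma finite_t_monomials: "finite (t_monomials A)"
proof -
  have "t_monomials A \<subseteq> (\<Union>j\<in>{..Polynomial.degree A}. Poly_Mapping.keys (Polynomial.coeff A j))"
  proof
    fix m assume "m \<in> t_monomials A"
    then obtain j where j: "m \<in> Poly_Mapping.keys (Polynomial.coeff A j)"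
      unfolding t_monomials_def by (elim UN_E)
    hence "Polynomial.coeff A j \<noteq> 0"
      by (intro notI) simp
    hence "j \<le> Polynomial.degree A"
      by (rule le_degree)
    with j show "m \<in> (\<Union>j\<in>{..Polynomial.degree A}. Poly_Mapping.keys (Polynomial.coeff A j))"
      by (intro UN_I[of j]) simp_all
  qed
  thus ?thesis
    by (rule finite_subset) simp
qed

lemma mfps_of_mpoly_0: "mfps_of_mpoly 0 = 0"
  and mfps_of_mpoly_1: "mfps_of_mpoly 1 = 1"
  and mfps_of_mpoly_add: "mfps_of_mpoly (A + B) = mfps_of_mpoly A + mfps_of_mpoly B"
  and mfps_of_mpoly_uminus: "mfps_of_mpoly (- C) = - mfps_of_mpoly C"
  for A B C :: "('n, 'k::comm_ring_1) mpoly"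
  by (rule mfps_eqI; simp add: mfps_of_mpoly_def mfps_nth_one lookup_one lookup_add when_def)+

lemma mfps_of_mpoly_mult: "mfps_of_mpoly (A * B) = mfps_of_mpoly A * mfps_of_mpoly B"
  for A B :: "('n, 'k::comm_ring_1) mpoly"
proof (rule mfps_eqI)
  fix m
  have "mfps_nth (mfps_of_mpoly (A * B)) m = (\<Sum>(a, b). Poly_Mapping.lookup A a * Poly_Mapping.lookup B b when m = a + b)"
    by (simp add: mfps_of_mpoly_def times_poly_mapping.rep_eq prod_fun_unfold_prod)
  also have "\<dots> = (\<Sum>(a, b) | a + b = m. Poly_Mapping.lookup A a * Poly_Mapping.lookup B b when m = a + b)"
    using finite_add_decomp[of m]
    by (intro Sum_any.expand_superset) (auto simp: when_def split: if_splits)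
  also have "\<dots> = mfps_nth (mfps_of_mpoly A * mfps_of_mpoly B) m"
    unfolding mfps_nth_mult by (intro sum.cong) (auto simp: mfps_of_mpoly_def)
  finally show "mfps_nth (mfps_of_mpoly (A * B)) m = mfps_nth (mfps_of_mpoly A * mfps_of_mpoly B) m" .
qed

lemma mfps_of_mpoly_eq_0_iff: "mfps_of_mpoly A = 0 \<longleftrightarrow> A = 0"
  by (metis mfps_nth_Abs_mfps mfps_of_mpoly_0 mfps_of_mpoly_def poly_mapping_eq_iff)

lemma field_mfps_field: "field (mfps_field :: ('n::finite, 'k::field) mfps fract ring)"
  by (rule field_from_type_algebra)

lemma subfield_ratfuns: "subfield (ratfuns :: ('n::finite, 'k::field) mfps fract set) mfps_field"
proof -
  let ?R = "mfps_field :: ('n, 'k) mfps fract ring"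
  interpret R: field ?R by (rule field_mfps_field)
  note defs = ring_of_type_algebra_def
  have nz: "a \<noteq> 0 \<Longrightarrow> b \<noteq> 0 \<Longrightarrow> a * b \<noteq> 0" for a b :: "('n, 'k) mpoly"
    unfolding mfps_of_mpoly_eq_0_iff[symmetric] mfps_of_mpoly_mult by simp
  have ratI: "x \<in> ratfuns"
    if "x = Fraction_Field.Fract (mfps_of_mpoly a) (mfps_of_mpoly b)" "b \<noteq> 0"
    for x and a b :: "('n, 'k) mpoly"
    using that unfolding ratfuns_def by blast
  have add: "x + y \<in> ratfuns" and mult: "x * y \<in> ratfuns"
    if xy: "x \<in> ratfuns" "y \<in> ratfuns" for x y :: "('n, 'k) mfps fract"
  proof -
    obtain a b c d where *: "x = Fraction_Field.Fract (mfps_of_mpoly a) (mfps_of_mpoly b)" "b \<noteq> 0"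
      "y = Fraction_Field.Fract (mfps_of_mpoly c) (mfps_of_mpoly d)" "d \<noteq> 0"
      using xy by (auto simp: ratfuns_def)
    have "x + y = Fraction_Field.Fract (mfps_of_mpoly (a * d + c * b)) (mfps_of_mpoly (b * d))"
      using * by (simp add: mfps_of_mpoly_add mfps_of_mpoly_mult mfps_of_mpoly_eq_0_iff)
    thus "x + y \<in> ratfuns" using nz[OF *(2,4)] by (rule ratI)
    have "x * y = Fraction_Field.Fract (mfps_of_mpoly (a * c)) (mfps_of_mpoly (b * d))"
      using * by (simp add: mfps_of_mpoly_mult)
    thus "x * y \<in> ratfuns" using nz[OF *(2,4)] by (rule ratI)
  qed
  have one_in: "1 \<in> (ratfuns :: ('n, 'k) mfps fract set)"
    by (rule ratI[of _ 1 1]) (simp_all add: mfps_of_mpoly_1 One_fract_def)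
  have uminus: "- x \<in> ratfuns" and inverse: "x \<noteq> 0 \<Longrightarrow> inverse x \<in> ratfuns"
    if x: "x \<in> ratfuns" for x :: "('n, 'k) mfps fract"
  proof -
    obtain a b where *: "x = Fraction_Field.Fract (mfps_of_mpoly a) (mfps_of_mpoly b)" "b \<noteq> 0"
      using x by (auto simp: ratfuns_def)
    have "- x = Fraction_Field.Fract (mfps_of_mpoly (- a)) (mfps_of_mpoly b)"
      using * by (simp add: mfps_of_mpoly_uminus)
    thus "- x \<in> ratfuns" using *(2) by (rule ratI)
    assume "x \<noteq> 0"
    hence "a \<noteq> 0" using * by (auto simp: mfps_of_mpoly_0 fract_collapse)
    have "inverse x = Fraction_Field.Fract (mfps_of_mpoly b) (mfps_of_mpoly a)"
      using * by simp
    thus "inverse x \<in> ratfuns" using \<open>a \<noteq> 0\<close> by (rule ratI)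
  qed
  have carrier: "carrier ?R = UNIV" and ops: "x \<oplus>\<^bsub>?R\<^esub> y = x + y" "x \<otimes>\<^bsub>?R\<^esub> y = x * y"
    "\<one>\<^bsub>?R\<^esub> = 1" "\<zero>\<^bsub>?R\<^esub> = 0" for x y
    by (simp_all add: defs)
  have neg: "\<ominus>\<^bsub>?R\<^esub> x = - x" for x
    by (rule R.minus_equality) (simp_all add: carrier ops)
  have inv: "inv\<^bsub>?R\<^esub> x = inverse x" if "x \<noteq> 0" for x
    using that by (intro R.comm_inv_char) (simp_all add: carrier ops)
  show ?thesis
  proof (rule R.subfieldI')
    show "subring ratfuns ?R"
      by (rule R.subringI) (use add mult one_in uminus in \<open>auto simp: carrier ops neg\<close>)
  qed (use inverse in \<open>auto simp: ops inv\<close>)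
qed

end

theory Submission
  imports Defs
begin

text \<open>
  Let \<open>P\<close> be a polynomial of minimal degree \<open>d\<close> in \<open>y\<close> annihilating \<open>f\<close>; it is separable. Then
  \<open>f\<close> is the residue at \<open>y = f\<close> of \<open>A dy / P\<close> for \<open>A = y P\<^sub>y\<close>. Since
  \<open>A / P = A P\<^bsup>p-1\<^esup> / P\<^sup>p\<close>, the section operators map residues of this kind to residues of the same kind
  for the series and the polynomial whose coefficients are raised to the \<open>p\<close>-th power; working with these
  Frobenius twists avoids \<open>p\<close>-th roots, so \<open>k\<close> need not be perfect.
  The numerators that occur satisfy the height bounds and keep every divisibility \<open>c | P D\<close> with \<open>c\<close>
  in \<open>k[t]\<close>. Comparing leading exponents of \<open>A D / c\<close>, where \<open>P D / c\<close> runs over annihilators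
  realizing the heights, bounds the dimension of the space of residues by \<open>N\<^sub>1\<close>, although \<open>P\<close> itself is
  not assumed primitive. The form of Gauss's lemma needed for this follows from the Dedekind--Mertens
  lemma and the complete integral closedness of \<open>k[t]\<close>, without unique factorization.

  Section operators commute with Hadamard products, so the products of residues of \<open>f\<close> and \<open>g\<close> form spaces
  of dimension at most \<open>N = N\<^sub>1 N\<^sub>2\<close>, again stable under sections. Hence \<open>u\<^bsup>p\<^sup>i\<^esup>\<close> for \<open>i = 0, \<dots>, N\<close>,
  where \<open>u\<close> is the Hadamard product of \<open>f\<close> and \<open>g\<close>, all lie in the \<open>k(t)\<close>-span of \<open>N\<close> series and are
  linearly dependent; dividing the relation by \<open>u\<close> gives degree at most \<open>p\<^sup>N - 1\<close>.
\<close>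

no_notation var (\<open>X\<index>\<close>)


subsection \<open>Monomials and polynomials among the power series\<close>

text \<open>As there are finitely many variables, every function is an exponent vector;
  \<open>expo\<close> allows exponents to be given by formulas in their coordinates.\<close>

definition expo :: "('n::finite \<Rightarrow> nat) \<Rightarrow> 'n \<Rightarrow>\<^sub>0 nat" where
  "expo g = Abs_poly_mapping g"

lemma lookup_expo [simp]: "Poly_Mapping.lookup (expo g) = g"
  unfolding expo_def by (simp add: Abs_poly_mapping_inverse)

lemma expo_lookup [simp]: "expo (Poly_Mapping.lookup m) = m"
  by (intro poly_mapping_eqI) simp

lemma expo_eq_iff: "expo g = m \<longleftrightarrow> (\<forall>i. g i = Poly_Mapping.lookup m i)"
  by (auto simp: poly_mapping_eq_iff fun_eq_iff)

lemma eq_expo_iff: "m = expo g \<longleftrightarrow> (\<forall>i. Poly_Mapping.lookup m i = g i)"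
  by (auto simp: poly_mapping_eq_iff fun_eq_iff)

definition mfps_monom :: "('n \<Rightarrow>\<^sub>0 nat) \<Rightarrow> 'a::zero \<Rightarrow> ('n, 'a) mfps" where
  "mfps_monom r c = Abs_mfps (\<lambda>m. if m = r then c else 0)"

lemma mfps_nth_monom: "mfps_nth (mfps_monom r c) m = (if m = r then c else 0)"
  by (simp add: mfps_monom_def)

lemma mfps_nth_sum [simp]: "mfps_nth (sum F S) m = (\<Sum>x\<in>S. mfps_nth (F x) m)"
  for F :: "'b \<Rightarrow> ('n, 'a::comm_ring_1) mfps"
  by (induction S rule: infinite_finite_induct) auto

lemma mfps_nth_monom_mult_add:
  "mfps_nth (mfps_monom r c * X) (r + m) = c * mfps_nth X m"
  for X :: "('n, 'a::comm_ring_1) mfps"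
proof -
  have "mfps_nth (mfps_monom r c * X) (r + m) =
      (\<Sum>x\<in>{(a, b). a + b = r + m}. if x = (r, m) then c * mfps_nth X m else 0)"
    unfolding mfps_nth_mult by (rule sum.cong) (auto simp: mfps_nth_monom split: if_splits)
  also have "\<dots> = c * mfps_nth X m"
    using finite_add_decomp[of "r + m"] by (subst sum.delta) auto
  finally show ?thesis .
qed

lemma mfps_nth_monom_mult_not_add:
  "(\<And>m'. m \<noteq> r + m') \<Longrightarrow> mfps_nth (mfps_monom r c * X) m = 0"
  for X :: "('n, 'a::comm_ring_1) mfps"
  unfolding mfps_nth_mult by (rule sum.neutral) (auto simp: mfps_nth_monom)

lemma mfps_monom_mult: "mfps_monom a c * mfps_monom b d = mfps_monom (a + b) (c * d)"
  for c d :: "'a::comm_ring_1"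
proof (rule mfps_eqI)
  fix m
  show "mfps_nth (mfps_monom a c * mfps_monom b d) m = mfps_nth (mfps_monom (a + b) (c * d)) m"
  proof (cases "\<exists>m'. m = a + m'")
    case True
    then show ?thesis by (auto simp: mfps_nth_monom_mult_add mfps_nth_monom)
  next
    case False
    then show ?thesis by (auto simp: mfps_nth_monom_mult_not_add mfps_nth_monom)
  qed
qed

lemma mfps_monom_0_1 [simp]: "mfps_monom 0 1 = 1"
  by (rule mfps_eqI) (simp add: mfps_nth_monom mfps_nth_one)

text \<open>k[t] is kept as a subset of k[[t]], so that polynomials, series and divisibility all
  live in one integral domain.\<close>

definition mpolys :: "('n, 'k::zero) mfps set" where
  "mpolys = {f. finite {m. mfps_nth f m \<noteq> 0}}"

lemma mpolys_eq_range: "mpolys = range mfps_of_mpoly"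
proof (intro equalityI subsetI)
  fix f :: "('n, 'k::zero) mfps" assume "f \<in> mpolys"
  then have "mfps_of_mpoly (Abs_poly_mapping (mfps_nth f)) = f"
    by (intro mfps_eqI) (simp add: mpolys_def mfps_of_mpoly_def Abs_poly_mapping_inverse)
  then show "f \<in> range mfps_of_mpoly" by (metis rangeI)
qed (auto simp: mpolys_def mfps_of_mpoly_def finite_lookup)

lemma mpolys_0 [simp, intro]: "0 \<in> mpolys"
  and mpolys_1 [simp, intro]: "1 \<in> mpolys"
  and mpolys_add: "x \<in> mpolys \<Longrightarrow> y \<in> mpolys \<Longrightarrow> x + y \<in> mpolys"
  and mpolys_uminus: "x \<in> mpolys \<Longrightarrow> - x \<in> mpolys"
  and mpolys_mult: "x \<in> mpolys \<Longrightarrow> y \<in> mpolys \<Longrightarrow> x * y \<in> mpolys"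
  for x y :: "('n, 'k::comm_ring_1) mfps"
  unfolding mpolys_eq_range
  by (auto simp: image_iff mfps_of_mpoly_0 [symmetric] mfps_of_mpoly_1 [symmetric]
      mfps_of_mpoly_add [symmetric] mfps_of_mpoly_uminus [symmetric]
      mfps_of_mpoly_mult [symmetric] simp del: image_eqI)

lemma mpolys_diff: "x \<in> mpolys \<Longrightarrow> y \<in> mpolys \<Longrightarrow> x - y \<in> mpolys"
  for x y :: "('n, 'k::comm_ring_1) mfps"
  using mpolys_add[of x "- y"] mpolys_uminus[of y] by simp

lemma mpolys_sum: "(\<And>x. x \<in> S \<Longrightarrow> F x \<in> mpolys) \<Longrightarrow> sum F S \<in> mpolys"
  for F :: "'b \<Rightarrow> ('n, 'k::comm_ring_1) mfps"
  by (induction S rule: infinite_finite_induct) (auto intro: mpolys_add)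

lemma mpolys_power: "x \<in> mpolys \<Longrightarrow> x ^ n \<in> mpolys"
  for x :: "('n, 'k::comm_ring_1) mfps"
  by (induction n) (auto intro: mpolys_mult)

lemma mpolys_of_nat: "of_nat n \<in> (mpolys :: ('n, 'k::comm_ring_1) mfps set)"
  by (induction n) (auto intro: mpolys_add)

lemma mpolys_monom [simp, intro]: "mfps_monom r c \<in> mpolys"
proof -
  have "{m. mfps_nth (mfps_monom r c) m \<noteq> 0} \<subseteq> {r}"
    by (auto simp: mfps_nth_monom)
  then show ?thesis unfolding mpolys_def by (simp add: finite_subset)
qed

subsection \<open>Frobenius, stretching and sections\<close>

text \<open>In characteristic p this is the ring endomorphism that twists the constants and fixes
  the variables. Together with \<open>stretch\<close>, the substitution of the p-th powers of the
  variables, it factors the p-th power map (\<open>power_p\<close>).\<close>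

definition coeff_frob :: "nat \<Rightarrow> ('n, 'k::power) mfps \<Rightarrow> ('n, 'k) mfps" where
  "coeff_frob p X = Abs_mfps (\<lambda>m. mfps_nth X m ^ p)"

definition stretch :: "nat \<Rightarrow> ('n::finite, 'k::zero) mfps \<Rightarrow> ('n, 'k) mfps" where
  "stretch p X = Abs_mfps (\<lambda>m. if \<forall>i. p dvd Poly_Mapping.lookup m i
     then mfps_nth X (expo (\<lambda>i. Poly_Mapping.lookup m i div p)) else 0)"

text \<open>The section operator of the digit vector r. No p-th root of a coefficient is taken, so
  it is linear over k, and for digits below p a factor \<open>X ^ p\<close> comes out as
  \<open>coeff_frob p X\<close> instead of X.\<close>

definition mfps_section :: "nat \<Rightarrow> ('n \<Rightarrow> nat) \<Rightarrow> ('n::finite, 'k) mfps \<Rightarrow> ('n, 'k) mfps" where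
  "mfps_section p r X = Abs_mfps (\<lambda>m. mfps_nth X (expo (\<lambda>i. p * Poly_Mapping.lookup m i + r i)))"

lemma mfps_nth_coeff_frob [simp]: "mfps_nth (coeff_frob p X) m = mfps_nth X m ^ p"
  by (simp add: coeff_frob_def)

lemma mfps_nth_section [simp]:
  "mfps_nth (mfps_section p r X) m = mfps_nth X (expo (\<lambda>i. p * Poly_Mapping.lookup m i + r i))"
  by (simp add: mfps_section_def)

lemma section_0 [simp]: "mfps_section p r 0 = (0 :: ('n::finite, 'k::comm_ring_1) mfps)"
  and section_add: "mfps_section p r (X + Y) = mfps_section p r X + mfps_section p r Y"
  for X Y :: "('n::finite, 'k::comm_ring_1) mfps"
  by (rule mfps_eqI; simp)+

lemma section_hadamard:
  "mfps_section p r (hadamard X Y) = hadamard (mfps_section p r X) (mfps_section p r Y)"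
  by (rule mfps_eqI) (simp add: hadamard_def)

lemma coeff_frob_hadamard:
  "coeff_frob p (hadamard X Y) = hadamard (coeff_frob p X) (coeff_frob p Y)"
  for X Y :: "('n, 'k::comm_semiring_1) mfps"
  by (rule mfps_eqI) (simp add: hadamard_def power_mult_distrib)

section \<open>Frobenius, substitution of p-th powers and sections in characteristic p\<close>

locale char_p =
  fixes p :: nat and ty :: "'k::field itself"
  assumes char: "CHAR('k) = p" and prime_p: "prime p"
begin

lemma p_pos: "p > 0"
  using prime_p prime_gt_0_nat by blast

lemma frob_add: "(x + y) ^ p = x ^ p + y ^ p" for x y :: 'k
  by (rule freshmans_dream) (simp_all add: char prime_p)

lemma frob_sum: "sum F S ^ p = (\<Sum>x\<in>S. F x ^ p)" for F :: "'b \<Rightarrow> 'k"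
  by (rule freshmans_dream_sum) (simp_all add: char prime_p)

lemma mfps_char: "CHAR(('n, 'k) mfps) = p"
proof (rule CHAR_eqI)
  have *: "mfps_nth (of_nat n :: ('n, 'k) mfps) m = (if m = 0 then of_nat n else 0)" for n m
    by (induction n) (auto simp: mfps_nth_one)
  show "of_nat p = (0 :: ('n, 'k) mfps)"
    using char by (intro mfps_eqI) (auto simp: * of_nat_eq_0_iff_char_dvd)
  fix n assume "of_nat n = (0 :: ('n, 'k) mfps)"
  then have "mfps_nth (of_nat n :: ('n, 'k) mfps) 0 = 0" by simp
  then show "p dvd n" using char by (simp add: * of_nat_eq_0_iff_char_dvd)
qed

lemma mfps_frob_add: "(X + Y) ^ p = X ^ p + Y ^ p" for X Y :: "('n::finite, 'k) mfps"
  by (rule freshmans_dream) (simp_all add: mfps_char prime_p)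

lemma mfps_frob_sum: "sum F S ^ p = (\<Sum>x\<in>S. F x ^ p)" for F :: "'b \<Rightarrow> ('n::finite, 'k) mfps"
  by (rule freshmans_dream_sum) (simp_all add: mfps_char prime_p)

lemma mfps_poly_frob_add: "(X + Y) ^ p = X ^ p + Y ^ p" for X Y :: "('n::finite, 'k) mfps poly"
  by (rule freshmans_dream) (simp_all add: mfps_char prime_p)

lemma coeff_frob_0 [simp]: "coeff_frob p (0 :: ('n, 'k) mfps) = 0"
  and coeff_frob_1 [simp]: "coeff_frob p (1 :: ('n, 'k) mfps) = 1"
  using p_pos by (auto intro!: mfps_eqI simp: mfps_nth_one power_0_left)

lemma coeff_frob_add: "coeff_frob p (X + Y) = coeff_frob p X + coeff_frob p Y"
  and coeff_frob_mult: "coeff_frob p (X * Y) = coeff_frob p X * coeff_frob p Y"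
  for X Y :: "('n, 'k) mfps"
  by (rule mfps_eqI; simp add: frob_add mfps_nth_mult frob_sum power_mult_distrib
      case_prod_unfold)+

lemma coeff_frob_eq_0_iff [simp]: "coeff_frob p X = 0 \<longleftrightarrow> X = 0" for X :: "('n, 'k) mfps"
  using p_pos by (auto simp: mfps_eq_0_iff)

lemma coeff_frob_mpolys: "X \<in> mpolys \<Longrightarrow> coeff_frob p X \<in> mpolys" for X :: "('n, 'k) mfps"
  using p_pos by (simp add: mpolys_def)

abbreviation pscale :: "('n::finite \<Rightarrow>\<^sub>0 nat) \<Rightarrow> 'n \<Rightarrow>\<^sub>0 nat" where
  "pscale m \<equiv> expo (\<lambda>i. p * Poly_Mapping.lookup m i)"

lemma stretch_nth_pscale [simp]: "mfps_nth (stretch p X) (pscale m) = mfps_nth X m"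
  for X :: "('n::finite, 'k) mfps"
  using p_pos by (simp add: stretch_def)

lemma stretch_nth_other: "\<nexists>m'. m = pscale m' \<Longrightarrow> mfps_nth (stretch p X) m = 0"
  for X :: "('n::finite, 'k) mfps"
proof -
  assume *: "\<nexists>m'. m = pscale m'"
  have "\<not> (\<forall>i. p dvd Poly_Mapping.lookup m i)"
  proof
    assume "\<forall>i. p dvd Poly_Mapping.lookup m i"
    then have "m = pscale (expo (\<lambda>i. Poly_Mapping.lookup m i div p))"
      by (simp add: eq_expo_iff)
    with * show False by blast
  qed
  then show ?thesis unfolding stretch_def by auto
qed

lemma stretch_eqI:
  fixes X Y :: "('n::finite, 'k) mfps"
  assumes "\<And>m. mfps_nth Y (pscale m) = mfps_nth X m"
    and "\<And>m. \<nexists>m'. m = pscale m' \<Longrightarrow> mfps_nth Y m = 0"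
  shows "stretch p X = Y"
proof (rule mfps_eqI)
  fix m show "mfps_nth (stretch p X) m = mfps_nth Y m"
    by (cases "\<exists>m'. m = pscale m'") (use assms stretch_nth_other[of m X] in auto)
qed

lemma pscale_inj [simp]: "pscale a = pscale b \<longleftrightarrow> a = b" for a b :: "'n::finite \<Rightarrow>\<^sub>0 nat"
  using p_pos by (auto simp: expo_eq_iff poly_mapping_eq_iff fun_eq_iff)

lemma pscale_add: "pscale (a + b) = pscale a + pscale b" for a b :: "'n::finite \<Rightarrow>\<^sub>0 nat"
  by (simp add: expo_eq_iff lookup_add algebra_simps)

lemma stretch_0 [simp]: "stretch p (0 :: ('n::finite, 'k) mfps) = 0"
  by (rule mfps_eqI) (simp add: stretch_def)

lemma stretch_add: "stretch p (X + Y) = stretch p X + stretch p Y"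
  for X Y :: "('n::finite, 'k) mfps"
  by (rule mfps_eqI) (simp add: stretch_def)

text \<open>The series \<open>stretch p X\<close> involves only exponents divisible by p, so a
  product exponent with digits r forces the exponent coming from Y to have digits r as well.\<close>

lemma section_stretch_mult:
  fixes X Y :: "('n::finite, 'k) mfps"
  assumes r: "\<And>i. r i < p"
  shows "mfps_section p r (stretch p X * Y) = X * mfps_section p r Y"
proof (rule mfps_eqI)
  fix m
  let ?m = "expo (\<lambda>i. p * Poly_Mapping.lookup m i + r i)"
  let ?T = "{(a, b). a + b = ?m} \<inter> {(a, b). \<exists>a'. a = pscale a'}"
  have "mfps_nth (mfps_section p r (stretch p X * Y)) m =
      (\<Sum>(a, b) | a + b = ?m. mfps_nth (stretch p X) a * mfps_nth Y b)"
    by (simp add: mfps_nth_mult)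
  also have "\<dots> = (\<Sum>(a, b)\<in>?T. mfps_nth (stretch p X) a * mfps_nth Y b)"
    by (rule sum.mono_neutral_right) (use finite_add_decomp stretch_nth_other[of _ X] in \<open>auto, blast\<close>)
  also have "\<dots> = (\<Sum>(a, b) | a + b = m. mfps_nth X a * mfps_nth Y (expo (\<lambda>i. p * Poly_Mapping.lookup b i + r i)))"
  proof (rule sum.reindex_bij_witness
      [where i = "\<lambda>(a, b). (pscale a, expo (\<lambda>i. p * Poly_Mapping.lookup b i + r i))"
         and j = "\<lambda>(a, b). (expo (\<lambda>i. Poly_Mapping.lookup a i div p), expo (\<lambda>i. Poly_Mapping.lookup b i div p))"])
    fix x assume "x \<in> ?T"
    then obtain a b where x: "x = (pscale a, b)" and s: "pscale a + b = ?m" by auto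
    have s': "p * Poly_Mapping.lookup a i + Poly_Mapping.lookup b i = p * Poly_Mapping.lookup m i + r i" for i
      using arg_cong[OF s, of "\<lambda>z. Poly_Mapping.lookup z i"] by (simp add: lookup_add)
    \<comment> \<open>The digit bound enters here: p a_i <= p m_i + r_i < p (m_i + 1).\<close>
    have le: "Poly_Mapping.lookup a i \<le> Poly_Mapping.lookup m i" for i
    proof (rule ccontr)
      assume "\<not> ?thesis"
      then have "p * (Poly_Mapping.lookup m i + 1) \<le> p * Poly_Mapping.lookup a i"
        by (intro mult_left_mono) auto
      then show False using s'[of i] r[of i] by simp
    qed
    have b: "Poly_Mapping.lookup b i = p * (Poly_Mapping.lookup m i - Poly_Mapping.lookup a i) + r i" for i
      using s'[of i] le[of i] by (simp add: right_diff_distrib')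
    have b': "Poly_Mapping.lookup b i div p = Poly_Mapping.lookup m i - Poly_Mapping.lookup a i" for i
      using r[of i] by (simp add: b)
    have bb: "b = expo (\<lambda>i. p * (Poly_Mapping.lookup m i - Poly_Mapping.lookup a i) + r i)"
      by (simp add: eq_expo_iff b)
    show "(case case x of (a, b) \<Rightarrow> (expo (\<lambda>i. Poly_Mapping.lookup a i div p), expo (\<lambda>i. Poly_Mapping.lookup b i div p)) of
          (a, b) \<Rightarrow> (pscale a, expo (\<lambda>i. p * Poly_Mapping.lookup b i + r i))) = x"
      using p_pos r by (simp add: x b' bb)
    show "(case x of (a, b) \<Rightarrow> (expo (\<lambda>i. Poly_Mapping.lookup a i div p), expo (\<lambda>i. Poly_Mapping.lookup b i div p)))
        \<in> {(a, b). a + b = m}"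
      using p_pos le by (simp add: x b' poly_mapping_eq_iff fun_eq_iff lookup_add)
    show "(case case x of (a, b) \<Rightarrow> (expo (\<lambda>i. Poly_Mapping.lookup a i div p), expo (\<lambda>i. Poly_Mapping.lookup b i div p)) of
          (a, b) \<Rightarrow> mfps_nth X a * mfps_nth Y (expo (\<lambda>i. p * Poly_Mapping.lookup b i + r i))) =
         (case x of (a, b) \<Rightarrow> mfps_nth (stretch p X) a * mfps_nth Y b)"
      using p_pos r by (simp add: x b' bb)
  next
    fix x assume "x \<in> {(a, b). a + b = m}"
    then obtain a b where x: "x = (a, b)" "a + b = m" by auto
    show "(case case x of (a, b) \<Rightarrow> (pscale a, expo (\<lambda>i. p * Poly_Mapping.lookup b i + r i)) of
          (a, b) \<Rightarrow> (expo (\<lambda>i. Poly_Mapping.lookup a i div p), expo (\<lambda>i. Poly_Mapping.lookup b i div p))) = x"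
      using p_pos r by (simp add: x)
    show "(case x of (a, b) \<Rightarrow> (pscale a, expo (\<lambda>i. p * Poly_Mapping.lookup b i + r i))) \<in> ?T"
      using x by (auto simp: eq_expo_iff lookup_add algebra_simps)
  qed
  also have "\<dots> = mfps_nth (X * mfps_section p r Y) m"
    by (simp add: mfps_nth_mult)
  finally show "mfps_nth (mfps_section p r (stretch p X * Y)) m = mfps_nth (X * mfps_section p r Y) m" .
qed

lemma stretch_monom: "stretch p (mfps_monom a c) = mfps_monom (pscale a) c" for c :: 'k
  by (rule stretch_eqI) (auto simp: mfps_nth_monom)

lemma monom_power: "mfps_monom a c ^ n = mfps_monom (expo (\<lambda>i. n * Poly_Mapping.lookup a i)) (c ^ n)"
  for c :: 'k and a :: "'n::finite \<Rightarrow>\<^sub>0 nat"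
proof (induction n)
  case 0
  have "expo (\<lambda>i::'n. 0) = 0" by (simp add: expo_eq_iff)
  then show ?case by simp
next
  case (Suc n)
  have "a + expo (\<lambda>i. n * Poly_Mapping.lookup a i) = expo (\<lambda>i. Suc n * Poly_Mapping.lookup a i)"
    by (simp add: eq_expo_iff lookup_add)
  then show ?case by (simp only: power_Suc Suc mfps_monom_mult)
qed

lemma section_0_stretch: "mfps_section p (\<lambda>_. 0) (stretch p X) = X" for X :: "('n::finite, 'k) mfps"
  by (rule mfps_eqI) simp

text \<open>At exponents divisible by p the claim is \<open>section_stretch_mult\<close> for zero
  digits; elsewhere both sides vanish, because the multiples of p are closed under addition.\<close>

lemma stretch_mult: "stretch p (X * Y) = stretch p X * stretch p Y"
  for X Y :: "('n::finite, 'k) mfps"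
proof (rule stretch_eqI)
  fix m
  have "mfps_nth (stretch p X * stretch p Y) (pscale m) =
      mfps_nth (mfps_section p (\<lambda>_. 0) (stretch p X * stretch p Y)) m"
    by simp
  also have "\<dots> = mfps_nth (X * Y) m"
    using p_pos by (subst section_stretch_mult) (simp_all add: section_0_stretch)
  finally show "mfps_nth (stretch p X * stretch p Y) (pscale m) = mfps_nth (X * Y) m" .
next
  fix m :: "'n \<Rightarrow>\<^sub>0 nat" assume m: "\<nexists>m'. m = pscale m'"
  have "mfps_nth (stretch p X) a * mfps_nth (stretch p Y) b = 0" if "a + b = m" for a b
  proof (rule ccontr)
    assume "mfps_nth (stretch p X) a * mfps_nth (stretch p Y) b \<noteq> 0"
    then obtain a' b' where "a = pscale a'" "b = pscale b'"
      using stretch_nth_other[of a X] stretch_nth_other[of b Y] by fastforce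
    with that m pscale_add[of a' b'] show False by metis
  qed
  then show "mfps_nth (stretch p X * stretch p Y) m = 0"
    unfolding mfps_nth_mult by (intro sum.neutral) auto
qed

lemma stretch_eq_0_iff [simp]: "stretch p X = 0 \<longleftrightarrow> X = 0" for X :: "('n::finite, 'k) mfps"
  by (metis stretch_0 stretch_nth_pscale mfps_eq_0_iff)

lemma stretch_sum: "stretch p (sum F S) = (\<Sum>x\<in>S. stretch p (F x))"
  for F :: "'b \<Rightarrow> ('n::finite, 'k) mfps"
  by (induction S rule: infinite_finite_induct) (auto simp: stretch_add)

lemma coeff_frob_sum: "coeff_frob p (sum F S) = (\<Sum>x\<in>S. coeff_frob p (F x))"
  for F :: "'b \<Rightarrow> ('n::finite, 'k) mfps"
  by (induction S rule: infinite_finite_induct) (auto simp: coeff_frob_add)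

lemma stretch_mpolys: "X \<in> mpolys \<Longrightarrow> stretch p X \<in> mpolys" for X :: "('n::finite, 'k) mfps"
proof -
  assume X: "X \<in> mpolys"
  have "{m. mfps_nth (stretch p X) m \<noteq> 0} \<subseteq> pscale ` {m. mfps_nth X m \<noteq> 0}"
  proof
    fix m assume m: "m \<in> {m. mfps_nth (stretch p X) m \<noteq> 0}"
    then obtain m' where "m = pscale m'" using stretch_nth_other[of m X] by blast
    with m show "m \<in> pscale ` {m. mfps_nth X m \<noteq> 0}" by simp
  qed
  then show ?thesis using X unfolding mpolys_def by (auto intro: finite_subset)
qed

lemma section_mpolys: "X \<in> mpolys \<Longrightarrow> mfps_section p r X \<in> mpolys" for X :: "('n::finite, 'k) mfps"
proof -
  assume X: "X \<in> mpolys"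
  let ?e = "\<lambda>m :: 'n \<Rightarrow>\<^sub>0 nat. expo (\<lambda>i. p * Poly_Mapping.lookup m i + r i)"
  have "inj ?e"
    using p_pos by (auto intro!: injI simp: expo_eq_iff poly_mapping_eq_iff fun_eq_iff)
  then have "finite (?e -` {m. mfps_nth X m \<noteq> 0})"
    using X by (intro finite_vimageI) (auto simp: mpolys_def)
  then show ?thesis by (simp add: mpolys_def vimage_def)
qed

lemma coeff_frob_stretch: "coeff_frob p (stretch p X) = stretch p (coeff_frob p X)"
  for X :: "('n::finite, 'k) mfps"
  using p_pos by (intro mfps_eqI) (auto simp: stretch_def power_0_left)

text \<open>
  At a given exponent \<open>m\<close> only the finitely many coefficients at divisors of \<open>m\<close> matter,
  so additivity of both sides reduces the claim to monomials.
\<close>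

lemma power_p: "X ^ p = stretch p (coeff_frob p X)" for X :: "('n::finite, 'k) mfps"
proof (rule mfps_eqI)
  fix m :: "'n \<Rightarrow>\<^sub>0 nat"
  define S where "S = {a. \<exists>b. a + b = m}"
  have "S = fst ` {(a, b). a + b = m}" by (force simp: S_def)
  then have fin: "finite S" using finite_add_decomp[of m] by simp
  define X1 where "X1 = (\<Sum>a\<in>S. mfps_monom a (mfps_nth X a))"
  define X2 where "X2 = X - X1"
  have X2: "mfps_nth X2 a = 0" if "a \<in> S" for a
    using that fin by (simp add: X2_def X1_def mfps_nth_monom)
  have "mfps_nth (X2 * X2 ^ (p - 1)) m = 0"
    unfolding mfps_nth_mult using X2 by (intro sum.neutral) (auto simp: S_def)
  then have 1: "mfps_nth (X2 ^ p) m = 0"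
    using p_pos by (simp flip: power_Suc)
  have 2: "mfps_nth (stretch p (coeff_frob p X2)) m = 0"
  proof (cases "\<exists>m'. m = pscale m'")
    case True
    then obtain m' where m: "m = pscale m'" by blast
    have "m' + expo (\<lambda>i. (p - 1) * Poly_Mapping.lookup m' i) = m"
      using p_pos by (simp add: m eq_expo_iff lookup_add algebra_simps)
    then have "m' \<in> S" by (auto simp: S_def)
    then show ?thesis using X2 p_pos by (simp add: m)
  qed (use stretch_nth_other in blast)
  have 3: "X1 ^ p = stretch p (coeff_frob p X1)"
  proof -
    have "coeff_frob p (mfps_monom a c) = mfps_monom a (c ^ p)" for a :: "'n \<Rightarrow>\<^sub>0 nat" and c :: 'k
      using p_pos by (intro mfps_eqI) (simp add: mfps_nth_monom)
    then show ?thesis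
      by (simp add: X1_def mfps_frob_sum coeff_frob_sum stretch_sum monom_power stretch_monom)
  qed
  have X: "X = X1 + X2" by (simp add: X2_def)
  show "mfps_nth (X ^ p) m = mfps_nth (stretch p (coeff_frob p X)) m"
    unfolding X mfps_frob_add coeff_frob_add stretch_add by (simp add: 1 2 3)
qed

section \<open>Base-p digits of exponents\<close>

abbreviation residues_p :: "('n::finite \<Rightarrow> nat) set" where
  "residues_p \<equiv> {r. \<forall>i. r i < p}"

lemma finite_residues_p: "finite (residues_p :: ('n::finite \<Rightarrow> nat) set)"
proof -
  have "finite (PiE (UNIV :: 'n set) (\<lambda>_. {..<p}))" by (intro finite_PiE) auto
  moreover have "residues_p = PiE (UNIV :: 'n set) (\<lambda>_. {..<p})" by (auto simp: PiE_def)
  ultimately show ?thesis by simp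
qed

text \<open>Every exponent is r + p m' with digits r below p in exactly one way. Hence, if all
  sections of a series lie in the k[t]-span of some series, the series itself lies in the k[t]-span
  of their stretches.\<close>

lemma section_decomp:
  "X = (\<Sum>r\<in>residues_p. mfps_monom (expo r) 1 * stretch p (mfps_section p r X))"
  for X :: "('n::finite, 'k) mfps"
proof (rule mfps_eqI)
  fix m :: "'n \<Rightarrow>\<^sub>0 nat"
  define r0 where "r0 = (\<lambda>i. Poly_Mapping.lookup m i mod p)"
  define m' where "m' = expo (\<lambda>i. Poly_Mapping.lookup m i div p)"
  have r0: "r0 \<in> residues_p" using p_pos by (simp add: r0_def)
  have m: "m = expo r0 + pscale m'"
    by (simp add: poly_mapping_eq_iff lookup_add fun_eq_iff r0_def m'_def)
  have "mfps_nth (mfps_monom (expo r) 1 * stretch p (mfps_section p r X)) m =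
      (if r = r0 then mfps_nth X m else 0)" if r: "r \<in> residues_p" for r
  proof (cases "r = r0")
    case True
    have "expo (\<lambda>i. p * Poly_Mapping.lookup m' i + r0 i) = m"
      by (simp add: expo_eq_iff r0_def m'_def)
    then have "mfps_nth (mfps_monom (expo r0) 1 * stretch p (mfps_section p r0 X)) (expo r0 + pscale m') =
        mfps_nth X m"
      by (simp add: mfps_nth_monom_mult_add)
    with True show ?thesis by (simp flip: m)
  next
    case False
    have "mfps_nth (mfps_monom (expo r) 1 * stretch p (mfps_section p r X)) m = 0"
    proof (cases "\<exists>a. m = expo r + pscale a")
      case True
      then obtain a where a: "m = expo r + pscale a" by blast
      have "r i = r0 i" for i
        using r arg_cong[OF a, of "\<lambda>z. Poly_Mapping.lookup z i"] by (simp add: r0_def lookup_add)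
      with False show ?thesis by auto
    next
      case no: False
      show ?thesis
      proof (cases "\<exists>a. m = expo r + a")
        case True
        then obtain a where a: "m = expo r + a" by blast
        then have "\<nexists>b. a = pscale b" using no by auto
        then show ?thesis unfolding a mfps_nth_monom_mult_add by (simp add: stretch_nth_other)
      qed (use mfps_nth_monom_mult_not_add in blast)
    qed
    with False show ?thesis by simp
  qed
  then have "mfps_nth (\<Sum>r\<in>residues_p. mfps_monom (expo r) 1 * stretch p (mfps_section p r X)) m =
      (\<Sum>r\<in>residues_p. if r = r0 then mfps_nth X m else 0)"
    by simp
  also have "\<dots> = mfps_nth X m"
    using r0 finite_residues_p by (subst sum.delta) auto
  finally show "mfps_nth X m =
      mfps_nth (\<Sum>r\<in>residues_p. mfps_monom (expo r) 1 * stretch p (mfps_section p r X)) m" ..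
qed

end

subsection \<open>The Dedekind--Mertens lemma\<close>

text \<open>Generators of the m-th power of the content ideal of F.\<close>

primrec coeff_prods :: "'a::comm_ring_1 poly \<Rightarrow> nat \<Rightarrow> 'a set" where
  "coeff_prods F 0 = {1}"
| "coeff_prods F (Suc m) = {coeff F i * x | i x. x \<in> coeff_prods F m}"

lemma coeff_mult_top:
  fixes F G :: "'a::comm_ring_1 poly"
  assumes "degree F \<le> k" "degree G \<le> m"
  shows "coeff (F * G) (k + m) = coeff F k * coeff G m"
proof -
  have "coeff (F * G) (k + m) = (\<Sum>i\<le>k + m. if i = k then coeff F k * coeff G m else 0)"
    unfolding coeff_mult
  proof (rule sum.cong [OF refl])
    fix i assume "i \<in> {..k + m}"
    then show "coeff F i * coeff G (k + m - i) = (if i = k then coeff F k * coeff G m else 0)"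
      using assms by (cases i k rule: linorder_cases) (auto simp: coeff_eq_0)
  qed
  then show ?thesis by simp
qed

lemma coeff_prods_mono:
  assumes "\<And>i. coeff F' i = coeff F i \<or> coeff F' i = 0" and "x \<in> coeff_prods F' m"
  shows "x \<in> coeff_prods F m \<or> x = 0"
  using assms(2)
proof (induction m arbitrary: x)
  case (Suc m)
  then obtain i y where x: "x = coeff F' i * y" "y \<in> coeff_prods F' m" by auto
  then show ?case
    using Suc.IH[OF x(2)] assms(1)[of i]
    unfolding x(1) coeff_prods.simps mem_Collect_eq by (elim disjE) (metis, simp_all)
qed simp

text \<open>In terms of content ideals: c(F)^(m+1) c(G) lies in c(F)^m c(F G) when G has degree at
  most m. Testing membership in an additive subgroup N instead of an ideal serves both uses: the
  multiples c J of an ideal in \<open>gauss_dvd\<close>, and the series of bounded degree in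
  \<open>gauss_deg\<close>. Leading coefficients are removed one at a time, from G in the outer and
  from F in the inner induction.\<close>

lemma dedekind_mertens:
  fixes F G :: "'a::comm_ring_1 poly"
  assumes N0: "0 \<in> N" and N: "\<And>x y. x \<in> N \<Longrightarrow> y \<in> N \<Longrightarrow> x - y \<in> N"
    and "degree G \<le> m"
    and "\<And>x l. x \<in> coeff_prods F m \<Longrightarrow> x * coeff (F * G) l \<in> N"
    and "x \<in> coeff_prods F (Suc m)"
  shows "x * coeff G j \<in> N"
  using assms(3-)
proof (induction m arbitrary: F G x j)
  have Nadd: "x + y \<in> N" if "x \<in> N" "y \<in> N" for x y
    using N[OF that(1) N[OF N0 that(2)]] by simp
  \<comment> \<open>Inner induction: the coefficients of F vanish from index k on.
    \<open>top\<close> handles the generators that contain the highest remaining coefficient f; the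
    others only involve F without that term, and dropping the term changes the coefficients of F G
    by elements that \<open>top\<close> controls.\<close>
  have step: "x * coeff G j \<in> N"
    if G: "degree G \<le> m" and F: "\<And>i. i \<ge> k \<Longrightarrow> coeff F i = 0"
      and H: "\<And>x l. x \<in> coeff_prods F m \<Longrightarrow> x * coeff (F * G) l \<in> N"
      and x: "x \<in> coeff_prods F (Suc m)"
      and top: "\<And>F k x j. (\<And>x l. x \<in> coeff_prods F m \<Longrightarrow> x * coeff (F * G) l \<in> N) \<Longrightarrow>
         degree F \<le> k \<Longrightarrow> x \<in> coeff_prods F m \<Longrightarrow> x * (coeff F k * coeff G j) \<in> N"
    for m k F G x j
    using F H x
  proof (induction k arbitrary: F x j)
    case 0
    then have "x = 0" by auto
    then show ?case using N0 by simp
  next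
    case (Suc k)
    define f where "f = coeff F k"
    define F' where "F' = F - monom f k"
    have deg: "degree F \<le> k" using Suc.prems(1) by (intro degree_le) auto
    have top': "y * (f * coeff G i) \<in> N" if "y \<in> coeff_prods F m" for y i
      unfolding f_def by (rule top[OF Suc.prems(2) deg that])
    have F'i: "coeff F' i = coeff F i \<or> coeff F' i = 0" for i
      by (simp add: F'_def f_def)
    have sub: "y \<in> coeff_prods F m \<or> y = 0" if "y \<in> coeff_prods F' m" for y m
      using coeff_prods_mono[OF F'i that] .
    have IH: "y * coeff G i \<in> N" if "y \<in> coeff_prods F' (Suc m)" for y i
    proof (rule Suc.IH[OF _ _ that])
      show "coeff F' i = 0" if "k \<le> i" for i
        using Suc.prems(1)[of i] that by (cases "i = k") (auto simp: F'_def f_def)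
      fix z l assume z: "z \<in> coeff_prods F' m"
      have "coeff (F' * G) l = coeff (F * G) l - f * (if l < k then 0 else coeff G (l - k))"
        by (simp add: F'_def left_diff_distrib coeff_monom_mult)
      then have "z * coeff (F' * G) l = z * coeff (F * G) l - (if l < k then 0 else z * (f * coeff G (l - k)))"
        by (cases "l < k") (simp_all add: right_diff_distrib ac_simps)
      then show "z * coeff (F' * G) l \<in> N"
        using sub[OF z] Suc.prems(2) top' N N0 by auto
    qed
    have split: "y \<in> coeff_prods F' m' \<or> (\<exists>z m''. m' = Suc m'' \<and> y = f * z \<and> z \<in> coeff_prods F m'')"
      if "y \<in> coeff_prods F m'" for y m'
      using that
    proof (induction m' arbitrary: y)
      case (Suc m')
      then obtain i z where y: "y = coeff F i * z" "z \<in> coeff_prods F m'" by auto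
      show ?case
      proof (cases "i = k")
        case True
        then show ?thesis using y by (auto simp: f_def)
      next
        case False
        from Suc.IH[OF y(2)] show ?thesis
        proof
          assume "z \<in> coeff_prods F' m'"
          moreover have "coeff F' i = coeff F i" using False by (simp add: F'_def)
          ultimately have "y \<in> coeff_prods F' (Suc m')"
            unfolding y(1) coeff_prods.simps by (smt (verit) mem_Collect_eq)
          then show ?thesis ..
        next
          assume "\<exists>u m''. m' = Suc m'' \<and> z = f * u \<and> u \<in> coeff_prods F m''"
          then obtain u m'' where u: "m' = Suc m''" "z = f * u" "u \<in> coeff_prods F m''" by blast
          have "coeff F i * u \<in> coeff_prods F m'" unfolding u(1) using u(3) by auto
          moreover have "y = f * (coeff F i * u)" by (simp add: y u ac_simps)
          ultimately show ?thesis by blast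
        qed
      qed
    qed simp
    from split[OF Suc.prems(3)] show ?case
    proof
      assume "\<exists>z m''. Suc m = Suc m'' \<and> x = f * z \<and> z \<in> coeff_prods F m''"
      then obtain z where z: "x = f * z" "z \<in> coeff_prods F m" by auto
      have "x * coeff G j = z * (f * coeff G j)" by (simp add: z ac_simps)
      then show ?thesis using top'[OF z(2)] by simp
    qed (rule IH)
  qed
  {
    case 0
    have "coeff G j = 0" if "j \<noteq> 0" for j
      using that 0(1) by (intro coeff_eq_0) auto
    moreover have "coeff (F * G) k = coeff F k * coeff G 0" if "degree F \<le> k" for F k
      using coeff_mult_top[OF that 0(1)] by simp
    ultimately have "x * (coeff F k * coeff G j) \<in> N"
      if "\<And>x l. x \<in> coeff_prods F 0 \<Longrightarrow> x * coeff (F * G) l \<in> N" "degree F \<le> k" "x \<in> coeff_prods F 0"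
      for F k x j
      using that(1)[OF that(3), of k] that(2) N0 by (cases "j = 0") auto
    from step[OF 0(1) _ 0(2,3) this] show ?case
      using coeff_eq_0[of F] by (metis less_eq_Suc_le)
  next
    case (Suc m)
    let ?g = "coeff G (Suc m)"
    define G' where "G' = G - monom ?g (Suc m)"
    have "coeff G' i = 0" if "i > m" for i
      using that Suc.prems(1) by (cases "i = Suc m") (auto simp: G'_def coeff_eq_0)
    then have degG': "degree G' \<le> m" by (intro degree_le) auto
    have "x * (coeff F k * coeff G j) \<in> N"
      if H: "\<And>x l. x \<in> coeff_prods F (Suc m) \<Longrightarrow> x * coeff (F * G) l \<in> N"
        and k: "degree F \<le> k" and x: "x \<in> coeff_prods F (Suc m)" for F k x j
    proof (cases "j = Suc m")
      case True
      then show ?thesis using H[OF x, of "k + Suc m"] coeff_mult_top[OF k Suc.prems(1)] by simp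
    next
      case False
      \<comment> \<open>The factor \<open>coeff F k\<close> is moved into the second polynomial. F
        times it is \<open>coeff F k\<close> times F G, minus a shift of F scaled by
        \<open>coeff F k * ?g\<close>, and this scalar is the coefficient of F G at k + m + 1. In
        both terms a coefficient of F is left over, which raises y from
        \<open>coeff_prods F m\<close> to \<open>coeff_prods F (Suc m)\<close>.\<close>
      have "x * coeff (smult (coeff F k) G') j \<in> N"
      proof (rule Suc.IH[OF _ _ x])
        show "degree (smult (coeff F k) G') \<le> m"
          using degG' degree_smult_le order_trans by blast
        fix y l assume y: "y \<in> coeff_prods F m"
        have in1: "coeff F i * y \<in> coeff_prods F (Suc m)" for i using y by auto
        have "coeff (F * smult (coeff F k) G') l =
            coeff F k * coeff (F * G) l - (if l < Suc m then 0 else coeff F (l - Suc m)) * (coeff F k * ?g)"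
        proof -
          have FM: "F * monom ?g (Suc m) = monom ?g (Suc m) * F" by (rule mult.commute)
          show ?thesis
            unfolding G'_def mult_smult_right right_diff_distrib coeff_smult coeff_diff FM coeff_monom_mult
            by (cases "l < Suc m") (simp_all add: ac_simps)
        qed
        then have "y * coeff (F * smult (coeff F k) G') l =
            (coeff F k * y) * coeff (F * G) l -
            (if l < Suc m then 0 else (coeff F (l - Suc m) * y) * coeff (F * G) (k + Suc m))"
          unfolding coeff_mult_top[OF k Suc.prems(1)]
          by (cases "l < Suc m") (simp_all add: right_diff_distrib ac_simps)
        then show "y * coeff (F * smult (coeff F k) G') l \<in> N"
          using H[OF in1] N N0 by (auto simp del: coeff_prods.simps)
      qed
      then show ?thesis using False by (simp add: G'_def)
    qed
    from step[OF Suc.prems(1) _ Suc.prems(2,3) this] show ?case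
      using coeff_eq_0[of F] by (metis less_eq_Suc_le)
  }
qed

subsection \<open>Leading exponents\<close>

text \<open>With distinct primes as labels of the variables, \<open>key\<close> is injective by
  unique factorization and takes values in the naturals, so one can descend on leading exponents
  without choosing an order of the variables.\<close>

lemma ex_prime_labels: "\<exists>q :: 'n::finite \<Rightarrow> nat. inj q \<and> (\<forall>i. prime (q i))"
proof -
  have "infinite {p :: nat. prime p}" by (rule primes_infinite)
  then obtain P :: "nat set" where P: "P \<subseteq> {p. prime p}" "card P = card (UNIV :: 'n set)" "finite P"
    by (metis infinite_arbitrarily_large)
  then obtain q where "bij_betw q (UNIV :: 'n set) P"
    using finite_same_card_bij[of "UNIV :: 'n set" P] by auto
  then show ?thesis using P by (intro exI[of _ q]) (auto simp: bij_betw_def)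
qed

definition prime_label :: "'n::finite \<Rightarrow> nat" where
  "prime_label = (SOME q. inj q \<and> (\<forall>i. prime (q i)))"

lemma inj_prime_label: "inj prime_label" and prime_prime_label: "prime (prime_label i)"
  using someI_ex[OF ex_prime_labels] unfolding prime_label_def by auto

text \<open>
  Comparing the products \<open>\<Prod>i. q\<^sub>i ^ m\<^sub>i\<close>, for distinct primes \<open>q\<^sub>i\<close>, is a monomial order; ties of the
  weight \<open>wt I\<close> are broken by it.
\<close>

definition key :: "('n::finite \<Rightarrow>\<^sub>0 nat) \<Rightarrow> nat" where
  "key m = (\<Prod>i\<in>UNIV. prime_label i ^ Poly_Mapping.lookup m i)"

definition wt :: "'n set \<Rightarrow> ('n::finite \<Rightarrow>\<^sub>0 nat) \<Rightarrow> nat" where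
  "wt I m = (\<Sum>i\<in>I. Poly_Mapping.lookup m i)"

lemma wt_add: "wt I (a + b) = wt I a + wt I b"
  by (simp add: wt_def lookup_add sum.distrib)

lemma key_add: "key (a + b) = key a * key b"
  by (simp add: key_def lookup_add power_add prod.distrib)

lemma key_pos: "key a > 0"
  by (simp add: key_def prod_pos prime_prime_label prime_gt_0_nat)

lemma key_inj: "key a = key b \<longleftrightarrow> a = b"
proof
  assume eq: "key a = key b"
  have "multiplicity (prime_label i) (key m) = Poly_Mapping.lookup m i" for i and m :: "'a \<Rightarrow>\<^sub>0 nat"
  proof -
    have "multiplicity (prime_label i) (key m) =
        (\<Sum>j\<in>UNIV. multiplicity (prime_label i) (prime_label j ^ Poly_Mapping.lookup m j))"
      unfolding key_def using prime_prime_label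
      by (intro prime_elem_multiplicity_prod_distrib) (auto, metis not_prime_0)
    also have "\<dots> = (\<Sum>j\<in>UNIV. if j = i then Poly_Mapping.lookup m i else 0)"
    proof (rule sum.cong [OF refl])
      fix j :: 'a
      have "multiplicity (prime_label i) (prime_label j) = (if j = i then 1 else 0)"
        using prime_prime_label[of i] prime_prime_label[of j] inj_prime_label
        by (auto intro!: prime_multiplicity_other dest: injD)
      then show "multiplicity (prime_label i) (prime_label j ^ Poly_Mapping.lookup m j) =
          (if j = i then Poly_Mapping.lookup m i else 0)"
        using prime_prime_label[of i] prime_prime_label[of j]
        by (subst prime_elem_multiplicity_power_distrib) auto
    qed
    finally show ?thesis by simp
  qed
  then show "a = b" using eq by (metis poly_mapping_eqI)
qed simp

text \<open>With \<open>I = {}\<close> this is the leading exponent for \<open>key\<close> alone;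
  for \<open>I = {i}\<close> or \<open>I = UNIV\<close> its weight is moreover the degree in the
  i-th variable or the total degree.\<close>

definition is_lead :: "'n::finite set \<Rightarrow> ('n, 'k::zero) mfps \<Rightarrow> ('n \<Rightarrow>\<^sub>0 nat) \<Rightarrow> bool" where
  "is_lead I X a \<longleftrightarrow> mfps_nth X a \<noteq> 0 \<and>
     (\<forall>b. mfps_nth X b \<noteq> 0 \<longrightarrow> wt I b < wt I a \<or> wt I b = wt I a \<and> key b \<le> key a)"

lemma is_lead_nth: "is_lead I X a \<Longrightarrow> mfps_nth X a \<noteq> 0"
  by (simp add: is_lead_def)

lemma is_lead_wt: "is_lead I X a \<Longrightarrow> mfps_nth X b \<noteq> 0 \<Longrightarrow> wt I b \<le> wt I a"
  unfolding is_lead_def by (metis order.refl less_imp_le)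

lemma is_lead_key: "is_lead {} X a \<Longrightarrow> mfps_nth X b \<noteq> 0 \<Longrightarrow> key b \<le> key a"
  by (simp add: is_lead_def wt_def)

lemma is_lead_unique: "is_lead I X a \<Longrightarrow> is_lead I X b \<Longrightarrow> a = b"
  unfolding is_lead_def by (metis key_inj le_antisym less_asym nat_neq_iff)

lemma is_lead_exists:
  fixes X :: "('n::finite, 'k::comm_ring_1) mfps"
  assumes "X \<in> mpolys" "X \<noteq> 0"
  shows "\<exists>a. is_lead I X a"
proof -
  let ?S = "{m. mfps_nth X m \<noteq> 0}"
  have fin: "finite ?S" and ne: "?S \<noteq> {}"
    using assms by (auto simp: mpolys_def mfps_eq_0_iff)
  define w where "w = Max (wt I ` ?S)"
  let ?T = "{m \<in> ?S. wt I m = w}"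
  have "w \<in> wt I ` ?S" unfolding w_def using fin ne by (intro Max_in) auto
  then have T: "finite ?T" "?T \<noteq> {}" using fin by auto
  then obtain a where a: "a \<in> ?T" "key a = Max (key ` ?T)"
    using Max_in[of "key ` ?T"] by (metis (no_types, lifting) finite_imageI image_iff image_is_empty)
  have "wt I b \<le> w" if "mfps_nth X b \<noteq> 0" for b
    unfolding w_def using fin that by (intro Max_ge) auto
  moreover have "key b \<le> key a" if "b \<in> ?T" for b
    unfolding a(2) using T that by (intro Max_ge) auto
  ultimately have "is_lead I X a"
    using a(1) by (auto simp: is_lead_def order.strict_iff_order)
  then show ?thesis ..
qed

lemma is_lead_mult:
  fixes X Y :: "('n::finite, 'k::idom) mfps"
  assumes X: "is_lead I X a" and Y: "is_lead I Y b"
  shows "is_lead I (X * Y) (a + b)"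
proof -
  have dom: "wt I (c + d) < wt I (a + b) \<or> wt I (c + d) = wt I (a + b) \<and> key (c + d) \<le> key (a + b)"
    and eq: "c + d = a + b \<Longrightarrow> c = a \<and> d = b"
    if "mfps_nth X c \<noteq> 0" "mfps_nth Y d \<noteq> 0" for c d
  proof -
    have c: "wt I c < wt I a \<or> wt I c = wt I a \<and> key c \<le> key a"
      and d: "wt I d < wt I b \<or> wt I d = wt I b \<and> key d \<le> key b"
      using that X Y by (auto simp: is_lead_def)
    show "wt I (c + d) < wt I (a + b) \<or> wt I (c + d) = wt I (a + b) \<and> key (c + d) \<le> key (a + b)"
      using c d by (auto simp: wt_add key_add intro: mult_le_mono)
    assume s: "c + d = a + b"
    then have "wt I c + wt I d = wt I a + wt I b" by (metis wt_add)
    with c d have le: "key c \<le> key a" "key d \<le> key b" by auto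
    have "key c * key d = key a * key b" using s by (metis key_add)
    then have "key c = key a"
      using le key_pos[of d] key_pos[of a]
      by (metis le_antisym mult_le_cancel2 mult_le_mono2 not_le order.strict_trans2)
    then show "c = a \<and> d = b" using s by (simp add: key_inj)
  qed
  have "mfps_nth (X * Y) (a + b) =
      (\<Sum>x\<in>{(c, d). c + d = a + b}. if x = (a, b) then mfps_nth X a * mfps_nth Y b else 0)"
    unfolding mfps_nth_mult using eq by (intro sum.cong) auto
  also have "\<dots> = mfps_nth X a * mfps_nth Y b"
    using finite_add_decomp[of "a + b"] by (subst sum.delta) auto
  finally have nz: "mfps_nth (X * Y) (a + b) \<noteq> 0"
    using X Y by (simp add: is_lead_def)
  moreover have "wt I m < wt I (a + b) \<or> wt I m = wt I (a + b) \<and> key m \<le> key (a + b)"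
    if "mfps_nth (X * Y) m \<noteq> 0" for m
  proof -
    from that have "\<exists>x\<in>{(c, d). c + d = m}. (case x of (c, d) \<Rightarrow> mfps_nth X c * mfps_nth Y d) \<noteq> 0"
      unfolding mfps_nth_mult by (meson sum.neutral)
    then obtain c d where "c + d = m" "mfps_nth X c \<noteq> 0" "mfps_nth Y d \<noteq> 0" by auto
    with dom show ?thesis by blast
  qed
  ultimately show ?thesis unfolding is_lead_def by blast
qed

lemma is_lead_1: "is_lead I (1 :: ('n::finite, 'k::idom) mfps) 0"
  by (simp add: is_lead_def mfps_nth_one)

lemma is_lead_power:
  fixes X :: "('n::finite, 'k::idom) mfps"
  assumes "is_lead I X a"
  shows "\<exists>b. is_lead I (X ^ n) b \<and> (\<forall>i. Poly_Mapping.lookup b i = n * Poly_Mapping.lookup a i)"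
proof (induction n)
  case 0
  show ?case using is_lead_1[of I] by (intro exI[of _ 0]) simp
next
  case (Suc n)
  then obtain b where "is_lead I (X ^ n) b" "\<forall>i. Poly_Mapping.lookup b i = n * Poly_Mapping.lookup a i"
    by blast
  then show ?case using is_lead_mult[OF assms] by (intro exI[of _ "a + b"]) (simp add: lookup_add)
qed

subsection \<open>Polynomials are completely integrally closed\<close>

definition mpoly_dvd :: "('n, 'k::comm_ring_1) mfps \<Rightarrow> ('n, 'k) mfps \<Rightarrow> bool" where
  "mpoly_dvd c a \<longleftrightarrow> (\<exists>x\<in>mpolys. a = c * x)"

lemma mpoly_dvd_0 [simp]: "mpoly_dvd c 0"
  unfolding mpoly_dvd_def by (rule bexI[of _ 0]) auto

lemma mpoly_dvd_add: "mpoly_dvd c a \<Longrightarrow> mpoly_dvd c b \<Longrightarrow> mpoly_dvd c (a + b)"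
  unfolding mpoly_dvd_def by (metis distrib_left mpolys_add)

lemma mpoly_dvd_sum: "(\<And>x. x \<in> S \<Longrightarrow> mpoly_dvd c (F x)) \<Longrightarrow> mpoly_dvd c (sum F S)"
  by (induction S rule: infinite_finite_induct) (auto intro: mpoly_dvd_add)

lemma mpoly_dvd_mult: "mpoly_dvd c a \<Longrightarrow> mpoly_dvd d b \<Longrightarrow> mpoly_dvd (c * d) (a * b)"
  unfolding mpoly_dvd_def by (metis mpolys_mult mult.assoc mult.left_commute)

lemma mpoly_dvd_self: "mpoly_dvd c c"
  unfolding mpoly_dvd_def by (rule bexI[of _ 1]) auto

lemma mpoly_dvd_mult_left: "x \<in> mpolys \<Longrightarrow> mpoly_dvd c a \<Longrightarrow> mpoly_dvd c (x * a)"
  unfolding mpoly_dvd_def by (metis mpolys_mult mult.left_commute)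

text \<open>Complete integral closedness of k[t]: if all powers of a/c have the common denominator
  e, then a/c is a polynomial. The hypothesis forces the leading monomial of c to divide that of a,
  so a monomial multiple of c cancels the leading term of a. The hypothesis survives this by the
  binomial theorem, and the \<open>key\<close> of the leading exponent drops.\<close>

lemma mpoly_dvd_of_powers:
  fixes a c e :: "('n::finite, 'k::field) mfps"
  assumes "c \<in> mpolys" "c \<noteq> 0" "e \<in> mpolys" "e \<noteq> 0"
    and "a \<in> mpolys" and "\<And>n. mpoly_dvd (c ^ n) (e * a ^ n)"
  shows "mpoly_dvd c a"
proof (cases "a = 0")
  case False
  obtain lc le where lc: "is_lead {} c lc" and le: "is_lead {} e le"
    using assms is_lead_exists by meson
  have main: "mpoly_dvd c a"
    if "is_lead {} a la" "a \<in> mpolys" "\<And>n. mpoly_dvd (c ^ n) (e * a ^ n)" for la a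
    using that
  proof (induction "key la" arbitrary: a la rule: less_induct)
    case less
    note la = less.prems(1)
    have le_i: "Poly_Mapping.lookup lc i \<le> Poly_Mapping.lookup la i" for i
    proof -
      \<comment> \<open>The power n exceeds the i-th leading exponent of e, so that e costs less
        than one unit once the comparison of n-th powers is divided by n.\<close>
      define n where "n = Suc (Poly_Mapping.lookup le i)"
      obtain t where t: "t \<in> mpolys" "e * a ^ n = c ^ n * t"
        using less.prems(3)[of n] by (auto simp: mpoly_dvd_def)
      obtain nla where nla: "is_lead {} (a ^ n) nla" "\<forall>i. Poly_Mapping.lookup nla i = n * Poly_Mapping.lookup la i"
        using is_lead_power[OF la] by blast
      obtain nlc where nlc: "is_lead {} (c ^ n) nlc" "\<forall>i. Poly_Mapping.lookup nlc i = n * Poly_Mapping.lookup lc i"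
        using is_lead_power[OF lc] by blast
      have l1: "is_lead {} (e * a ^ n) (le + nla)" by (rule is_lead_mult[OF le nla(1)])
      then have "t \<noteq> 0" using t(2) by (auto simp: is_lead_def)
      then obtain lt where lt: "is_lead {} t lt" using is_lead_exists t(1) by blast
      have "le + nla = nlc + lt"
        using is_lead_unique[OF l1] is_lead_mult[OF nlc(1) lt] t(2) by simp
      from arg_cong[OF this, of "\<lambda>z. Poly_Mapping.lookup z i"]
      have "n * Poly_Mapping.lookup lc i \<le> Poly_Mapping.lookup le i + n * Poly_Mapping.lookup la i"
        using nla(2) nlc(2) by (simp add: lookup_add)
      also have "\<dots> < n * (Poly_Mapping.lookup la i + 1)" by (simp add: n_def)
      finally show ?thesis by (metis Suc_eq_plus1 less_Suc_eq_le nat_mult_less_cancel1 zero_less_Suc n_def)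
    qed
    define s where "s = expo (\<lambda>i. Poly_Mapping.lookup la i - Poly_Mapping.lookup lc i)"
    have s: "la = s + lc"
      using le_i by (simp add: s_def poly_mapping_eq_iff lookup_add fun_eq_iff)
    define \<mu> where "\<mu> = mfps_monom s (mfps_nth a la / mfps_nth c lc)"
    define a' where "a' = a - \<mu> * c"
    have \<mu>: "\<mu> \<in> mpolys" by (simp add: \<mu>_def)
    have "a' \<in> mpolys"
      unfolding a'_def using less.prems(2) \<mu> assms(1) by (intro mpolys_diff mpolys_mult)
    have supp: "key b \<le> key la" if "mfps_nth (\<mu> * c) b \<noteq> 0" for b
    proof -
      have "is_lead {} \<mu> s"
        using is_lead_nth[OF la] is_lead_nth[OF lc] by (simp add: is_lead_def \<mu>_def mfps_nth_monom)
      from is_lead_mult[OF this lc] that show ?thesis unfolding s by (rule is_lead_key)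
    qed
    have zero: "mfps_nth a' la = 0"
      using is_lead_nth[OF lc] by (simp add: a'_def \<mu>_def s mfps_nth_monom_mult_add)
    have powers: "mpoly_dvd (c ^ n) (e * a' ^ n)" for n
    proof -
      have "e * a' ^ n = (\<Sum>k\<le>n. (of_nat (n choose k) * (- \<mu>) ^ (n - k)) * ((e * a ^ k) * c ^ (n - k)))"
      proof -
        have a'': "a' = a + (- \<mu>) * c" by (simp add: a'_def)
        show ?thesis
          unfolding a'' binomial_ring sum_distrib_left power_mult_distrib
          by (rule sum.cong) (simp_all only: ac_simps)
      qed
      also have "mpoly_dvd (c ^ n) \<dots>"
      proof (rule mpoly_dvd_sum)
        fix k assume "k \<in> {..n}"
        then have n: "c ^ n = c ^ k * c ^ (n - k)" by (simp flip: power_add)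
        show "mpoly_dvd (c ^ n) ((of_nat (n choose k) * (- \<mu>) ^ (n - k)) * ((e * a ^ k) * c ^ (n - k)))"
        proof (rule mpoly_dvd_mult_left)
          show "of_nat (n choose k) * (- \<mu>) ^ (n - k) \<in> mpolys"
            using \<mu> by (intro mpolys_mult mpolys_of_nat mpolys_power mpolys_uminus)
          show "mpoly_dvd (c ^ n) ((e * a ^ k) * c ^ (n - k))"
            unfolding n by (rule mpoly_dvd_mult[OF less.prems(3) mpoly_dvd_self])
        qed
      qed
      finally show ?thesis .
    qed
    have "mpoly_dvd c a'"
    proof (cases "a' = 0")
      case False
      then obtain la' where la': "is_lead {} a' la'" using is_lead_exists \<open>a' \<in> mpolys\<close> by blast
      have "mfps_nth a la' \<noteq> 0 \<or> mfps_nth (\<mu> * c) la' \<noteq> 0"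
        using is_lead_nth[OF la'] by (auto simp: a'_def)
      then have "key la' \<le> key la" using supp is_lead_key[OF la] by blast
      moreover have "la' \<noteq> la" using zero is_lead_nth[OF la'] by auto
      ultimately have "key la' < key la" by (simp add: order.strict_iff_order key_inj)
      from less.hyps[OF this la' \<open>a' \<in> mpolys\<close> powers] show ?thesis .
    qed simp
    then have "mpoly_dvd c (a' + \<mu> * c)"
      by (rule mpoly_dvd_add) (rule mpoly_dvd_mult_left[OF \<mu> mpoly_dvd_self])
    then show ?case by (simp add: a'_def)
  qed
  from False obtain la where "is_lead {} a la" using is_lead_exists assms(5) by blast
  from main[OF this assms(5,6)] show ?thesis .
qed simp

subsection \<open>Gauss's lemma without factorization\<close>

definition polys_over :: "'a::zero set \<Rightarrow> 'a poly set" where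
  "polys_over R = {F. \<forall>i. coeff F i \<in> R}"

lemma polys_overD: "F \<in> polys_over R \<Longrightarrow> coeff F i \<in> R"
  by (simp add: polys_over_def)

lemma polys_over_mult: "F \<in> polys_over mpolys \<Longrightarrow> G \<in> polys_over mpolys \<Longrightarrow> F * G \<in> polys_over mpolys"
  for F G :: "('n, 'k::comm_ring_1) mfps poly"
  by (auto simp: polys_over_def coeff_mult intro!: mpolys_sum mpolys_mult)

lemma polys_over_power: "F \<in> polys_over mpolys \<Longrightarrow> F ^ n \<in> polys_over mpolys"
  for F :: "('n, 'k::comm_ring_1) mfps poly"
proof (induction n)
  case 0
  show ?case by (simp add: polys_over_def coeff_1)
qed (auto intro: polys_over_mult)

lemma coeff_prods_mpolys:
  "F \<in> polys_over mpolys \<Longrightarrow> x \<in> coeff_prods F m \<Longrightarrow> x \<in> mpolys"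
  by (induction m arbitrary: x) (auto intro: mpolys_mult polys_overD)

lemma power_in_coeff_prods: "coeff F i ^ m \<in> coeff_prods F m"
  by (induction m) auto

text \<open>The multipliers r are restricted to polynomials so that, for F over k[t], the ideal
  stays inside k[t].\<close>

inductive_set ideal_coeff_prods :: "('n, 'k::comm_ring_1) mfps poly \<Rightarrow> nat \<Rightarrow> ('n, 'k) mfps set"
  for F m where
  zero: "0 \<in> ideal_coeff_prods F m"
| base: "x \<in> coeff_prods F m \<Longrightarrow> x \<in> ideal_coeff_prods F m"
| diff: "x \<in> ideal_coeff_prods F m \<Longrightarrow> y \<in> ideal_coeff_prods F m \<Longrightarrow> x - y \<in> ideal_coeff_prods F m"
| mult: "x \<in> ideal_coeff_prods F m \<Longrightarrow> r \<in> mpolys \<Longrightarrow> r * x \<in> ideal_coeff_prods F m"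

text \<open>
  By Dedekind--Mertens, multiplication by \<open>coeff F i * coeff G j\<close> maps the ideal \<open>J\<close> generated by the
  \<open>degree G\<close>-fold products of coefficients of \<open>F\<close> into \<open>c J\<close>.
\<close>

lemma gauss_dvd:
  fixes F G :: "('n::finite, 'k::field) mfps poly"
  assumes F: "F \<in> polys_over mpolys" and G: "G \<in> polys_over mpolys"
    and c: "c \<in> mpolys" "c \<noteq> 0" and dvd: "\<And>l. mpoly_dvd c (coeff (F * G) l)"
  shows "mpoly_dvd c (coeff F i * coeff G j)"
proof (cases "F = 0")
  case False
  define m where "m = degree G"
  define J where "J = ideal_coeff_prods F m"
  have J: "x \<in> mpolys" if "x \<in> J" for x
    using that unfolding J_def
    by induction (auto intro: mpolys_diff mpolys_mult coeff_prods_mpolys[OF F])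
  define a where "a = coeff F i * coeff G j"
  have a: "a \<in> mpolys" unfolding a_def by (intro mpolys_mult polys_overD[OF F] polys_overD[OF G])
  have diff: "x - y \<in> (*) c ` J" if xy: "x \<in> (*) c ` J" "y \<in> (*) c ` J" for x y
  proof -
    obtain x' y' where "x = c * x'" "y = c * y'" "x' \<in> J" "y' \<in> J" using xy by auto
    then show ?thesis
      unfolding J_def by (intro image_eqI[of _ _ "x' - y'"] ideal_coeff_prods.diff) (simp_all add: algebra_simps)
  qed
  have zero: "0 \<in> (*) c ` J"
    unfolding J_def by (intro image_eqI[of _ _ 0] ideal_coeff_prods.zero) simp
  have prods: "x * a \<in> (*) c ` J" if x: "x \<in> coeff_prods F m" for x
  proof -
    have "(coeff F i * x) * coeff G j \<in> (*) c ` J"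
    proof (rule dedekind_mertens[OF zero diff])
      show "degree G \<le> m" by (simp add: m_def)
      show "coeff F i * x \<in> coeff_prods F (Suc m)" using x by auto
      fix y l assume y: "y \<in> coeff_prods F m"
      obtain t where t: "t \<in> mpolys" "coeff (F * G) l = c * t"
        using dvd[of l] by (auto simp: mpoly_dvd_def)
      show "y * coeff (F * G) l \<in> (*) c ` J"
        unfolding J_def using y t
        by (intro image_eqI[of _ _ "t * y"] ideal_coeff_prods.mult ideal_coeff_prods.base) (simp_all add: ac_simps)
    qed
    then show ?thesis by (simp add: a_def ac_simps)
  qed
  have step: "a * x \<in> (*) c ` J" if "x \<in> J" for x
    using that unfolding J_def
  proof induction
    case (diff x y)
    then show ?case using \<open>\<And>x y. x \<in> (*) c ` J \<Longrightarrow> y \<in> (*) c ` J \<Longrightarrow> x - y \<in> (*) c ` J\<close>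
      by (simp add: right_diff_distrib J_def)
  next
    case (mult x r)
    then obtain x' where "a * x = c * x'" "x' \<in> ideal_coeff_prods F m" by auto
    then show ?case using mult.hyps(2)
      by (intro image_eqI[of _ _ "r * x'"] ideal_coeff_prods.mult) (simp_all add: ac_simps)
  next
    case (base x)
    then show ?case using prods by (simp add: mult.commute[of a] J_def)
  qed (use zero in \<open>simp add: J_def\<close>)
  \<comment> \<open>Since multiplication by a maps J into c J, iterating it on this one nonzero
    element of J gives the common denominator that \<open>mpoly_dvd_of_powers\<close>
    requires.\<close>
  define e where "e = lead_coeff F ^ m"
  have e: "e \<in> J" "e \<noteq> 0"
    using False by (auto simp: J_def e_def intro: ideal_coeff_prods.base power_in_coeff_prods)
  have "e * a ^ n \<in> (*) (c ^ n) ` J" for n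
  proof (induction n)
    case (Suc n)
    then obtain x where x: "x \<in> J" "e * a ^ n = c ^ n * x" by auto
    from step[OF x(1)] obtain y where y: "y \<in> J" "a * x = c * y" by auto
    have "e * a ^ Suc n = a * (e * a ^ n)" by (simp only: power_Suc ac_simps)
    also have "\<dots> = c ^ n * (a * x)" unfolding x(2) by (simp only: ac_simps)
    finally have "e * a ^ Suc n = c ^ n * (a * x)" .
    then show ?case using y by (intro image_eqI[of _ _ y]) (simp_all add: ac_simps)
  qed (use e in simp)
  then have "mpoly_dvd (c ^ n) (e * a ^ n)" for n
    unfolding mpoly_dvd_def using J by blast
  from mpoly_dvd_of_powers[OF c J[OF e(1)] e(2) a this] show ?thesis by (simp add: a_def)
qed simp

section \<open>Degrees of products of polynomials in y\<close>

definition deg_le :: "'n::finite set \<Rightarrow> nat \<Rightarrow> ('n, 'k::zero) mfps \<Rightarrow> bool" where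
  "deg_le I b X \<longleftrightarrow> (\<forall>m. mfps_nth X m \<noteq> 0 \<longrightarrow> wt I m \<le> b)"

lemma deg_le_0 [simp]: "deg_le I b 0"
  by (simp add: deg_le_def)

lemma deg_le_1: "deg_le I b (1 :: ('n::finite, 'k::comm_ring_1) mfps)"
  by (simp add: deg_le_def mfps_nth_one wt_def)

lemma deg_le_diff: "deg_le I b X \<Longrightarrow> deg_le I b Y \<Longrightarrow> deg_le I b (X - Y)"
  for X Y :: "('n::finite, 'k::comm_ring_1) mfps"
  unfolding deg_le_def by (metis diff_self mfps_nth_diff)

lemma deg_le_add: "deg_le I b X \<Longrightarrow> deg_le I b Y \<Longrightarrow> deg_le I b (X + Y)"
  for X Y :: "('n::finite, 'k::comm_ring_1) mfps"
  unfolding deg_le_def by (metis add_0 mfps_nth_add)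

lemma deg_le_mult: "deg_le I b X \<Longrightarrow> deg_le I c Y \<Longrightarrow> deg_le I (b + c) (X * Y)"
  for X Y :: "('n::finite, 'k::comm_ring_1) mfps"
proof -
  assume X: "deg_le I b X" and Y: "deg_le I c Y"
  show ?thesis
    unfolding deg_le_def
  proof (intro allI impI)
    fix m assume "mfps_nth (X * Y) m \<noteq> 0"
    then have "\<exists>x\<in>{(c, d). c + d = m}. (case x of (c, d) \<Rightarrow> mfps_nth X c * mfps_nth Y d) \<noteq> 0"
      unfolding mfps_nth_mult by (meson sum.neutral)
    then obtain u v where uv: "u + v = m" "mfps_nth X u * mfps_nth Y v \<noteq> 0" by auto
    then have "mfps_nth X u \<noteq> 0" "mfps_nth Y v \<noteq> 0" by auto
    then have "wt I u \<le> b" "wt I v \<le> c" using X Y by (auto simp: deg_le_def)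
    then show "wt I m \<le> b + c" unfolding uv(1) [symmetric] wt_add by simp
  qed
qed

lemma deg_le_sum: "(\<And>x. x \<in> S \<Longrightarrow> deg_le I b (F x)) \<Longrightarrow> deg_le I b (sum F S)"
  for F :: "'b \<Rightarrow> ('n::finite, 'k::comm_ring_1) mfps"
  by (induction S rule: infinite_finite_induct) (auto intro: deg_le_add)

lemma deg_le_coeff_mult:
  fixes F G :: "('n::finite, 'k::comm_ring_1) mfps poly"
  assumes "\<And>i. deg_le I b (coeff F i)" "\<And>j. deg_le I c (coeff G j)"
  shows "deg_le I (b + c) (coeff (F * G) l)"
  unfolding coeff_mult by (intro deg_le_sum deg_le_mult assms)

lemma deg_le_coeff_power:
  fixes F :: "('n::finite, 'k::comm_ring_1) mfps poly"
  assumes "\<And>i. deg_le I b (coeff F i)"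
  shows "deg_le I (n * b) (coeff (F ^ n) l)"
proof (induction n arbitrary: l)
  case (Suc n)
  then show ?case using deg_le_coeff_mult[OF assms Suc] by simp
qed (auto simp: coeff_1 deg_le_1)

lemma ex_exact_deg:
  fixes F :: "('n::finite, 'k::comm_ring_1) mfps poly"
  assumes F: "F \<in> polys_over mpolys" "F \<noteq> 0"
  obtains i a where "is_lead I (coeff F i) a" "\<And>j. deg_le I (wt I a) (coeff F j)"
proof -
  let ?S = "{i. coeff F i \<noteq> 0}"
  have "?S \<subseteq> {..degree F}" by (auto simp: le_degree)
  then have fin: "finite ?S" by (rule finite_subset) simp
  have ne: "?S \<noteq> {}" using F(2) by (auto simp: poly_eq_iff)
  have "\<forall>i\<in>?S. \<exists>a. is_lead I (coeff F i) a"
    using is_lead_exists polys_overD[OF F(1)] by blast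
  then obtain l where l: "\<And>i. i \<in> ?S \<Longrightarrow> is_lead I (coeff F i) (l i)" by metis
  let ?w = "\<lambda>i. wt I (l i)"
  obtain i where i: "i \<in> ?S" "?w i = Max (?w ` ?S)"
    using Max_in[of "?w ` ?S"] fin ne by (metis (no_types, lifting) finite_imageI image_iff image_is_empty)
  have "deg_le I (?w i) (coeff F j)" for j
  proof (cases "j \<in> ?S")
    case True
    then have "?w j \<le> ?w i" unfolding i(2) using fin by (intro Max_ge) auto
    then show ?thesis using is_lead_wt[OF l[OF True]] order_trans by (auto simp: deg_le_def)
  qed simp
  then show ?thesis using that l[OF i(1)] by blast
qed

text \<open>Let m be the degree of G in y. Dedekind-Mertens for the subgroup of series of degree at
  most m wt(a) + \<beta> puts F_i^(m+1) G_j into it. The leading exponent of this product has weight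
  (m+1) wt(a) + wt(b'), where b' leads G_j; cancelling m wt(a) gives the bound.\<close>

lemma gauss_deg:
  fixes F G :: "('n::finite, 'k::field) mfps poly"
  assumes G: "G \<in> polys_over mpolys"
    and lead: "is_lead I (coeff F i) a" and F: "\<And>i. deg_le I (wt I a) (coeff F i)"
    and FG: "\<And>l. deg_le I \<beta> (coeff (F * G) l)"
    and b: "mfps_nth (coeff G j) b \<noteq> 0"
  shows "wt I a + wt I b \<le> \<beta>"
proof -
  define m where "m = degree G"
  have prods: "deg_le I (m * wt I a) x" if "x \<in> coeff_prods F m" for x m
    using that
    by (induction m arbitrary: x) (auto intro!: deg_le_mult F simp: deg_le_1)
  have "coeff G j \<noteq> 0" using b by auto
  then obtain b' where b': "is_lead I (coeff G j) b'"
    using is_lead_exists polys_overD[OF G] by blast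
  let ?N = "{z. deg_le I (m * wt I a + \<beta>) z}"
  have "coeff F i ^ Suc m * coeff G j \<in> ?N"
  proof (rule dedekind_mertens)
    show "degree G \<le> m" by (simp add: m_def)
    show "coeff F i ^ Suc m \<in> coeff_prods F (Suc m)" by (rule power_in_coeff_prods)
  qed (auto intro: deg_le_diff deg_le_mult prods FG)
  moreover obtain u where u: "is_lead I (coeff F i ^ Suc m) u"
      "\<forall>i. Poly_Mapping.lookup u i = Suc m * Poly_Mapping.lookup a i"
    using is_lead_power[OF lead] by blast
  ultimately have "wt I (u + b') \<le> m * wt I a + \<beta>"
    using is_lead_nth[OF is_lead_mult[OF u(1) b']] by (auto simp: deg_le_def)
  moreover have "wt I u = Suc m * wt I a"
    unfolding wt_def sum_distrib_left by (rule sum.cong) (simp_all only: u(2))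
  ultimately have "wt I a + wt I b' \<le> \<beta>" by (simp add: wt_add)
  then show ?thesis using is_lead_wt[OF b' b] by linarith
qed

subsection \<open>Sections of residues\<close>

context char_p
begin

section \<open>Frobenius twists of polynomials in y\<close>

abbreviation frob_poly :: "('n, 'k) mfps poly \<Rightarrow> ('n, 'k) mfps poly" where
  "frob_poly \<equiv> map_poly (coeff_frob p)"

lemma coeff_frob_poly [simp]: "coeff (frob_poly P) i = coeff_frob p (coeff P i)"
  for P :: "('n::finite, 'k) mfps poly"
  by (simp add: coeff_map_poly)

lemma frob_poly_mult: "frob_poly (P * Q) = frob_poly P * frob_poly Q"
  for P Q :: "('n::finite, 'k) mfps poly"
  by (rule poly_eqI) (simp add: coeff_mult coeff_frob_sum coeff_frob_mult)

lemma frob_poly_smult: "frob_poly (smult c Q) = smult (coeff_frob p c) (frob_poly Q)"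
  for Q :: "('n::finite, 'k) mfps poly"
  by (rule poly_eqI) (simp add: coeff_frob_mult)

lemma coeff_frob_of_nat: "coeff_frob p (of_nat n) = (of_nat n :: ('n::finite, 'k) mfps)"
  by (induction n) (auto simp: coeff_frob_add)

lemma frob_poly_pderiv: "frob_poly (pderiv P) = pderiv (frob_poly P)"
  for P :: "('n::finite, 'k) mfps poly"
  by (rule poly_eqI) (simp add: coeff_pderiv coeff_frob_mult coeff_frob_of_nat del: of_nat_Suc)

lemma poly_frob_poly: "poly (frob_poly P) (coeff_frob p f) = coeff_frob p (poly P f)"
  for P :: "('n::finite, 'k) mfps poly"
  by (induction P) (auto simp: map_poly_pCons coeff_frob_add coeff_frob_mult)

lemma frob_poly_eq_0_iff [simp]: "frob_poly P = 0 \<longleftrightarrow> P = 0" for P :: "('n::finite, 'k) mfps poly"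
  by (simp add: poly_eq_iff)

lemma degree_frob_poly [simp]: "degree (frob_poly P) = degree P" for P :: "('n::finite, 'k) mfps poly"
  by (rule degree_map_poly) simp

lemma frob_poly_over: "P \<in> polys_over mpolys \<Longrightarrow> frob_poly P \<in> polys_over mpolys"
  for P :: "('n::finite, 'k) mfps poly"
  by (simp add: polys_over_def coeff_frob_mpolys)

text \<open>The substitution of p-th powers for y and for all variables of the series; with
  \<open>frob_poly\<close> it factors the p-th power map on polynomials in y, see
  \<open>poly_power_p\<close>.\<close>

definition stretch_poly :: "('n::finite, 'k) mfps poly \<Rightarrow> ('n, 'k) mfps poly" where
  "stretch_poly P = pcompose (map_poly (stretch p) P) (monom 1 p)"

lemma stretch_poly_0 [simp]: "stretch_poly 0 = 0"
  by (simp add: stretch_poly_def)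

lemma stretch_poly_pCons: "stretch_poly (pCons a P) = [:stretch p a:] + monom 1 p * stretch_poly P"
  by (simp add: stretch_poly_def map_poly_pCons pcompose_pCons)

lemma stretch_poly_mult: "stretch_poly (P * Q) = stretch_poly P * stretch_poly Q"
proof -
  have "map_poly (stretch p) (P * Q) = map_poly (stretch p) P * map_poly (stretch p) Q"
    by (rule poly_eqI) (simp add: coeff_map_poly coeff_mult stretch_sum stretch_mult)
  then show ?thesis by (simp add: stretch_poly_def pcompose_mult)
qed

lemma coeff_stretch_poly: "coeff (stretch_poly P) l = 0 \<or> (\<exists>j. coeff (stretch_poly P) l = stretch p (coeff P j))"
proof (induction P arbitrary: l)
  case (pCons a P)
  show ?case
  proof (cases "l = 0")
    case True
    then have "coeff (stretch_poly (pCons a P)) l = stretch p (coeff (pCons a P) 0)"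
      using p_pos by (simp add: stretch_poly_pCons coeff_monom_mult)
    then show ?thesis by blast
  next
    case False
    then have "coeff [:stretch p a:] l = 0" by (cases l) auto
    then have "coeff (stretch_poly (pCons a P)) l = (if l < p then 0 else coeff (stretch_poly P) (l - p))"
      by (simp add: stretch_poly_pCons coeff_monom_mult)
    then show ?thesis using pCons.IH[of "l - p"] coeff_pCons_Suc[of a P] by metis
  qed
qed simp

lemma stretch_poly_over:
  assumes "P \<in> polys_over mpolys"
  shows "stretch_poly P \<in> polys_over mpolys"
proof -
  have "coeff (stretch_poly P) l \<in> mpolys" for l
    using coeff_stretch_poly[of P l] stretch_mpolys[OF polys_overD[OF assms]] by auto
  then show ?thesis by (simp add: polys_over_def)
qed

lemma poly_power_p: "P ^ p = stretch_poly (frob_poly P)" for P :: "('n::finite, 'k) mfps poly"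
proof (induction P)
  case 0
  then show ?case using p_pos by (simp add: power_0_left)
next
  case (pCons a P)
  have "pCons a P = [:a:] + monom 1 1 * P"
    by (simp add: monom_altdef)
  then have "pCons a P ^ p = [:a:] ^ p + (monom 1 1 * P) ^ p"
    by (simp only: mfps_poly_frob_add)
  also have "\<dots> = [:a ^ p:] + monom 1 p * P ^ p"
    by (simp add: power_mult_distrib poly_const_pow Polynomial.monom_power)
  finally show ?case
    using pCons.IH by (simp add: map_poly_pCons stretch_poly_pCons power_p)
qed

text \<open>The section of the differential B dy: in y only the terms y^(p j + p - 1) dy survive and
  become y^j dy, while the digits r are selected in the other variables. The range of j is long
  enough because j <= p j + p - 1.\<close>

definition poly_section :: "('n \<Rightarrow> nat) \<Rightarrow> ('n::finite, 'k) mfps poly \<Rightarrow> ('n, 'k) mfps poly" where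
  "poly_section r B = (\<Sum>j\<le>degree B. monom (mfps_section p r (coeff B (p * j + (p - 1)))) j)"

lemma coeff_poly_section: "coeff (poly_section r B) j = mfps_section p r (coeff B (p * j + (p - 1)))"
proof (cases "j \<le> degree B")
  case False
  have "j \<le> p * j" using p_pos by simp
  with False have "degree B < p * j + (p - 1)" by linarith
  then have "coeff B (p * j + (p - 1)) = 0" by (rule coeff_eq_0)
  with False show ?thesis by (simp add: poly_section_def coeff_sum)
qed (simp add: poly_section_def coeff_sum)

lemma poly_section_add: "poly_section r (A + B) = poly_section r A + poly_section r B"
  by (rule poly_eqI) (simp add: coeff_poly_section section_add)

lemma poly_section_stretch:
  assumes r: "\<And>i. r i < p"
  shows "poly_section r (B * stretch_poly D) = poly_section r B * D"
proof (induction D arbitrary: B)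
  case 0
  show ?case by (rule poly_eqI) (simp add: coeff_poly_section)
next
  case (pCons a D)
  have 1: "poly_section r (B * [:stretch p a:]) = smult a (poly_section r B)"
    by (rule poly_eqI) (simp add: coeff_poly_section section_stretch_mult[OF r])
  have 2: "poly_section r (monom 1 p * B) = pCons 0 (poly_section r B)"
  proof (rule poly_eqI)
    fix j
    show "coeff (poly_section r (monom 1 p * B)) j = coeff (pCons 0 (poly_section r B)) j"
      using p_pos by (cases j) (auto simp: coeff_poly_section coeff_monom_mult)
  qed
  have "B * stretch_poly (pCons a D) = B * [:stretch p a:] + (monom 1 p * B) * stretch_poly D"
    by (simp only: stretch_poly_pCons distrib_left ac_simps)
  then have "poly_section r (B * stretch_poly (pCons a D)) =
      smult a (poly_section r B) + pCons 0 (poly_section r B) * D"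
    by (simp only: poly_section_add 1 pCons.IH 2)
  then show ?case by (simp add: mult_pCons_right)
qed

text \<open>This is the commutation of sections with the residue at \<open>y = f\<close> of \<open>G / (y - f)\<close>.\<close>

lemma poly_section_residue:
  fixes G :: "('n::finite, 'k) mfps poly"
  assumes r: "\<And>i. r i < p"
  shows "poly (poly_section r (G * [:- f, 1:] ^ (p - 1))) (coeff_frob p f) = mfps_section p r (poly G f)"
proof -
  \<comment> \<open>G is split into a multiple of y - f and its value at f. The part
    \<open>H * ?L ^ p\<close> gives a multiple of the twisted linear factor, which vanishes at the
    twisted root. The rest has degree at most p - 1 in y, so only its coefficient at y^(p-1) is
    seen, where \<open>?L ^ (p - 1)\<close> is monic.\<close>
  define H where "H = synthetic_div G f"
  let ?L = "[:- f, 1:]"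
  have L: "?L ^ p = ?L * ?L ^ (p - 1)" using p_pos by (simp flip: power_Suc)
  have G: "G = ?L * H + [:poly G f:]" unfolding H_def by (rule synthetic_div_correct' [symmetric])
  have "G * ?L ^ (p - 1) = (?L * H + [:poly G f:]) * ?L ^ (p - 1)"
    by (subst G) (rule refl)
  also have "\<dots> = H * ?L ^ p + smult (poly G f) (?L ^ (p - 1))"
  proof -
    have "[:poly G f:] * ?L ^ (p - 1) = smult (poly G f) (?L ^ (p - 1))" by simp
    then show ?thesis by (simp only: L distrib_right) (simp only: ac_simps)
  qed
  finally have "poly_section r (G * ?L ^ (p - 1)) =
      poly_section r H * frob_poly ?L + poly_section r (smult (poly G f) (?L ^ (p - 1)))"
    by (simp only: poly_section_add poly_power_p poly_section_stretch[OF r])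
  moreover have "poly_section r (smult (poly G f) (?L ^ (p - 1))) = [:mfps_section p r (poly G f):]"
  proof (rule poly_eqI)
    fix j
    show "coeff (poly_section r (smult (poly G f) (?L ^ (p - 1)))) j =
        coeff [:mfps_section p r (poly G f):] j"
    proof (cases j)
      case 0
      then show ?thesis by (simp add: coeff_poly_section coeff_linear_power)
    next
      case (Suc k)
      have "coeff (?L ^ (p - 1)) (p * j + (p - 1)) = 0"
        using p_pos Suc by (intro coeff_eq_0) (simp add: degree_linear_power)
      then show ?thesis using Suc by (simp add: coeff_poly_section)
    qed
  qed
  moreover have "poly (frob_poly ?L) (coeff_frob p f) = 0"
    unfolding poly_frob_poly by simp
  ultimately show ?thesis by simp
qed

text \<open>A is to inherit every degree bound and every content divisor of P. The latter is phrased
  with test polynomials D instead of gcds, which is a form that passes through sections.\<close>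

definition numerators :: "nat \<Rightarrow> 'n set set \<Rightarrow> ('n::finite, 'k) mfps poly \<Rightarrow> ('n, 'k) mfps poly set" where
  "numerators d \<I> P = {A \<in> polys_over mpolys. degree A \<le> d \<and>
     (\<forall>I\<in>\<I>. \<forall>b. (\<forall>i. deg_le I b (coeff P i)) \<longrightarrow> (\<forall>i. deg_le I b (coeff A i))) \<and>
     (\<forall>c\<in>mpolys. \<forall>D\<in>polys_over mpolys. c \<noteq> 0 \<longrightarrow>
        (\<forall>l. mpoly_dvd c (coeff (P * D) l)) \<longrightarrow> (\<forall>l. mpoly_dvd c (coeff (A * D) l)))}"

text \<open>The residues at \<open>y = f\<close> of \<open>A dy / P\<close> that happen to be power series.\<close>

definition residues :: "nat \<Rightarrow> 'n set set \<Rightarrow> ('n::finite, 'k) mfps poly \<Rightarrow> ('n, 'k) mfps \<Rightarrow> ('n, 'k) mfps set" where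
  "residues d \<I> P f = {w. \<exists>A\<in>numerators d \<I> P. w * poly (pderiv P) f = poly A f}"

lemma deg_le_of_nat_mult: "deg_le I b x \<Longrightarrow> deg_le I b (of_nat n * x)" for x :: "('n::finite, 'k) mfps"
  by (induction n) (auto simp: distrib_right intro: deg_le_add)

text \<open>The numerator is y P', with residue f P'(f) / P'(f) = f. Its coefficients are i P_i, so
  c has to divide each P_i D_j separately and not only the coefficients of P D; this is
  \<open>gauss_dvd\<close>.\<close>

lemma root_in_residues:
  fixes P :: "('n::finite, 'k) mfps poly"
  assumes P: "P \<in> polys_over mpolys" "degree P \<le> d"
  shows "f \<in> residues d \<I> P f"
proof -
  define A where "A = pCons 0 (pderiv P)"
  have A: "coeff A i = of_nat i * coeff P i" for i
    unfolding A_def by (cases i) (auto simp: coeff_pderiv)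
  have "A \<in> numerators d \<I> P"
    unfolding numerators_def
  proof (intro CollectI conjI ballI allI impI)
    show "A \<in> polys_over mpolys"
      unfolding polys_over_def by (auto simp: A intro!: mpolys_mult mpolys_of_nat polys_overD[OF P(1)])
    show "degree A \<le> d"
      using P(2) by (intro degree_le) (auto simp: A coeff_eq_0)
    show "deg_le I b (coeff A i)" if "\<forall>i. deg_le I b (coeff P i)" for I b i
      unfolding A using that deg_le_of_nat_mult by blast
    show "mpoly_dvd c (coeff (A * D) l)"
      if c: "c \<in> mpolys" "D \<in> polys_over mpolys" "c \<noteq> 0" "\<forall>l. mpoly_dvd c (coeff (P * D) l)" for c D l
      unfolding coeff_mult A mult.assoc
      by (intro mpoly_dvd_sum mpoly_dvd_mult_left mpolys_of_nat gauss_dvd[OF P(1) c(2,1,3)])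
        (use c(4) in blast)
  qed
  moreover have "f * poly (pderiv P) f = poly A f" by (simp add: A_def)
  ultimately show ?thesis unfolding residues_def by blast
qed

lemma deg_le_section: "deg_le I (p * b) x \<Longrightarrow> deg_le I b (mfps_section p r x)"
  for x :: "('n::finite, 'k) mfps"
  unfolding deg_le_def
proof (intro allI impI)
  fix m assume *: "\<forall>m. mfps_nth x m \<noteq> 0 \<longrightarrow> wt I m \<le> p * b" "mfps_nth (mfps_section p r x) m \<noteq> 0"
  have "p * wt I m \<le> wt I (expo (\<lambda>i. p * Poly_Mapping.lookup m i + r i))"
    unfolding wt_def sum_distrib_left by (intro sum_mono) simp
  also have "\<dots> \<le> p * b" using * by simp
  finally show "wt I m \<le> b" using p_pos by simp
qed

text \<open>The new numerator is the section of B = A P^(p-1). The bounds for B are p times those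
  for A and P, and the section divides them by p again, so the same bounds hold with respect to the
  twisted P.\<close>

lemma section_in_residues:
  fixes P :: "('n::finite, 'k) mfps poly"
  assumes P: "P \<in> polys_over mpolys" "degree P \<le> d" "poly P f = 0"
    and r: "\<And>i. r i < p" and w: "w \<in> residues d \<I> P f"
  shows "mfps_section p r w \<in> residues d \<I> (frob_poly P) (coeff_frob p f)"
proof -
  obtain A where A: "A \<in> numerators d \<I> P" and wA: "w * poly (pderiv P) f = poly A f"
    using w by (auto simp: residues_def)
  have A1: "A \<in> polys_over mpolys" "degree A \<le> d" using A by (auto simp: numerators_def)
  define B where "B = A * P ^ (p - 1)"
  define A' where "A' = poly_section r B"
  have pp: "P * P ^ (p - 1) = P ^ p" using p_pos by (simp flip: power_Suc)
  have B: "B \<in> polys_over mpolys"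
    unfolding B_def by (intro polys_over_mult polys_over_power A1 P(1))
  have "A' \<in> numerators d \<I> (frob_poly P)"
    unfolding numerators_def
  proof (intro CollectI conjI ballI allI impI)
    show "A' \<in> polys_over mpolys"
      using B by (simp add: polys_over_def A'_def coeff_poly_section section_mpolys)
    have "degree B \<le> degree A + degree (P ^ (p - 1))"
      unfolding B_def by (rule degree_mult_le)
    also have "degree (P ^ (p - 1)) \<le> degree P * (p - 1)" by (rule degree_power_le)
    also have "degree P * (p - 1) \<le> d * (p - 1)" using P(2) by simp
    finally have "degree B \<le> d + d * (p - 1)" using A1(2) by simp
    also have "\<dots> = p * d" using p_pos by (cases p) auto
    finally have "degree B \<le> p * d" .
    then have "coeff A' i = 0" if "i > d" for i
    proof -
      have "p * d < p * i" using that p_pos by simp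
      then have "degree B < p * i + (p - 1)" using \<open>degree B \<le> p * d\<close> by linarith
      then show ?thesis by (simp add: A'_def coeff_poly_section coeff_eq_0)
    qed
    then show "degree A' \<le> d" by (intro degree_le) auto
  next
    fix I b i assume I: "I \<in> \<I>" and "\<forall>i. deg_le I b (coeff (frob_poly P) i)"
    then have degP: "\<And>i. deg_le I b (coeff P i)"
      using p_pos by (simp add: deg_le_def)
    then have "\<And>i. deg_le I b (coeff A i)" using A I by (auto simp: numerators_def)
    then have "deg_le I (b + (p - 1) * b) (coeff B i)" for i
      unfolding B_def by (intro deg_le_coeff_mult deg_le_coeff_power degP)
    moreover have "b + (p - 1) * b = p * b" using p_pos by (cases p) auto
    ultimately show "deg_le I b (coeff A' i)"
      by (simp add: A'_def coeff_poly_section deg_le_section)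
  next
    fix c D l
    assume c: "c \<in> mpolys" "D \<in> polys_over mpolys" "c \<noteq> 0"
      and dvd: "\<forall>l. mpoly_dvd c (coeff (frob_poly P * D) l)"
    \<comment> \<open>The test polynomial for A is chosen so that P D' is the stretch of
      \<open>frob_poly P * D\<close>, while A D' is B times the stretch of D and has section A'
      D.\<close>
    define D' where "D' = P ^ (p - 1) * stretch_poly D"
    have "P * D' = P ^ p * stretch_poly D" by (simp only: D'_def pp mult.assoc [symmetric])
    also have "\<dots> = stretch_poly (frob_poly P * D)" by (simp only: poly_power_p stretch_poly_mult)
    finally have PD: "P * D' = stretch_poly (frob_poly P * D)" .
    have "mpoly_dvd (stretch p c) (coeff (P * D') l)" for l
      using coeff_stretch_poly[of "frob_poly P * D" l] unfolding PD
    proof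
      assume "\<exists>j. coeff (stretch_poly (frob_poly P * D)) l = stretch p (coeff (frob_poly P * D) j)"
      then obtain j where j: "coeff (stretch_poly (frob_poly P * D)) l = stretch p (coeff (frob_poly P * D) j)" ..
      obtain x where "x \<in> mpolys" "coeff (frob_poly P * D) j = c * x"
        using dvd by (auto simp: mpoly_dvd_def)
      then show "mpoly_dvd (stretch p c) (coeff (stretch_poly (frob_poly P * D)) l)"
        unfolding j mpoly_dvd_def by (auto simp: stretch_mult intro!: bexI[of _ "stretch p x"] stretch_mpolys)
    qed simp
    moreover have "D' \<in> polys_over mpolys"
      unfolding D'_def by (intro polys_over_mult polys_over_power P(1) stretch_poly_over c(2))
    ultimately have AD: "mpoly_dvd (stretch p c) (coeff (A * D') l)" for l
      using A c stretch_mpolys[OF c(1)] unfolding numerators_def by simp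
    have "A' * D = poly_section r (A * D')"
      unfolding A'_def D'_def B_def by (simp only: poly_section_stretch[OF r, symmetric] mult.assoc)
    moreover obtain x where "x \<in> mpolys" "coeff (A * D') (p * l + (p - 1)) = stretch p c * x"
      using AD by (auto simp: mpoly_dvd_def)
    ultimately show "mpoly_dvd c (coeff (A' * D) l)"
      unfolding mpoly_dvd_def
      by (auto simp: coeff_poly_section section_stretch_mult[OF r] intro!: bexI[of _ "mfps_section p r x"] section_mpolys)
  qed
  moreover have "mfps_section p r w * poly (pderiv (frob_poly P)) (coeff_frob p f) = poly A' (coeff_frob p f)"
  proof -
    \<comment> \<open>As P = (y - f) Q, the denominator P'(f) of the residue is Q(f). Its p-th power
      can be pulled out of the section: w Q(f)^p = A(f) Q(f)^(p-1), and
      \<open>poly_section_residue\<close> applies because A Q^(p-1) (y - f)^(p-1) = B.\<close>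
    define Q where "Q = synthetic_div P f"
    have PQ: "P = [:- f, 1:] * Q"
      using synthetic_div_correct'[of f P] P(3) by (simp add: Q_def)
    define \<delta> where "\<delta> = poly (pderiv P) f"
    have \<delta>: "\<delta> = poly Q f"
      unfolding \<delta>_def PQ pderiv_mult by (simp add: pderiv_pCons)
    have "mfps_section p r w * coeff_frob p \<delta> = mfps_section p r (stretch p (coeff_frob p \<delta>) * w)"
      by (subst section_stretch_mult[OF r]) (rule mult.commute)
    also have "stretch p (coeff_frob p \<delta>) * w = w * \<delta> * \<delta> ^ (p - 1)"
      using p_pos by (simp add: power_p [symmetric] ac_simps flip: power_Suc)
    also have "\<dots> = poly (A * Q ^ (p - 1)) f"
      using wA by (simp add: \<delta> [symmetric], simp add: \<delta>_def)
    also have "mfps_section p r \<dots> = poly (poly_section r ((A * Q ^ (p - 1)) * [:- f, 1:] ^ (p - 1))) (coeff_frob p f)"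
      by (rule poly_section_residue [symmetric]) (rule r)
    also have "(A * Q ^ (p - 1)) * [:- f, 1:] ^ (p - 1) = B"
      unfolding B_def PQ by (simp only: power_mult_distrib ac_simps)
    finally show ?thesis
      by (simp add: A'_def \<delta>_def frob_poly_pderiv [symmetric] poly_frob_poly)
  qed
  ultimately show ?thesis unfolding residues_def by blast
qed

end

subsection \<open>Bounding the space of residues\<close>

text \<open>The exponents m such that, for all I at once, m + s I - t I is an exponent vector of
  weight at most h I; the additive form avoids truncated subtraction. In use, s I and t I are the
  leading exponents of the leading coefficient of the cofactor D and of the divisor c belonging to
  I.\<close>

definition exponent_cell ::
  "'n set set \<Rightarrow> ('n set \<Rightarrow> nat) \<Rightarrow> ('n set \<Rightarrow> 'n \<Rightarrow>\<^sub>0 nat) \<Rightarrow> ('n set \<Rightarrow> 'n \<Rightarrow>\<^sub>0 nat) \<Rightarrow> ('n::finite \<Rightarrow>\<^sub>0 nat) set" where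
  "exponent_cell \<I> h s t = {m. \<forall>I\<in>\<I>. \<exists>e. m + s I = t I + e \<and> wt I e \<le> h I}"

context char_p
begin

lemma mfps_nth_const_mult: "mfps_nth (mfps_monom 0 c * x) m = c * mfps_nth x m"
  for x :: "('n, 'k) mfps"
  using mfps_nth_monom_mult_add[of 0 c x m] by simp

text \<open>A k-space of polynomials on which the coefficients at the positions Z have no nonzero
  common zero has dimension at most \<open>card Z\<close>. The induction splits off one position:
  the kernel of that coordinate, and one element outside the kernel if there is any.\<close>

lemma coordinates:
  fixes V :: "('n::finite, 'k) mfps poly set"
  assumes "finite Z" "card Z \<le> N" "0 \<in> V"
    and "\<And>A B c. A \<in> V \<Longrightarrow> B \<in> V \<Longrightarrow> A - smult (mfps_monom 0 c) B \<in> V"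
    and "\<And>A. A \<in> V \<Longrightarrow> A \<noteq> 0 \<Longrightarrow> \<exists>z\<in>Z. mfps_nth (coeff A (fst z)) (snd z) \<noteq> 0"
  shows "\<exists>b :: nat \<Rightarrow> _. (\<forall>i. b i \<in> V) \<and>
    (\<forall>A\<in>V. \<exists>u. A = (\<Sum>i<N. smult (mfps_monom 0 (u i)) (b i)))"
  using assms
proof (induction Z arbitrary: N V rule: finite_induct)
  case empty
  then have "A = 0" if "A \<in> V" for A using that by blast
  then show ?case using empty.prems by (intro exI[of _ "\<lambda>_. 0"]) auto
next
  case (insert z Z)
  let ?c = "\<lambda>A. mfps_nth (coeff A (fst z)) (snd z)"
  let ?V = "{A \<in> V. ?c A = 0}"
  obtain N' where N: "N = Suc N'" "card Z \<le> N'" using insert by (cases N) auto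
  have "\<exists>b :: nat \<Rightarrow> _. (\<forall>i. b i \<in> ?V) \<and>
    (\<forall>A\<in>?V. \<exists>u. A = (\<Sum>i<N'. smult (mfps_monom 0 (u i)) (b i)))"
  proof (rule insert.IH[OF N(2)])
    show "\<exists>z\<in>Z. mfps_nth (coeff A (fst z)) (snd z) \<noteq> 0" if "A \<in> ?V" "A \<noteq> 0" for A
      using insert.prems(4)[of A] that by auto
  qed (use insert.prems in \<open>auto simp: mfps_nth_const_mult\<close>)
  then obtain b where b: "\<And>i. b i \<in> ?V"
    and bV: "\<And>A. A \<in> ?V \<Longrightarrow> \<exists>u. A = (\<Sum>i<N'. smult (mfps_monom 0 (u i)) (b i))" by blast
  \<comment> \<open>If the coordinate vanishes on all of V, any element such as 0 will do, since the
    quotient \<open>?k\<close> below is then 0 / 0 = 0.\<close>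
  obtain A0 where A0: "A0 \<in> V" "\<And>A. A \<in> V \<Longrightarrow> ?c A0 = 0 \<Longrightarrow> ?c A = 0"
    using insert.prems(2) by metis
  have "\<exists>u. A = (\<Sum>i<N. smult (mfps_monom 0 (u i)) ((b(N' := A0)) i))" if A: "A \<in> V" for A
  proof -
    let ?k = "?c A / ?c A0"
    have "A - smult (mfps_monom 0 ?k) A0 \<in> ?V"
      using insert.prems(3)[OF A A0(1)] A0(2)[OF A] by (auto simp: mfps_nth_const_mult)
    from bV[OF this] obtain u
      where "A - smult (mfps_monom 0 ?k) A0 = (\<Sum>i<N'. smult (mfps_monom 0 (u i)) (b i))" by blast
    then have "A = (\<Sum>i<N'. smult (mfps_monom 0 (u i)) (b i)) + smult (mfps_monom 0 ?k) A0"
      by (simp add: diff_eq_eq)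
    then have "A = (\<Sum>i<N. smult (mfps_monom 0 ((u(N' := ?k)) i)) ((b(N' := A0)) i))"
      by (simp add: N(1))
    then show ?thesis by blast
  qed
  moreover have "(b(N' := A0)) i \<in> V" for i using b[of i] A0(1) by auto
  ultimately show ?case by blast
qed

text \<open>For each I in the family, P divides over k(t) some E whose degree with respect to I is
  at most h I; c and D record this with denominators cleared, in place of making P primitive. In
  use, E is an annihilator of f that realizes a height.\<close>

definition residue_data ::
  "nat \<Rightarrow> 'n set set \<Rightarrow> ('n set \<Rightarrow> nat) \<Rightarrow> ('n::finite, 'k) mfps poly \<Rightarrow> ('n, 'k) mfps \<Rightarrow> bool" where
  "residue_data d \<I> h P f \<longleftrightarrow> P \<in> polys_over mpolys \<and> degree P \<le> d \<and> poly P f = 0 \<and>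
     poly (pderiv P) f \<noteq> 0 \<and>
     (\<forall>I\<in>\<I>. \<exists>c D E. c \<in> mpolys \<and> c \<noteq> 0 \<and> D \<in> polys_over mpolys \<and> D \<noteq> 0 \<and> E \<in> polys_over mpolys \<and>
        P * D = smult c E \<and> (\<forall>i. deg_le I (h I) (coeff E i)))"

lemma residue_data_frob:
  assumes "residue_data d \<I> h P f"
  shows "residue_data d \<I> h (frob_poly P) (coeff_frob p f)"
  unfolding residue_data_def
proof (intro conjI ballI)
  show "frob_poly P \<in> polys_over mpolys" "degree (frob_poly P) \<le> d"
    "poly (frob_poly P) (coeff_frob p f) = 0" "poly (pderiv (frob_poly P)) (coeff_frob p f) \<noteq> 0"
    using assms by (simp_all add: residue_data_def frob_poly_over poly_frob_poly frob_poly_pderiv [symmetric])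
  fix I assume "I \<in> \<I>"
  then obtain c D E where *: "c \<in> mpolys" "c \<noteq> 0" "D \<in> polys_over mpolys" "D \<noteq> 0" "E \<in> polys_over mpolys"
    "P * D = smult c E" "\<forall>i. deg_le I (h I) (coeff E i)"
    using assms unfolding residue_data_def by blast
  have "frob_poly P * frob_poly D = smult (coeff_frob p c) (frob_poly E)"
    using arg_cong[OF *(6), of frob_poly] by (simp add: frob_poly_mult frob_poly_smult)
  moreover have "\<forall>i. deg_le I (h I) (coeff (frob_poly E) i)"
    using *(7) p_pos by (simp add: deg_le_def)
  ultimately show "\<exists>c D E. c \<in> mpolys \<and> c \<noteq> 0 \<and> D \<in> polys_over mpolys \<and> D \<noteq> 0 \<and> E \<in> polys_over mpolys \<and>
      frob_poly P * D = smult c E \<and> (\<forall>i. deg_le I (h I) (coeff E i))"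
    using * by (intro exI[of _ "coeff_frob p c"] exI[of _ "frob_poly D"] exI[of _ "frob_poly E"])
      (simp add: coeff_frob_mpolys frob_poly_over)
qed

text \<open>Let l be the leading exponent of the leading coefficient of a nonzero numerator A. As c
  divides A D, the product of the leading coefficients of A and D is c x, whence l + s = t + e for
  the leading exponents s, t, e of the leading coefficient of D, of c and of x. The weight of e is
  at most h I, because the degree of c x is at most that of P plus that of D, hence at most that of
  c plus h I. So l lies in a fixed exponent cell, and \<open>coordinates\<close> applies with
  positions in {0..d} times the cell.\<close>

lemma residues_coordinates:
  fixes P :: "('n::finite, 'k) mfps poly"
  assumes data: "residue_data d \<I> h P f"
    and cells: "\<And>s t. finite (exponent_cell \<I> h s t) \<and> (d + 1) * card (exponent_cell \<I> h s t) \<le> N"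
  shows "\<exists>v :: nat \<Rightarrow> _. \<forall>w\<in>residues d \<I> P f. \<exists>u. w = (\<Sum>i<N. mfps_monom 0 (u i) * v i)"
proof -
  have P: "P \<in> polys_over mpolys" "poly P f = 0" "poly (pderiv P) f \<noteq> 0"
    using data by (auto simp: residue_data_def)
  have "P \<noteq> 0" using P(3) by auto
  define \<delta> where "\<delta> = poly (pderiv P) f"
  have "\<forall>I\<in>\<I>. \<exists>s t. \<forall>A\<in>numerators d \<I> P. \<forall>l. is_lead {} (lead_coeff A) l \<longrightarrow>
      (\<exists>e. l + s = t + e \<and> wt I e \<le> h I)"
  proof
    fix I assume I: "I \<in> \<I>"
    then obtain c D E where c: "c \<in> mpolys" "c \<noteq> 0" and D: "D \<in> polys_over mpolys" "D \<noteq> 0"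
      and E: "E \<in> polys_over mpolys" "\<forall>i. deg_le I (h I) (coeff E i)" and PD: "P * D = smult c E"
      using data unfolding residue_data_def by blast
    obtain s where s: "is_lead {} (lead_coeff D) s"
      using is_lead_exists[OF polys_overD[OF D(1)]] D(2) by (metis leading_coeff_0_iff)
    obtain t where t: "is_lead {} c t" using is_lead_exists[OF c] by blast
    \<comment> \<open>Leading exponents with suffix I maximize \<open>wt I\<close> and serve to
      compute degrees. Those without suffix refer to \<open>key\<close> alone, so that one and the
      same l satisfies the cell conditions for all I.\<close>
    obtain tI where tI: "is_lead I c tI" using is_lead_exists[OF c] by blast
    obtain i\<^sub>0 a where a: "is_lead I (coeff P i\<^sub>0) a" "\<And>j. deg_le I (wt I a) (coeff P j)"
      using ex_exact_deg[OF P(1) \<open>P \<noteq> 0\<close>] by blast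
    have "deg_le I (wt I tI) c" using is_lead_wt[OF tI] by (simp add: deg_le_def)
    then have PD': "deg_le I (wt I tI + h I) (coeff (P * D) l)" for l
      unfolding PD coeff_smult using E(2) by (intro deg_le_mult) auto
    have dD: "wt I a + wt I b \<le> wt I tI + h I" if "mfps_nth (coeff D j) b \<noteq> 0" for j b
      using gauss_deg[OF D(1) a PD' that] .
    show "\<exists>s t. \<forall>A\<in>numerators d \<I> P. \<forall>l. is_lead {} (lead_coeff A) l \<longrightarrow>
      (\<exists>e. l + s = t + e \<and> wt I e \<le> h I)"
    proof (rule exI[of _ s], rule exI[of _ t], intro ballI allI impI)
      fix A l assume A: "A \<in> numerators d \<I> P" and l: "is_lead {} (lead_coeff A) l"
      have "mpoly_dvd c (coeff (P * D) j)" for j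
        unfolding PD mpoly_dvd_def using polys_overD[OF E(1)] by auto
      then have "mpoly_dvd c (coeff (A * D) j)" for j
        using A c D unfolding numerators_def by blast
      then obtain x where x: "x \<in> mpolys" "lead_coeff A * lead_coeff D = c * x"
        using coeff_mult_degree_sum[of A D] by (metis mpoly_dvd_def)
      have lead1: "is_lead {} (c * x) (l + s)"
        using is_lead_mult[OF l s] x(2) by simp
      then have "x \<noteq> 0" by (auto simp: is_lead_def)
      then obtain e where e: "is_lead {} x e" using is_lead_exists x(1) by blast
      obtain eI where eI: "is_lead I x eI" using is_lead_exists x(1) \<open>x \<noteq> 0\<close> by blast
      have dA: "deg_le I (wt I a) (coeff A j)" for j using A a(2) I unfolding numerators_def by blast
      obtain sI where sI: "is_lead I (lead_coeff D) sI"
        using is_lead_exists[OF polys_overD[OF D(1)]] D(2) by (metis leading_coeff_0_iff)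
      then have "deg_le I (wt I sI) (lead_coeff D)" using is_lead_wt by (auto simp: deg_le_def)
      then have "deg_le I (wt I a + wt I sI) (lead_coeff A * lead_coeff D)"
        by (rule deg_le_mult[OF dA])
      then have "deg_le I (wt I a + wt I sI) (c * x)" unfolding x(2) .
      moreover have "mfps_nth (c * x) (tI + eI) \<noteq> 0"
        by (rule is_lead_nth[OF is_lead_mult[OF tI eI]])
      ultimately have "wt I (tI + eI) \<le> wt I a + wt I sI" by (simp add: deg_le_def)
      then have "wt I tI + wt I eI \<le> wt I a + wt I sI" by (simp only: wt_add)
      also have "\<dots> \<le> wt I tI + h I" using dD is_lead_nth[OF sI] by blast
      finally have "wt I eI \<le> h I" by simp
      then have "wt I e \<le> h I" using is_lead_wt[OF eI is_lead_nth[OF e]] by simp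
      moreover have "l + s = t + e" using is_lead_unique[OF lead1 is_lead_mult[OF t e]] .
      ultimately show "\<exists>e. l + s = t + e \<and> wt I e \<le> h I" by blast
    qed
  qed
  then obtain s t where st: "\<And>I A l. I \<in> \<I> \<Longrightarrow> A \<in> numerators d \<I> P \<Longrightarrow> is_lead {} (lead_coeff A) l \<Longrightarrow>
      \<exists>e. l + s I = t I + e \<and> wt I e \<le> h I"
    by metis
  define Z where "Z = {..d} \<times> exponent_cell \<I> h s t"
  \<comment> \<open>Keeping only numerators whose residue is a power series allows the spanning
    polynomials to be turned into spanning series.\<close>
  define V where "V = {A \<in> numerators d \<I> P. \<exists>w. w * \<delta> = poly A f}"
  have "\<exists>b :: nat \<Rightarrow> _. (\<forall>i. b i \<in> V) \<and>
    (\<forall>A\<in>V. \<exists>u. A = (\<Sum>i<N. smult (mfps_monom 0 (u i)) (b i)))"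
  proof (rule coordinates)
    show "finite Z" "card Z \<le> N" using cells[of s t] by (auto simp: Z_def)
    show "0 \<in> V" by (auto simp: V_def numerators_def polys_over_def intro: exI[of _ 0])
    show "\<exists>z\<in>Z. mfps_nth (coeff A (fst z)) (snd z) \<noteq> 0" if AV: "A \<in> V" "A \<noteq> 0" for A
    proof -
      have A: "A \<in> numerators d \<I> P" "A \<in> polys_over mpolys" "degree A \<le> d"
        using AV by (auto simp: V_def numerators_def)
      obtain l where l: "is_lead {} (lead_coeff A) l"
        using is_lead_exists[OF polys_overD[OF A(2)]] AV(2) by (metis leading_coeff_0_iff)
      have "(degree A, l) \<in> Z"
        using A(3) st[OF _ A(1) l] by (auto simp: Z_def exponent_cell_def)
      moreover have "mfps_nth (lead_coeff A) l \<noteq> 0" using l by (rule is_lead_nth)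
      ultimately show ?thesis by force
    qed
    show "A - smult (mfps_monom 0 k) B \<in> V" if AB: "A \<in> V" "B \<in> V" for A B k
    proof -
      have A: "A \<in> numerators d \<I> P" and B: "B \<in> numerators d \<I> P"
        using AB by (auto simp: V_def)
      obtain w w' where w: "w * \<delta> = poly A f" "w' * \<delta> = poly B f" using AB by (auto simp: V_def)
      have k: "deg_le I 0 (mfps_monom 0 k :: ('n, 'k) mfps)" for I
        by (auto simp: deg_le_def mfps_nth_monom wt_def)
      have "A - smult (mfps_monom 0 k) B \<in> numerators d \<I> P"
        unfolding numerators_def
      proof (intro CollectI conjI ballI allI impI)
        show "A - smult (mfps_monom 0 k) B \<in> polys_over mpolys"
          using A B by (auto simp: numerators_def polys_over_def intro!: mpolys_diff mpolys_mult)
        show "degree (A - smult (mfps_monom 0 k) B) \<le> d"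
          using A B by (auto simp: numerators_def intro!: degree_diff_le order_trans[OF degree_smult_le])
        show "deg_le I b (coeff (A - smult (mfps_monom 0 k) B) i)"
          if "I \<in> \<I>" "\<forall>i. deg_le I b (coeff P i)" for I b i
        proof -
          have "deg_le I b (coeff A i)" "deg_le I b (coeff B i)"
            using A B that unfolding numerators_def by blast+
          then show ?thesis using deg_le_mult[OF k] by (auto intro!: deg_le_diff)
        qed
        show "mpoly_dvd c (coeff ((A - smult (mfps_monom 0 k) B) * D) l)"
          if "c \<in> mpolys" "D \<in> polys_over mpolys" "c \<noteq> 0" "\<forall>l. mpoly_dvd c (coeff (P * D) l)" for c D l
        proof -
          have "mpoly_dvd c (coeff (A * D) l)" "mpoly_dvd c (coeff (B * D) l)"
            using A B that unfolding numerators_def by blast+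
          then have "mpoly_dvd c (coeff (A * D) l + (- mfps_monom 0 k) * coeff (B * D) l)"
            by (intro mpoly_dvd_add mpoly_dvd_mult_left mpolys_uminus mpolys_monom)
          then show ?thesis by (simp add: left_diff_distrib)
        qed
      qed
      moreover have "(w - mfps_monom 0 k * w') * \<delta> = poly (A - smult (mfps_monom 0 k) B) f"
        by (simp add: left_diff_distrib w mult.assoc)
      ultimately show ?thesis unfolding V_def by blast
    qed
  qed
  then obtain b where b: "\<And>i. b i \<in> V"
    and bV: "\<And>A. A \<in> V \<Longrightarrow> \<exists>u. A = (\<Sum>i<N. smult (mfps_monom 0 (u i)) (b i))" by blast
  have "\<forall>i. \<exists>w. w * \<delta> = poly (b i) f" using b by (auto simp: V_def)
  then obtain v where v: "\<And>i. v i * \<delta> = poly (b i) f" by metis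
  have "\<exists>u. w = (\<Sum>i<N. mfps_monom 0 (u i) * v i)" if "w \<in> residues d \<I> P f" for w
  proof -
    obtain A where A: "A \<in> V" "w * \<delta> = poly A f"
      using \<open>w \<in> _\<close> by (auto simp: residues_def V_def \<delta>_def)
    obtain u where u: "A = (\<Sum>i<N. smult (mfps_monom 0 (u i)) (b i))" using bV[OF A(1)] by blast
    have "w * \<delta> = (\<Sum>i<N. mfps_monom 0 (u i) * v i) * \<delta>"
      unfolding A(2) unfolding u by (simp add: poly_sum sum_distrib_right mult.assoc v)
    then show ?thesis using P(3) by (auto simp: \<delta>_def)
  qed
  then show ?thesis by blast
qed

text \<open>W j is the residue space of the j-th Frobenius twist. The bound N is the same at all
  levels, because twisting preserves \<open>residue_data\<close> with the same d, family and
  h.\<close>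

lemma residue_chain:
  fixes P :: "('n::finite, 'k) mfps poly"
  assumes data: "residue_data d \<I> h P f"
    and cells: "\<And>s t. finite (exponent_cell \<I> h s t) \<and> (d + 1) * card (exponent_cell \<I> h s t) \<le> N"
  shows "\<exists>W :: nat \<Rightarrow> ('n, 'k) mfps set. (\<forall>j. (coeff_frob p ^^ j) f \<in> W j) \<and>
    (\<forall>j. \<forall>r\<in>residues_p. \<forall>w\<in>W j. mfps_section p r w \<in> W (Suc j)) \<and>
    (\<forall>j. \<exists>v :: nat \<Rightarrow> _. \<forall>w\<in>W j. \<exists>u. w = (\<Sum>i<N. mfps_monom 0 (u i) * v i))"
proof -
  define W where "W = (\<lambda>j. residues d \<I> ((frob_poly ^^ j) P) ((coeff_frob p ^^ j) f))"
  have D: "residue_data d \<I> h ((frob_poly ^^ j) P) ((coeff_frob p ^^ j) f)" for j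
    by (induction j) (use data residue_data_frob in auto)
  show ?thesis
  proof (intro exI[of _ W] conjI allI ballI)
    show "(coeff_frob p ^^ j) f \<in> W j" for j
      using D[of j] unfolding W_def residue_data_def by (intro root_in_residues) auto
    show "mfps_section p r w \<in> W (Suc j)" if "r \<in> residues_p" "w \<in> W j" for r w j
      using section_in_residues[of "(frob_poly ^^ j) P" d "(coeff_frob p ^^ j) f" r w \<I>] D[of j] that
      unfolding W_def residue_data_def by simp
    show "\<exists>v :: nat \<Rightarrow> _. \<forall>w\<in>W j. \<exists>u. w = (\<Sum>i<N. mfps_monom 0 (u i) * v i)" for j
      unfolding W_def by (rule residues_coordinates[OF D cells])
  qed
qed

end

subsection \<open>Separability and the minimal polynomial\<close>

context char_p
begin

text \<open>Let a in k act on k as multiplication by a^p and extend b \<mapsto> 1 to a linear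
  functional for this vector space structure. It takes over the role of the p-th root when k is not
  perfect.\<close>

lemma cartier_map:
  assumes "b \<noteq> (0 :: 'k)"
  obtains \<kappa> :: "'k \<Rightarrow> 'k" where "\<And>x y. \<kappa> (x + y) = \<kappa> x + \<kappa> y"
    "\<And>a x. \<kappa> (a ^ p * x) = a * \<kappa> x" "\<kappa> b = 1"
proof -
  interpret vp: vector_space_pair "\<lambda>a b :: 'k. a ^ p * b" "(*) :: 'k \<Rightarrow> 'k \<Rightarrow> 'k"
    by unfold_locales (auto simp: algebra_simps frob_add power_mult_distrib)
  have "vp.vs1.independent {b}" using assms by simp
  from vp.linear_independent_extend[OF this, of "\<lambda>_. 1"]
  obtain g where g: "Vector_Spaces.linear (\<lambda>a b. a ^ p * b) (*) g" "g b = 1" by auto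
  show ?thesis
    by (rule that[of g]) (use g in \<open>auto simp: vp.linear_add vp.linear_scale\<close>)
qed

lemma of_nat_mfps_eq_0_iff: "of_nat n = (0 :: ('n::finite, 'k) mfps) \<longleftrightarrow> p dvd n"
  using mfps_char[where ?'n = 'n] by (simp add: of_nat_eq_0_iff_char_dvd)

text \<open>
  If \<open>P = Q(y\<^sup>p)\<close>, then applying to the coefficients of \<open>P\<close> an additive map \<open>S\<close> with
  \<open>S(F\<^sup>p G) = F S(G)\<close> gives an annihilator of smaller degree; \<open>k\<close> need not be perfect for such
  an \<open>S\<close> to exist.
\<close>

lemma pderiv_minimal_ne_0:
  fixes P :: "('n::finite, 'k) mfps poly"
  assumes P: "P \<in> polys_over mpolys" "P \<noteq> 0" "poly P f = 0"
    and min: "\<And>A. A \<in> polys_over mpolys \<Longrightarrow> A \<noteq> 0 \<Longrightarrow> poly A f = 0 \<Longrightarrow> degree P \<le> degree A"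
  shows "pderiv P \<noteq> 0"
proof
  assume pd: "pderiv P = 0"
  have zero: "coeff P i = 0" if nd: "\<not> p dvd i" for i
  proof -
    obtain i' where i: "i = Suc i'" using nd by (cases i) auto
    have "of_nat i * coeff P i = coeff (pderiv P) i'" by (simp add: i coeff_pderiv)
    then show ?thesis using nd of_nat_mfps_eq_0_iff[of i] pd by auto
  qed
  define n where "n = degree P"
  obtain j\<^sub>0 where j0: "lead_coeff P = coeff P (p * j\<^sub>0)" "coeff P (p * j\<^sub>0) \<noteq> 0"
    using zero[of "degree P"] P(2) by (metis dvdE leading_coeff_0_iff)
  then obtain m where m: "mfps_nth (coeff P (p * j\<^sub>0)) m \<noteq> 0" by (auto simp: mfps_eq_0_iff)
  define b where "b = mfps_nth (coeff P (p * j\<^sub>0)) m"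
  obtain \<kappa> where \<kappa>: "\<And>x y. \<kappa> (x + y) = \<kappa> x + \<kappa> y" "\<And>a x. \<kappa> (a ^ p * x) = a * \<kappa> x" "\<kappa> b = 1"
    using cartier_map m unfolding b_def by metis
  have \<kappa>0: "\<kappa> 0 = 0" using \<kappa>(2)[of 0 0] by simp
  have \<kappa>sum: "\<kappa> (sum F S) = (\<Sum>x\<in>S. \<kappa> (F x))" for F and S :: "'z set"
    by (induction S rule: infinite_finite_induct) (auto simp: \<kappa>0 \<kappa>(1))
  \<comment> \<open>The digits of the exponent m at which b sits: then S sends the leading
    coefficient of P to a series whose coefficient at m div p is \<open>\<kappa> b\<close>, that is
    1, and A stays nonzero.\<close>
  define r where "r = (\<lambda>i. Poly_Mapping.lookup m i mod p)"
  have r: "r i < p" for i using p_pos by (simp add: r_def)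
  define S where "S = (\<lambda>X :: ('n, 'k) mfps. Abs_mfps (\<lambda>m. \<kappa> (mfps_nth (mfps_section p r X) m)))"
  have S_nth: "mfps_nth (S X) m = \<kappa> (mfps_nth X (expo (\<lambda>i. p * Poly_Mapping.lookup m i + r i)))" for X m
    by (simp add: S_def)
  have S0: "S 0 = 0" by (rule mfps_eqI) (simp add: S_nth \<kappa>0)
  have Ssum: "S (sum F A) = (\<Sum>x\<in>A. S (F x))" for F :: "nat \<Rightarrow> _" and A
    by (rule mfps_eqI) (simp add: S_nth \<kappa>sum)
  have Smult: "S (F ^ p * X) = F * S X" for F X
  proof (rule mfps_eqI)
    fix m
    have "mfps_nth (S (F ^ p * X)) m = \<kappa> (mfps_nth (coeff_frob p F * mfps_section p r X) m)"
      by (simp add: S_def power_p section_stretch_mult[OF r] del: mfps_nth_section)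
    also have "\<dots> = mfps_nth (F * S X) m"
      by (simp add: mfps_nth_mult \<kappa>sum case_prod_unfold \<kappa>(2) S_nth)
    finally show "mfps_nth (S (F ^ p * X)) m = mfps_nth (F * S X) m" .
  qed
  have Spoly: "S X \<in> mpolys" if "X \<in> mpolys" for X
  proof -
    have "{m. mfps_nth (S X) m \<noteq> 0} \<subseteq> {m. mfps_nth (mfps_section p r X) m \<noteq> 0}"
      using \<kappa>0 by (auto simp: S_nth)
    then show ?thesis using section_mpolys[OF that] unfolding mpolys_def by (auto intro: finite_subset)
  qed
  define A where "A = (\<Sum>j\<le>n. monom (S (coeff P (p * j))) j)"
  have A: "coeff A j = S (coeff P (p * j))" for j
  proof (cases "j \<le> n")
    case False
    then have "degree P < p * j" using p_pos unfolding n_def by (metis less_le_trans mult_le_mono1 not_le one_le_mult_iff mult_1 Suc_leI One_nat_def)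
    with False show ?thesis by (simp add: A_def coeff_sum coeff_eq_0 S0)
  qed (simp add: A_def coeff_sum)
  have "n > 0"
  proof (rule ccontr)
    assume "\<not> n > 0"
    then obtain a where "P = [:a:]" by (auto simp: n_def intro: degree_eq_zeroE)
    then show False using P by simp
  qed
  have "degree A < n"
  proof -
    have "coeff A i = 0" if "i > n div p" for i
    proof -
      have "n < p * i" using that p_pos by (metis div_less_iff_less_mult mult.commute)
      then show ?thesis by (simp add: A n_def coeff_eq_0 S0)
    qed
    then have "degree A \<le> n div p" by (intro degree_le) auto
    also have "\<dots> < n" using \<open>n > 0\<close> prime_gt_1_nat[OF prime_p] by simp
    finally show ?thesis .
  qed
  moreover have "A \<in> polys_over mpolys"
    by (simp add: polys_over_def A Spoly polys_overD[OF P(1)])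
  moreover have "A \<noteq> 0"
  proof
    assume "A = 0"
    then have "S (coeff P (p * j\<^sub>0)) = 0" using A[of j\<^sub>0] by simp
    then have "mfps_nth (S (coeff P (p * j\<^sub>0))) (expo (\<lambda>i. Poly_Mapping.lookup m i div p)) = 0"
      by simp
    then have "\<kappa> b = 0" by (simp add: S_nth r_def b_def)
    then show False using \<kappa>(3) by simp
  qed
  moreover have "poly A f = 0"
  proof -
    have "0 = poly P f" using P(3) by simp
    also have "\<dots> = (\<Sum>i\<in>{..n}. coeff P i * f ^ i)" by (simp add: poly_altdef n_def)
    also have "\<dots> = (\<Sum>i\<in>(\<lambda>j. p * j) ` {..n}. coeff P i * f ^ i)"
    proof (rule sum.mono_neutral_cong)
      show "coeff P i * f ^ i = 0" if "i \<in> {..n} - (\<lambda>j. p * j) ` {..n}" for i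
      proof (cases "p dvd i")
        case True
        then obtain j where j: "i = p * j" ..
        have "j \<le> p * j" using p_pos by simp
        moreover have "p * j \<le> n" using that j by auto
        ultimately have "j \<in> {..n}" unfolding atMost_iff by (rule order_trans)
        then have "i \<in> (\<lambda>j. p * j) ` {..n}" unfolding j by (rule imageI)
        with that show ?thesis by blast
      qed (simp add: zero)
    qed (auto simp: n_def coeff_eq_0)
    also have "\<dots> = (\<Sum>j\<le>n. (f ^ j) ^ p * coeff P (p * j))"
      using p_pos by (subst sum.reindex) (auto simp: inj_on_def power_mult mult.commute)
    finally have "S 0 = S (\<Sum>j\<le>n. (f ^ j) ^ p * coeff P (p * j))" by simp
    then have "0 = (\<Sum>j\<le>n. f ^ j * S (coeff P (p * j)))" by (simp only: S0 Ssum Smult)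
    also have "\<dots> = poly A f" by (simp add: A_def poly_sum poly_monom mult.commute)
    finally show ?thesis ..
  qed
  ultimately show False using min[of A] by (simp add: n_def)
qed

end

section \<open>Pseudo-division and existence of the residue data\<close>

lemma polys_over_diff: "F \<in> polys_over mpolys \<Longrightarrow> G \<in> polys_over mpolys \<Longrightarrow> F - G \<in> polys_over mpolys"
  and polys_over_add: "F \<in> polys_over mpolys \<Longrightarrow> G \<in> polys_over mpolys \<Longrightarrow> F + G \<in> polys_over mpolys"
  and polys_over_smult: "c \<in> mpolys \<Longrightarrow> F \<in> polys_over mpolys \<Longrightarrow> smult c F \<in> polys_over mpolys"
  and polys_over_monom: "c \<in> mpolys \<Longrightarrow> monom c n \<in> polys_over mpolys"
  for F G :: "('n, 'k::comm_ring_1) mfps poly"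
  by (auto simp: polys_over_def coeff_monom intro: mpolys_diff mpolys_add mpolys_mult)

lemma pseudo_division:
  fixes A P :: "('n::finite, 'k::field) mfps poly"
  assumes P: "P \<in> polys_over mpolys" "P \<noteq> 0" and A: "A \<in> polys_over mpolys"
  shows "\<exists>c D R. c \<in> mpolys \<and> c \<noteq> 0 \<and> D \<in> polys_over mpolys \<and> R \<in> polys_over mpolys \<and>
    smult c A = P * D + R \<and> (R = 0 \<or> degree R < degree P)"
  using A
proof (induction "degree A" arbitrary: A rule: less_induct)
  case less
  have 0: "0 \<in> polys_over mpolys" by (simp add: polys_over_def)
  show ?case
  proof (cases "A = 0 \<or> degree A < degree P")
    case True
    then show ?thesis using less.prems 0 by (intro exI[of _ 1] exI[of _ 0] exI[of _ A]) auto
  next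
    case False
    define k where "k = degree A - degree P"
    define M where "M = monom (lead_coeff A) k"
    define A' where "A' = smult (lead_coeff P) A - P * M"
    have lc: "lead_coeff P \<in> mpolys" "lead_coeff A \<in> mpolys"
      using P(1) less.prems polys_overD by blast+
    have M: "M \<in> polys_over mpolys" unfolding M_def by (rule polys_over_monom[OF lc(2)])
    have A': "A' \<in> polys_over mpolys"
      unfolding A'_def by (intro polys_over_diff polys_over_smult polys_over_mult P less.prems lc M)
    have coeffs: "coeff A' i = 0" if "i \<ge> degree A" for i
    proof -
      have "coeff (P * M) i = lead_coeff A * coeff P (i - k)"
        using that by (simp add: M_def mult.commute[of P] coeff_monom_mult k_def)
      moreover have "i = degree A \<Longrightarrow> i - k = degree P" using False by (simp add: k_def)
      moreover have "i > degree A \<Longrightarrow> i - k > degree P" using False by (simp add: k_def)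
      ultimately show ?thesis
        using that by (cases "i = degree A") (auto simp: A'_def coeff_eq_0)
    qed
    have "\<exists>c D R. c \<in> mpolys \<and> c \<noteq> 0 \<and> D \<in> polys_over mpolys \<and> R \<in> polys_over mpolys \<and>
      smult c A' = P * D + R \<and> (R = 0 \<or> degree R < degree P)"
    proof (cases "A' = 0")
      case True
      then show ?thesis using 0 by (intro exI[of _ 1] exI[of _ 0] exI[of _ 0]) auto
    next
      case False
      then have "degree A' < degree A"
        using coeffs[of "degree A'"] by (meson leading_coeff_0_iff not_le)
      from less.hyps[OF this A'] show ?thesis .
    qed
    then obtain c D R where *: "c \<in> mpolys" "c \<noteq> 0" "D \<in> polys_over mpolys" "R \<in> polys_over mpolys"
      "smult c A' = P * D + R" "R = 0 \<or> degree R < degree P" by blast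
    have "smult (c * lead_coeff P) A = smult c A' + smult c (P * M)"
      by (simp add: A'_def smult_diff_right)
    also have "\<dots> = P * (D + smult c M) + R"
      unfolding *(5) by (simp add: distrib_left)
    finally have "smult (c * lead_coeff P) A = P * (D + smult c M) + R" .
    moreover have "D + smult c M \<in> polys_over mpolys" "c * lead_coeff P \<in> mpolys"
      by (intro polys_over_add polys_over_smult mpolys_mult * M lc)+
    moreover have "c * lead_coeff P \<noteq> 0" using *(2) P(2) by simp
    ultimately show ?thesis using *(4,6) by blast
  qed
qed

context char_p
begin

text \<open>P is an annihilator over k[t] of least degree in y. Minimality excludes P'(f) = 0 and
  also a nonzero remainder in the pseudo-division of E by P; a zero remainder is the relation P D =
  c E.\<close>

lemma residue_data_exists:
  fixes f :: "('n::finite, 'k) mfps"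
  assumes A: "A \<in> polys_over mpolys" "A \<noteq> 0" "poly A f = 0" "degree A \<le> d"
    and ann: "\<And>I. I \<in> \<I> \<Longrightarrow> \<exists>E\<in>polys_over mpolys. E \<noteq> 0 \<and> poly E f = 0 \<and> (\<forall>i. deg_le I (h I) (coeff E i))"
  shows "\<exists>P. residue_data d \<I> h P f"
proof -
  define Q where "Q = (\<lambda>P. P \<in> polys_over mpolys \<and> P \<noteq> 0 \<and> poly P f = 0)"
  obtain P where P: "Q P" and min: "\<And>B. Q B \<Longrightarrow> degree P \<le> degree B"
    using ex_has_least_nat[of Q A degree] A unfolding Q_def by blast
  have "pderiv P \<noteq> 0"
    using P min unfolding Q_def by (intro pderiv_minimal_ne_0) auto
  have "poly (pderiv P) f \<noteq> 0"
  proof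
    assume "poly (pderiv P) f = 0"
    moreover have "pderiv P \<in> polys_over mpolys"
      using P unfolding Q_def polys_over_def
      by (auto simp: coeff_pderiv simp del: of_nat_Suc intro!: mpolys_mult mpolys_of_nat)
    ultimately have "degree P \<le> degree (pderiv P)"
      using \<open>pderiv P \<noteq> 0\<close> min by (auto simp: Q_def)
    moreover have "degree P \<noteq> 0"
      using \<open>pderiv P \<noteq> 0\<close> by (metis degree_eq_zeroE pderiv_pCons pderiv_0 pCons_0_0 add_0)
    moreover have "degree (pderiv P) \<le> degree P - 1"
      by (rule degree_le) (auto simp: coeff_pderiv coeff_eq_0)
    ultimately show False by linarith
  qed
  moreover have "degree P \<le> d" using min[of A] A by (simp add: Q_def)
  moreover have "\<exists>c D E. c \<in> mpolys \<and> c \<noteq> 0 \<and> D \<in> polys_over mpolys \<and> D \<noteq> 0 \<and> E \<in> polys_over mpolys \<and>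
        P * D = smult c E \<and> (\<forall>i. deg_le I (h I) (coeff E i))" if mem: "I \<in> \<I>" for I
  proof -
    obtain E where E: "E \<in> polys_over mpolys" "E \<noteq> 0" "poly E f = 0" "\<forall>i. deg_le I (h I) (coeff E i)"
      using ann[OF mem] by blast
    obtain c D R where *: "c \<in> mpolys" "c \<noteq> 0" "D \<in> polys_over mpolys" "R \<in> polys_over mpolys"
      "smult c E = P * D + R" "R = 0 \<or> degree R < degree P"
      using pseudo_division[of P E] P E(1) unfolding Q_def by blast
    have "R = 0"
    proof (rule ccontr)
      assume "R \<noteq> 0"
      moreover have "poly R f = 0"
        using arg_cong[OF *(5), of "\<lambda>z. poly z f"] E(3) P by (simp add: Q_def)
      ultimately show False using *(4,6) min[of R] by (auto simp: Q_def)
    qed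
    then have "P * D = smult c E" using *(5) by simp
    moreover from this have "D \<noteq> 0" using *(2) E(2) by auto
    ultimately show ?thesis using * E by blast
  qed
  ultimately show ?thesis using P unfolding residue_data_def Q_def by blast
qed

end

subsection \<open>Hadamard products\<close>

lemma mpolys_linear_dependence:
  fixes c :: "'i \<Rightarrow> 's \<Rightarrow> ('n::finite, 'k::field) mfps"
  assumes "finite S" "finite I" "card S < card I" "\<And>i s. c i s \<in> mpolys"
  shows "\<exists>b. (\<forall>i. b i \<in> mpolys) \<and> (\<exists>i\<in>I. b i \<noteq> 0) \<and> (\<forall>s\<in>S. (\<Sum>i\<in>I. b i * c i s) = 0)"
  using assms
proof (induction S arbitrary: I c rule: finite_induct)
  case empty
  then have "I \<noteq> {}" by auto
  then show ?case by (intro exI[of _ "\<lambda>_. 1"]) auto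
next
  case (insert s S)
  show ?case
  proof (cases "\<forall>i\<in>I. c i s = 0")
    case True
    have "card S < card I" using insert by simp
    from insert.IH[OF insert.prems(1) this insert.prems(3)] True show ?thesis by auto
  next
    case False
    then obtain j where j: "j \<in> I" "c j s \<noteq> 0" by blast
    \<comment> \<open>Fraction-free elimination of the coordinate s with pivot \<open>c j s\<close>,
      which keeps all entries polynomial.\<close>
    define c' where "c' = (\<lambda>i t. c j s * c i t - c i s * c j t)"
    have c': "c' i t \<in> mpolys" for i t
      unfolding c'_def by (intro mpolys_diff mpolys_mult insert.prems)
    have "card S < card (I - {j})" using insert j by simp
    then have "\<exists>b. (\<forall>i. b i \<in> mpolys) \<and> (\<exists>i\<in>I - {j}. b i \<noteq> 0) \<and> (\<forall>t\<in>S. (\<Sum>i\<in>I - {j}. b i * c' i t) = 0)"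
      using insert.prems(1) c' by (intro insert.IH) auto
    then obtain b where
      b: "\<And>i. b i \<in> mpolys" "\<exists>i\<in>I - {j}. b i \<noteq> 0"
        "\<And>t. t \<in> S \<Longrightarrow> (\<Sum>i\<in>I - {j}. b i * c' i t) = 0" by auto
    define b' where "b' = (\<lambda>i. if i = j then - (\<Sum>i\<in>I - {j}. b i * c i s) else c j s * b i)"
    have sum: "(\<Sum>i\<in>I. b' i * c i t) = (\<Sum>i\<in>I - {j}. b i * c' i t)" for t
    proof -
      have "(\<Sum>i\<in>I. b' i * c i t) = b' j * c j t + (\<Sum>i\<in>I - {j}. b' i * c i t)"
        using j(1) insert.prems(1) by (simp add: sum.remove)
      also have "(\<Sum>i\<in>I - {j}. b' i * c i t) = (\<Sum>i\<in>I - {j}. c j s * b i * c i t)"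
        by (rule sum.cong) (auto simp: b'_def)
      also have "b' j * c j t + \<dots> = (\<Sum>i\<in>I - {j}. c j s * b i * c i t - b i * c i s * c j t)"
        by (simp add: b'_def sum_distrib_right sum_subtractf)
      also have "\<dots> = (\<Sum>i\<in>I - {j}. b i * c' i t)"
        by (rule sum.cong) (simp_all add: c'_def algebra_simps)
      finally show ?thesis .
    qed
    have "c' i s = 0" for i by (simp add: c'_def mult.commute)
    then have "\<forall>t\<in>insert s S. (\<Sum>i\<in>I. b' i * c i t) = 0" using sum b(3) by simp
    moreover have "\<forall>i. b' i \<in> mpolys"
      unfolding b'_def using b(1) insert.prems(3) by (auto intro!: mpolys_uminus mpolys_sum mpolys_mult)
    moreover have "\<exists>i\<in>I. b' i \<noteq> 0" using b(2) j(2) by (auto simp: b'_def)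
    ultimately show ?thesis by blast
  qed
qed

context char_p
begin

lemma power_p_power: "x ^ (p ^ i) = (stretch p ^^ i) ((coeff_frob p ^^ i) x)"
  for x :: "('n::finite, 'k) mfps"
proof (induction i)
  case (Suc i)
  have comm: "coeff_frob p ((stretch p ^^ i) y) = (stretch p ^^ i) (coeff_frob p y)" for y :: "('n, 'k) mfps"
    by (induction i) (auto simp: coeff_frob_stretch)
  have "x ^ (p ^ Suc i) = (x ^ (p ^ i)) ^ p" by (simp add: power_mult [symmetric] mult.commute)
  also have "\<dots> = stretch p (coeff_frob p ((stretch p ^^ i) ((coeff_frob p ^^ i) x)))"
    unfolding Suc by (rule power_p)
  finally show ?case by (simp add: comm)
qed simp

lemma coeff_frob_funpow_hadamard:
  "(coeff_frob p ^^ i) (hadamard x y) = hadamard ((coeff_frob p ^^ i) x) ((coeff_frob p ^^ i) y)"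
  for x y :: "('n::finite, 'k) mfps"
  by (induction i) (auto simp: coeff_frob_hadamard)

lemma stretch_funpow_sum_mult:
  "(stretch p ^^ i) (\<Sum>k\<in>S. c k * z k) = (\<Sum>k\<in>S. (stretch p ^^ i) (c k) * (stretch p ^^ i) (z k))"
  for c z :: "'b \<Rightarrow> ('n::finite, 'k) mfps"
  by (induction i) (auto simp: stretch_sum stretch_mult)

lemma stretch_funpow_mpolys: "x \<in> mpolys \<Longrightarrow> (stretch p ^^ i) x \<in> mpolys"
  for x :: "('n::finite, 'k) mfps"
  by (induction i) (auto simp: stretch_mpolys)

lemma hadamard_sum:
  fixes v v' :: "nat \<Rightarrow> ('n::finite, 'k) mfps"
  shows "hadamard (\<Sum>a<N. mfps_monom 0 (u a) * v a) (\<Sum>b<N'. mfps_monom 0 (u' b) * v' b) =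
    (\<Sum>k\<in>{..<N} \<times> {..<N'}. mfps_monom 0 (u (fst k) * u' (snd k)) * hadamard (v (fst k)) (v' (snd k)))"
proof (rule mfps_eqI)
  fix m
  have "mfps_nth (hadamard (\<Sum>a<N. mfps_monom 0 (u a) * v a) (\<Sum>b<N'. mfps_monom 0 (u' b) * v' b)) m =
      (\<Sum>a<N. u a * mfps_nth (v a) m) * (\<Sum>b<N'. u' b * mfps_nth (v' b) m)"
    by (simp add: hadamard_def mfps_nth_const_mult)
  also have "\<dots> = (\<Sum>k\<in>{..<N} \<times> {..<N'}.
      (u (fst k) * mfps_nth (v (fst k)) m) * (u' (snd k) * mfps_nth (v' (snd k)) m))"
    by (simp add: sum_product sum.cartesian_product case_prod_unfold)
  also have "\<dots> = (\<Sum>k\<in>{..<N} \<times> {..<N'}.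
      u (fst k) * u' (snd k) * (mfps_nth (v (fst k)) m * mfps_nth (v' (snd k)) m))"
    by (intro sum.cong refl) (simp only: ac_simps)
  finally show "mfps_nth (hadamard (\<Sum>a<N. mfps_monom 0 (u a) * v a) (\<Sum>b<N'. mfps_monom 0 (u' b) * v' b)) m =
      mfps_nth (\<Sum>k\<in>{..<N} \<times> {..<N'}. mfps_monom 0 (u (fst k) * u' (snd k)) * hadamard (v (fst k)) (v' (snd k))) m"
    by (simp add: hadamard_def mfps_nth_const_mult)
qed

text \<open>With T = N N', the T + 1 powers of x = \<open>hadamard f g\<close> with exponents p^i, i
  = 0..T, all lie in the k(t)-span of the T-fold stretches of the T Hadamard products z of spanning
  series at level T.\<close>

lemma hadamard_annihilator:
  fixes f g :: "('n::finite, 'k) mfps"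
  assumes f: "residue_data d \<I> h P f"
      "\<And>s t. finite (exponent_cell \<I> h s t) \<and> (d + 1) * card (exponent_cell \<I> h s t) \<le> N"
    and g: "residue_data d' \<I>' h' P' g"
      "\<And>s t. finite (exponent_cell \<I>' h' s t) \<and> (d' + 1) * card (exponent_cell \<I>' h' s t) \<le> N'"
    and pos: "N * N' > 0"
  shows "\<exists>A\<in>polys_over mpolys. A \<noteq> 0 \<and> poly A (hadamard f g) = 0 \<and> degree A \<le> p ^ (N * N') - 1"
proof -
  obtain W where W: "\<And>j. (coeff_frob p ^^ j) f \<in> W j"
    "\<And>j r w. r \<in> residues_p \<Longrightarrow> w \<in> W j \<Longrightarrow> mfps_section p r w \<in> W (Suc j)"
    "\<And>j. \<exists>v :: nat \<Rightarrow> _. \<forall>w\<in>W j. \<exists>u. w = (\<Sum>i<N. mfps_monom 0 (u i) * v i)"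
    using residue_chain[OF f] by blast
  obtain W' where W': "\<And>j. (coeff_frob p ^^ j) g \<in> W' j"
    "\<And>j r w. r \<in> residues_p \<Longrightarrow> w \<in> W' j \<Longrightarrow> mfps_section p r w \<in> W' (Suc j)"
    "\<And>j. \<exists>v :: nat \<Rightarrow> _. \<forall>w\<in>W' j. \<exists>u. w = (\<Sum>i<N'. mfps_monom 0 (u i) * v i)"
    using residue_chain[OF g] by blast
  define T where "T = N * N'"
  define K where "K = {..<N} \<times> {..<N'}"
  obtain v where v: "\<And>w. w \<in> W T \<Longrightarrow> \<exists>u. w = (\<Sum>i<N. mfps_monom 0 (u i) * v i)" using W(3) by metis
  obtain v' where v': "\<And>w. w \<in> W' T \<Longrightarrow> \<exists>u. w = (\<Sum>i<N'. mfps_monom 0 (u i) * v' i)" using W'(3) by metis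
  define z where "z = (\<lambda>k. hadamard (v (fst k)) (v' (snd k)))"
  \<comment> \<open>Sections lead one level up, so \<open>section_decomp\<close> expresses products
    at level T - j - 1 through those at level T - j, at the price of one more stretch of the fixed
    series z.\<close>
  have descend: "\<exists>c. (\<forall>k. c k \<in> mpolys) \<and> hadamard w w' = (\<Sum>k\<in>K. c k * (stretch p ^^ j) (z k))"
    if "j \<le> T" "w \<in> W (T - j)" "w' \<in> W' (T - j)" for j w w'
    using that
  proof (induction j arbitrary: w w')
    case 0
    then obtain u u' where "w = (\<Sum>i<N. mfps_monom 0 (u i) * v i)" "w' = (\<Sum>i<N'. mfps_monom 0 (u' i) * v' i)"
      using v v' by fastforce
    then show ?case
      by (intro exI[of _ "\<lambda>k. mfps_monom 0 (u (fst k) * u' (snd k))"]) (simp add: hadamard_sum z_def K_def)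
  next
    case (Suc j)
    have eq: "Suc (T - Suc j) = T - j" using Suc.prems(1) by simp
    have "\<exists>c. (\<forall>k. c k \<in> mpolys) \<and>
        hadamard (mfps_section p r w) (mfps_section p r w') = (\<Sum>k\<in>K. c k * (stretch p ^^ j) (z k))"
      if "r \<in> residues_p" for r
      using Suc.IH[of "mfps_section p r w" "mfps_section p r w'"] Suc.prems
        W(2)[OF that Suc.prems(2)] W'(2)[OF that Suc.prems(3)] unfolding eq by simp
    then have "\<forall>r\<in>residues_p. \<exists>c. (\<forall>k. c k \<in> mpolys) \<and>
        mfps_section p r (hadamard w w') = (\<Sum>k\<in>K. c k * (stretch p ^^ j) (z k))"
      unfolding section_hadamard by blast
    from bchoice[OF this] obtain c where c: "\<And>r k. r \<in> residues_p \<Longrightarrow> c r k \<in> mpolys"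
      "\<And>r. r \<in> residues_p \<Longrightarrow> mfps_section p r (hadamard w w') = (\<Sum>k\<in>K. c r k * (stretch p ^^ j) (z k))"
      by blast
    have "hadamard w w' = (\<Sum>r\<in>residues_p. mfps_monom (expo r) 1 * stretch p (mfps_section p r (hadamard w w')))"
      by (rule section_decomp)
    also have "\<dots> = (\<Sum>r\<in>residues_p. \<Sum>k\<in>K. mfps_monom (expo r) 1 * stretch p (c r k) * (stretch p ^^ Suc j) (z k))"
      by (rule sum.cong [OF refl]) (simp add: c(2) stretch_sum stretch_mult sum_distrib_left mult.assoc)
    also have "\<dots> = (\<Sum>k\<in>K. (\<Sum>r\<in>residues_p. mfps_monom (expo r) 1 * stretch p (c r k)) * (stretch p ^^ Suc j) (z k))"
      unfolding sum_distrib_right by (rule sum.swap)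
    finally show ?case
      by (intro exI[of _ "\<lambda>k. \<Sum>r\<in>residues_p. mfps_monom (expo r) 1 * stretch p (c r k)"])
        (auto intro!: mpolys_sum mpolys_mult stretch_mpolys c(1))
  qed
  define x where "x = hadamard f g"
  have "\<exists>c. (\<forall>k. c k \<in> mpolys) \<and> x ^ (p ^ i) = (\<Sum>k\<in>K. c k * (stretch p ^^ T) (z k))" if i: "i \<le> T" for i
  proof -
    \<comment> \<open>The power with exponent p^i is the i-fold stretch of the Hadamard product of
      the i-th twists, which lie at level i. The T - i stretches from the descent and these i
      stretches always add up to T.\<close>
    have ii: "T - (T - i) = i" using i by simp
    have "\<exists>c. (\<forall>k. c k \<in> mpolys) \<and> hadamard ((coeff_frob p ^^ i) f) ((coeff_frob p ^^ i) g) =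
        (\<Sum>k\<in>K. c k * (stretch p ^^ (T - i)) (z k))"
      by (rule descend) (use W(1)[of i] W'(1)[of i] in \<open>simp_all add: ii\<close>)
    then obtain c where c: "\<And>k. c k \<in> mpolys"
      "hadamard ((coeff_frob p ^^ i) f) ((coeff_frob p ^^ i) g) = (\<Sum>k\<in>K. c k * (stretch p ^^ (T - i)) (z k))"
      by blast
    have "(stretch p ^^ i) ((stretch p ^^ (T - i)) y) = (stretch p ^^ T) y" for y :: "('n, 'k) mfps"
      using i fun_cong[OF funpow_add[of i "T - i" "stretch p"], of y] by simp
    then have "x ^ (p ^ i) = (\<Sum>k\<in>K. (stretch p ^^ i) (c k) * (stretch p ^^ T) (z k))"
      unfolding x_def power_p_power coeff_frob_funpow_hadamard c(2) stretch_funpow_sum_mult by simp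
    then show ?thesis
      by (intro exI[of _ "\<lambda>k. (stretch p ^^ i) (c k)"]) (simp add: stretch_funpow_mpolys c(1))
  qed
  then have "\<forall>i\<in>{..T}. \<exists>c. (\<forall>k. c k \<in> mpolys) \<and> x ^ (p ^ i) = (\<Sum>k\<in>K. c k * (stretch p ^^ T) (z k))"
    by blast
  from bchoice[OF this] obtain c where c: "\<And>i k. i \<le> T \<Longrightarrow> c i k \<in> mpolys"
    "\<And>i. i \<le> T \<Longrightarrow> x ^ (p ^ i) = (\<Sum>k\<in>K. c i k * (stretch p ^^ T) (z k))"
    by auto
  \<comment> \<open>Padding by 0, since the entries are known to be polynomials only for indices up
    to T.\<close>
  define c' where "c' = (\<lambda>i k. if i \<le> T then c i k else 0)"
  have "\<exists>b. (\<forall>i. b i \<in> mpolys) \<and> (\<exists>i\<in>{..T}. b i \<noteq> 0) \<and> (\<forall>k\<in>K. (\<Sum>i\<le>T. b i * c' i k) = 0)"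
    by (rule mpolys_linear_dependence) (auto simp: K_def T_def c'_def c(1))
  then obtain b i\<^sub>0 where b: "\<And>i. b i \<in> mpolys" "i\<^sub>0 \<le> T" "b i\<^sub>0 \<noteq> 0" "\<And>k. k \<in> K \<Longrightarrow> (\<Sum>i\<le>T. b i * c' i k) = 0"
    by auto
  have "(\<Sum>i\<le>T. b i * x ^ (p ^ i)) = (\<Sum>i\<le>T. \<Sum>k\<in>K. b i * c' i k * (stretch p ^^ T) (z k))"
    by (rule sum.cong [OF refl]) (simp add: c(2) c'_def sum_distrib_left mult.assoc)
  also have "\<dots> = (\<Sum>k\<in>K. (\<Sum>i\<le>T. b i * c' i k) * (stretch p ^^ T) (z k))"
    unfolding sum_distrib_right by (rule sum.swap)
  finally have rel: "(\<Sum>i\<le>T. b i * x ^ (p ^ i)) = 0" using b(4) by simp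
  have p1: "p > 1" using prime_p by (rule prime_gt_1_nat)
  show ?thesis
  proof (cases "x = 0")
    case True
    \<comment> \<open>For x = 0 the relation cannot be divided by x; here y annihilates x, and its
      degree 1 is at most p^T - 1 because T is positive.\<close>
    have "T > 0" using pos by (simp add: T_def)
    then have "p ^ 1 \<le> p ^ T" using p1 by (intro power_increasing) auto
    then have "1 \<le> p ^ T - 1" using p1 by simp
    then show ?thesis using True
      by (intro bexI[of _ "monom 1 1"]) (simp_all add: x_def T_def poly_monom degree_monom_eq polys_over_monom)
  next
    case False
    \<comment> \<open>The relation divided by x. Distinct i give distinct exponents p^i - 1, so the
      coefficients b i do not cancel.\<close>
    define A where "A = (\<Sum>i\<le>T. monom (b i) (p ^ i - 1))"
    have "coeff A (p ^ i\<^sub>0 - 1) = (\<Sum>i\<le>T. if i = i\<^sub>0 then b i else 0)"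
      unfolding A_def coeff_sum
    proof (rule sum.cong [OF refl])
      fix i
      have "p ^ i - 1 = p ^ i\<^sub>0 - 1 \<longleftrightarrow> p ^ i = p ^ i\<^sub>0"
        using p_pos by (metis Suc_pred' diff_Suc_1 zero_less_power)
      then show "coeff (monom (b i) (p ^ i - 1)) (p ^ i\<^sub>0 - 1) = (if i = i\<^sub>0 then b i else 0)"
        using p1 by simp
    qed
    then have "A \<noteq> 0" using b(2,3) by auto
    moreover have "A \<in> polys_over mpolys"
      unfolding A_def polys_over_def by (auto simp: coeff_sum intro!: mpolys_sum b(1))
    moreover have "degree A \<le> p ^ T - 1"
      unfolding A_def
      by (intro degree_sum_le order_trans[OF degree_monom_le]) (use p_pos in \<open>auto intro!: diff_le_mono power_increasing\<close>)
    moreover have "poly A x = 0"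
    proof -
      have "x * poly A x = (\<Sum>i\<le>T. b i * (x * x ^ (p ^ i - 1)))"
        by (simp add: A_def poly_sum poly_monom sum_distrib_left ac_simps)
      also have "\<dots> = (\<Sum>i\<le>T. b i * x ^ (p ^ i))"
        using p_pos by (simp flip: power_Suc)
      finally show ?thesis using rel False by simp
    qed
    ultimately show ?thesis unfolding x_def T_def by blast
  qed
qed

end

subsection \<open>Counting exponents\<close>

text \<open>The condition for {i} confines the coordinate m_i to a window of hs i + 1 values. The
  shifts depend on i, so from the i-th condition only the i-th coordinate is used.\<close>

lemma card_exponent_cell_singletons:
  fixes hs :: "'n::finite \<Rightarrow> nat"
  assumes "\<And>i. h {i} = hs i"
  shows "finite (exponent_cell (range (\<lambda>i. {i})) h s t) \<and>
    card (exponent_cell (range (\<lambda>i. {i})) h s t) \<le> (\<Prod>i\<in>UNIV. hs i + 1)"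
proof -
  let ?Z = "exponent_cell (range (\<lambda>i. {i})) h s t"
  let ?\<phi> = "\<lambda>m i. Poly_Mapping.lookup m i + Poly_Mapping.lookup (s {i}) i - Poly_Mapping.lookup (t {i}) i"
  have Z: "\<exists>e. Poly_Mapping.lookup m i + Poly_Mapping.lookup (s {i}) i = Poly_Mapping.lookup (t {i}) i + e \<and> e \<le> hs i"
    if "m \<in> ?Z" for m i
  proof -
    obtain e where e: "m + s {i} = t {i} + e" "wt {i} e \<le> h {i}"
      using \<open>m \<in> ?Z\<close> by (auto simp: exponent_cell_def)
    have "Poly_Mapping.lookup m i + Poly_Mapping.lookup (s {i}) i =
        Poly_Mapping.lookup (t {i}) i + Poly_Mapping.lookup e i"
      by (simp only: lookup_add [symmetric] e(1))
    moreover have "Poly_Mapping.lookup e i \<le> hs i" using e(2) assms by (simp add: wt_def)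
    ultimately show ?thesis by blast
  qed
  have inj: "inj_on ?\<phi> ?Z"
  proof (rule inj_onI)
    fix m m' assume m: "m \<in> ?Z" "m' \<in> ?Z" and eq: "?\<phi> m = ?\<phi> m'"
    have "Poly_Mapping.lookup m i = Poly_Mapping.lookup m' i" for i
      using Z[OF m(1), of i] Z[OF m(2), of i] fun_cong[OF eq, of i] by auto
    then show "m = m'" by (rule poly_mapping_eqI)
  qed
  have sub: "?\<phi> ` ?Z \<subseteq> PiE UNIV (\<lambda>i. {..hs i})"
  proof
    fix x assume "x \<in> ?\<phi> ` ?Z"
    then obtain m where m: "m \<in> ?Z" "x = ?\<phi> m" by blast
    have "x i \<le> hs i" for i using Z[OF m(1), of i] by (auto simp: m(2))
    then show "x \<in> PiE UNIV (\<lambda>i. {..hs i})" by auto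
  qed
  have fin: "finite (PiE (UNIV :: 'n set) (\<lambda>i. {..hs i}))" by (intro finite_PiE) auto
  have "card ?Z \<le> card (PiE UNIV (\<lambda>i. {..hs i}))" by (rule card_inj_on_le[OF inj sub fin])
  moreover have "card (PiE UNIV (\<lambda>i. {..hs i})) = (\<Prod>i\<in>UNIV. hs i + 1)" by (simp add: card_PiE)
  moreover have "finite ?Z" using inj_on_finite[OF inj sub fin] .
  ultimately show ?thesis by simp
qed

text \<open>One shift serves all coordinates, so m is determined by an exponent vector e of total
  degree at most \<open>h UNIV\<close>. Prepending the slack turns these vectors into lists of n + 1
  naturals with sum exactly \<open>h UNIV\<close>, n being the number of variables, which stars and
  bars counts.\<close>

lemma card_exponent_cell_total:
  fixes s t :: "'n set \<Rightarrow> 'n::finite \<Rightarrow>\<^sub>0 nat"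
  shows "finite (exponent_cell {UNIV} h s t) \<and>
    card (exponent_cell {UNIV} h s t) \<le> (card (UNIV :: 'n set) + h UNIV) choose card (UNIV :: 'n set)"
proof -
  let ?Z = "exponent_cell {UNIV} h s t" and ?n = "card (UNIV :: 'n set)"
  obtain xs :: "'n list" where xs: "set xs = UNIV" "distinct xs"
    using finite_distinct_list[of "UNIV :: 'n set"] by auto
  have len: "length xs = ?n" using distinct_card[OF xs(2)] xs(1) by simp
  have "\<forall>m\<in>?Z. \<exists>e. m + s UNIV = t UNIV + e \<and> wt UNIV e \<le> h UNIV"
    by (simp add: exponent_cell_def)
  from bchoice[OF this] obtain e where
    e: "\<And>m. m \<in> ?Z \<Longrightarrow> m + s UNIV = t UNIV + e m" "\<And>m. m \<in> ?Z \<Longrightarrow> wt UNIV (e m) \<le> h UNIV" by blast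
  define \<phi> where "\<phi> = (\<lambda>m. (h UNIV - wt UNIV (e m)) # map (Poly_Mapping.lookup (e m)) xs)"
  let ?L = "{l :: nat list. size l = ?n + 1 \<and> sum_list l = h UNIV}"
  have inj: "inj_on \<phi> ?Z"
  proof (rule inj_onI)
    fix m m' assume m: "m \<in> ?Z" "m' \<in> ?Z" and eq: "\<phi> m = \<phi> m'"
    have "Poly_Mapping.lookup (e m) i = Poly_Mapping.lookup (e m') i" for i
      using eq xs(1) by (auto simp: \<phi>_def map_eq_conv)
    then have "e m = e m'" by (rule poly_mapping_eqI)
    then have "m + s UNIV = m' + s UNIV" using e(1) m by simp
    then show "m = m'" by simp
  qed
  have sub: "\<phi> ` ?Z \<subseteq> ?L"
  proof
    fix l assume "l \<in> \<phi> ` ?Z"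
    then obtain m where m: "m \<in> ?Z" "l = \<phi> m" by blast
    have "sum_list (map (Poly_Mapping.lookup (e m)) xs) = wt UNIV (e m)"
      using xs by (simp add: wt_def sum_list_distinct_conv_sum_set)
    then show "l \<in> ?L" using e(2)[OF m(1)] by (simp add: m(2) \<phi>_def len)
  qed
  have "?L \<subseteq> {l. set l \<subseteq> {..h UNIV} \<and> length l = ?n + 1}"
    using member_le_sum_list by fastforce
  then have fin: "finite ?L" by (rule finite_subset) (rule finite_lists_length_eq, simp)
  have "card ?Z \<le> card ?L" by (rule card_inj_on_le[OF inj sub fin])
  also have "card ?L = (h UNIV + ?n) choose h UNIV"
    using card_length_sum_list[of "?n + 1" "h UNIV"] by simp
  also have "\<dots> = (?n + h UNIV) choose ?n"
    by (subst binomial_symmetric) (simp_all add: add.commute)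
  finally show ?thesis using inj_on_finite[OF inj sub fin] by simp
qed

subsection \<open>Annihilating polynomials and the degree\<close>

lemma ex_mpoly_poly:
  fixes A :: "('n, 'k::field) mfps poly"
  assumes "A \<in> polys_over mpolys"
  shows "\<exists>B :: ('n, 'k) mpoly poly. map_poly mfps_of_mpoly B = A"
  using assms
proof (induction A)
  case 0
  show ?case by (rule exI[of _ 0]) simp
next
  case (pCons a A)
  have "coeff A i \<in> mpolys" for i
    using polys_overD[OF pCons.prems, of "Suc i"] by simp
  then obtain B :: "('n, 'k) mpoly poly" where B: "map_poly mfps_of_mpoly B = A"
    using pCons.IH by (auto simp: polys_over_def)
  obtain b where b: "a = mfps_of_mpoly b"
    using polys_overD[OF pCons.prems, of 0] by (auto simp: mpolys_eq_range)
  have "map_poly mfps_of_mpoly (pCons b B) = pCons a A"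
    by (rule poly_eqI)
      (simp add: coeff_map_poly mfps_of_mpoly_0 b B [symmetric] coeff_pCons split: nat.split)
  then show ?case by blast
qed

lemma annihilatorE:
  fixes A :: "('n::finite, 'k::field) mpoly poly"
  assumes "A \<noteq> 0" "annihilates A f"
  shows "map_poly mfps_of_mpoly A \<in> polys_over mpolys" "map_poly mfps_of_mpoly A \<noteq> 0"
    "poly (map_poly mfps_of_mpoly A) f = 0"
    "deg_le {i} (degree_in i A) (coeff (map_poly mfps_of_mpoly A) j)"
    "deg_le UNIV (total_degree A) (coeff (map_poly mfps_of_mpoly A) j)"
proof -
  have c: "coeff (map_poly mfps_of_mpoly A) j = mfps_of_mpoly (coeff A j)" for j
    by (simp add: coeff_map_poly mfps_of_mpoly_0)
  show "map_poly mfps_of_mpoly A \<in> polys_over mpolys"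
    by (simp add: polys_over_def c mpolys_eq_range)
  show "map_poly mfps_of_mpoly A \<noteq> 0"
    using assms(1) by (auto simp: poly_eq_iff c mfps_of_mpoly_eq_0_iff)
  show "poly (map_poly mfps_of_mpoly A) f = 0" using assms(2) by (simp add: annihilates_def)
  have m: "m \<in> t_monomials A" if "mfps_nth (coeff (map_poly mfps_of_mpoly A) j) m \<noteq> 0" for m
    using that unfolding c t_monomials_def by (auto simp: mfps_of_mpoly_def in_keys_iff)
  show "deg_le {i} (degree_in i A) (coeff (map_poly mfps_of_mpoly A) j)"
    unfolding deg_le_def degree_in_def wt_def using m finite_t_monomials[of A]
    by (auto intro!: Max_ge)
  show "deg_le UNIV (total_degree A) (coeff (map_poly mfps_of_mpoly A) j)"
    unfolding deg_le_def total_degree_def wt_def using m finite_t_monomials[of A]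
    by (auto intro!: Max_ge)
qed

section \<open>Comparison with the field-theoretic degree over k(t)\<close>

context
  fixes f :: "('n::finite, 'k::field) mfps"
begin

interpretation R: field "mfps_field :: ('n, 'k) mfps fract ring"
  by (rule field_mfps_field)

lemma carrier_R: "carrier (mfps_field :: ('n, 'k) mfps fract ring) = UNIV"
  and ops_R: "x \<oplus>\<^bsub>mfps_field\<^esub> y = x + y" "x \<otimes>\<^bsub>mfps_field\<^esub> y = x * y"
    "\<one>\<^bsub>mfps_field\<^esub> = 1" "\<zero>\<^bsub>mfps_field\<^esub> = (0 :: ('n, 'k) mfps fract)"
  for x y :: "('n, 'k) mfps fract"
  by (simp_all add: ring_of_type_algebra_def)

lemma pow_R: "x [^]\<^bsub>mfps_field\<^esub> (n :: nat) = x ^ n" for x :: "('n, 'k) mfps fract"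
  by (induction n) (simp_all add: ops_R)

lemma Fract_power: "Fract y 1 ^ i = Fract (y ^ i) 1" for y :: "('n, 'k) mfps"
  by (induction i) (simp_all add: One_fract_def)

text \<open>For algebraic f the ring generated by f over k(t) is already a field, hence equal to
  \<open>adjoin f\<close>, and its dimension is the degree of the minimal polynomial. That
  polynomial is a list of coefficients, so its degree is the length minus 1.\<close>

lemma alg_degree_eq_Irr:
  assumes "mfps_algebraic f"
  shows "alg_degree f = length (R.Irr ratfuns (Fract f 1)) - 1"
proof -
  have alg: "(R.algebraic over ratfuns) (Fract f 1)"
    using assms by (simp add: mfps_algebraic_def over_def)
  have x: "Fract f 1 \<in> carrier mfps_field" by (simp add: carrier_R)
  have K: "ratfuns \<subseteq> carrier (mfps_field :: ('n, 'k) mfps fract ring)" by (simp add: carrier_R)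
  have sr: "subring ratfuns (mfps_field :: ('n, 'k) mfps fract ring)"
    using subfield_ratfuns by (rule subfieldE(1))
  have "adjoin f = R.simple_extension ratfuns (Fract f 1)"
    unfolding adjoin_def
  proof (rule R.generate_fieldI [symmetric])
    show "ratfuns \<union> {Fract f 1} \<subseteq> carrier mfps_field" by (simp add: carrier_R)
    show "subfield (R.simple_extension ratfuns (Fract f 1)) mfps_field"
      using R.simple_extension_is_subfield[OF subfield_ratfuns x] alg by simp
    show "ratfuns \<union> {Fract f 1} \<subseteq> R.simple_extension ratfuns (Fract f 1)"
      using R.simple_extension_incl[OF K x] R.simple_extension_mem[OF sr x] by simp
    show "R.simple_extension ratfuns (Fract f 1) \<subseteq> K'" if "subfield K' mfps_field" "ratfuns \<union> {Fract f 1} \<subseteq> K'" for K'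
      using R.simple_extension_subring_incl[of K' ratfuns "Fract f 1"] that subfieldE(1)[OF that(1)] by simp
  qed
  then show ?thesis
    using R.simple_extension_dim[OF subfield_ratfuns x alg]
    by (simp add: alg_degree_def over_def)
qed

text \<open>c collects the denominators of the entries. The lists have the leading coefficient
  first, so the head of \<open>a # l\<close> belongs to the exponent
  \<open>length l\<close>.\<close>

lemma clear_denominators:
  fixes l :: "('n, 'k) mfps fract list"
  assumes "set l \<subseteq> ratfuns"
  shows "\<exists>c A. c \<in> mpolys \<and> c \<noteq> 0 \<and> A \<in> polys_over mpolys \<and> (\<forall>i\<ge>length l. coeff A i = 0) \<and>
    Fract (poly A f) 1 = Fract c 1 * R.eval l (Fract f 1) \<and> (l \<noteq> [] \<longrightarrow> hd l \<noteq> 0 \<longrightarrow> A \<noteq> 0)"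
  using assms
proof (induction l)
  case Nil
  show ?case
    by (intro exI[of _ 1] exI[of _ 0]) (simp add: polys_over_def ops_R fract_collapse)
next
  case (Cons a l)
  then obtain c A where IH: "c \<in> mpolys" "c \<noteq> 0" "A \<in> polys_over mpolys" "\<And>i. i \<ge> length l \<Longrightarrow> coeff A i = 0"
    "Fract (poly A f) 1 = Fract c 1 * R.eval l (Fract f 1)" by auto
  obtain n' d' where a': "a = Fract (mfps_of_mpoly n') (mfps_of_mpoly d')" "d' \<noteq> 0"
    using Cons.prems by (auto simp: ratfuns_def)
  define n where "n = mfps_of_mpoly n'"
  define d where "d = mfps_of_mpoly d'"
  have nd: "n \<in> mpolys" "d \<in> mpolys" "d \<noteq> 0" "a = Fract n d"
    using a' by (auto simp: n_def d_def mpolys_eq_range mfps_of_mpoly_eq_0_iff)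
  define A' where "A' = smult d A + monom (n * c) (length l)"
  have "Fract (poly A' f) 1 = Fract d 1 * Fract (poly A f) 1 + Fract (n * c) 1 * Fract (f ^ length l) 1"
    by (simp add: A'_def poly_monom)
  also have "Fract (f ^ length l) 1 = (Fract f 1) ^ length l" by (rule Fract_power [symmetric])
  also have "Fract (n * c) 1 = Fract (c * d) 1 * a"
    using nd by (simp add: eq_fract ac_simps)
  also have "Fract d 1 * Fract (poly A f) 1 = Fract (c * d) 1 * R.eval l (Fract f 1)"
    unfolding IH(5) by (simp add: mult.assoc [symmetric] mult.commute)
  finally have "Fract (poly A' f) 1 = Fract (c * d) 1 * R.eval (a # l) (Fract f 1)"
    by (simp add: ops_R pow_R algebra_simps)
  moreover have "A' \<in> polys_over mpolys"
    unfolding A'_def by (intro polys_over_add polys_over_smult polys_over_monom mpolys_mult nd IH)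
  moreover have "coeff A' i = 0" if "i \<ge> length (a # l)" for i
    using that IH(4)[of i] by (simp add: A'_def)
  moreover have "A' \<noteq> 0" if "a \<noteq> 0"
  proof -
    have "coeff A' (length l) = n * c" using IH(4)[of "length l"] by (simp add: A'_def)
    moreover have "n \<noteq> 0" using that nd(4) by (auto simp: fract_collapse)
    ultimately show ?thesis using IH(2) by auto
  qed
  ultimately show ?case
    using IH nd by (intro exI[of _ "c * d"] exI[of _ A']) (auto intro: mpolys_mult)
qed

lemma algebraic_imp_annihilator:
  assumes "mfps_algebraic f"
  shows "\<exists>A\<in>polys_over mpolys. A \<noteq> 0 \<and> poly A f = 0 \<and> degree A \<le> alg_degree f"
proof -
  let ?p = "R.Irr ratfuns (Fract f 1)"
  have alg: "(R.algebraic over ratfuns) (Fract f 1)"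
    using assms by (simp add: mfps_algebraic_def over_def)
  have x: "Fract f 1 \<in> carrier mfps_field" by (simp add: carrier_R)
  note Irr = R.IrrE[OF subfield_ratfuns x alg]
  have p: "polynomial\<^bsub>mfps_field\<^esub> ratfuns ?p" using Irr(1) by (simp add: univ_poly_carrier)
  have "?p \<noteq> []" using Irr(2) by (auto simp: ring_irreducible_def univ_poly_zero)
  then have hd: "hd ?p \<noteq> 0" using p by (simp add: polynomial_def ops_R)
  have "set ?p \<subseteq> ratfuns" using p by (auto simp: polynomial_def)
  from clear_denominators[OF this] obtain c A where A: "A \<in> polys_over mpolys"
    "\<And>i. i \<ge> length ?p \<Longrightarrow> coeff A i = 0" "Fract (poly A f) 1 = Fract c 1 * R.eval ?p (Fract f 1)" "A \<noteq> 0"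
    using hd \<open>?p \<noteq> []\<close> by blast
  have "Fract (poly A f) 1 = 0" using A(3) Irr(4) by (simp add: ops_R)
  then have "poly A f = 0" by (simp add: Zero_fract_def eq_fract)
  moreover have "degree A \<le> length ?p - 1"
    using A(2) by (intro degree_le) auto
  ultimately show ?thesis using A(1,4) alg_degree_eq_Irr[OF assms] by auto
qed

lemma eval_rev_map:
  "R.eval (rev (map c [0..<n])) x = (\<Sum>i<n. c i * x ^ i)"
  by (induction n) (simp_all add: ops_R pow_R)

text \<open>Read as a polynomial over k(t), A is divisible by the minimal polynomial of f, whose
  degree is \<open>alg_degree f\<close>.\<close>

lemma annihilator_imp_algebraic:
  assumes A: "A \<in> polys_over mpolys" "A \<noteq> 0" "poly A f = 0"
  shows "mfps_algebraic f \<and> alg_degree f \<le> degree A"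
proof -
  define l where "l = rev (map (\<lambda>i. Fract (coeff A i) 1) [0..<Suc (degree A)])"
  have x: "Fract f 1 \<in> carrier mfps_field" by (simp add: carrier_R)
  have "Fract (coeff A i) 1 \<in> ratfuns" for i
  proof -
    obtain a where "coeff A i = mfps_of_mpoly a" using polys_overD[OF A(1), of i] by (auto simp: mpolys_eq_range)
    then show ?thesis unfolding ratfuns_def
      by (intro CollectI exI[of _ a] exI[of _ 1]) (simp add: mfps_of_mpoly_1)
  qed
  then have "set l \<subseteq> ratfuns" by (auto simp: l_def)
  moreover have "hd l \<noteq> 0" using A(2) by (simp add: l_def Zero_fract_def eq_fract)
  ultimately have l: "l \<in> carrier (ratfuns[X]\<^bsub>mfps_field\<^esub>)" "l \<noteq> []"
    by (auto simp: univ_poly_carrier [symmetric] polynomial_def ops_R l_def)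
  have sum: "(\<Sum>i\<in>I. Fract (g i) 1) = Fract (sum g I) 1" for g :: "nat \<Rightarrow> ('n, 'k) mfps" and I
    by (induction I rule: infinite_finite_induct) (simp_all add: Zero_fract_def)
  have "R.eval l (Fract f 1) = (\<Sum>i<Suc (degree A). Fract (coeff A i * f ^ i) 1)"
    unfolding l_def eval_rev_map by (simp add: Fract_power)
  also have "\<dots> = Fract (poly A f) 1"
    unfolding sum poly_altdef lessThan_Suc_atMost ..
  finally have ev: "R.eval l (Fract f 1) = \<zero>\<^bsub>mfps_field\<^esub>" using A(3) by (simp add: ops_R Zero_fract_def)
  have alg: "(R.algebraic over ratfuns) (Fract f 1)" using R.algebraicI[OF l ev] .
  then have mf: "mfps_algebraic f" by (simp add: mfps_algebraic_def over_def)
  have "length (R.Irr ratfuns (Fract f 1)) - 1 \<le> length l - 1"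
    using R.pdivides_imp_degree_le[OF subfieldE(1)[OF subfield_ratfuns]
        R.IrrE(1)[OF subfield_ratfuns x alg] l R.Irr_minimal[OF subfield_ratfuns x alg l(1) ev]] .
  then show ?thesis using alg_degree_eq_Irr[OF mf] mf by (simp add: l_def)
qed

end

text \<open>An algebraic f has a nonzero annihilator, so the sets under \<open>LEAST\<close> in the
  heights are nonempty and the minima are attained, possibly by a different polynomial for each
  height.\<close>

lemma height_annihilators:
  fixes f :: "('n::finite, 'k::field) mfps"
  assumes "mfps_algebraic f"
  shows "\<exists>A\<in>polys_over mpolys. A \<noteq> 0 \<and> poly A f = 0 \<and> (\<forall>j. deg_le {i} (partial_height f i) (coeff A j))"
    and "\<exists>A\<in>polys_over mpolys. A \<noteq> 0 \<and> poly A f = 0 \<and> (\<forall>j. deg_le UNIV (total_height f) (coeff A j))"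
proof -
  obtain A where A: "A \<in> polys_over mpolys" "A \<noteq> 0" "poly A f = 0"
    using algebraic_imp_annihilator[OF assms] by blast
  then obtain B :: "('n, 'k) mpoly poly" where B: "map_poly mfps_of_mpoly B = A"
    using ex_mpoly_poly by blast
  then have B': "B \<noteq> 0" "annihilates B f" using A by (auto simp: annihilates_def)
  have "\<exists>h A. A \<noteq> 0 \<and> annihilates A f \<and> degree_in i A = h" using B' by blast
  from LeastI_ex[OF this] obtain C where C: "C \<noteq> 0" "annihilates C f" "degree_in i C = partial_height f i"
    unfolding partial_height_def by blast
  then show "\<exists>A\<in>polys_over mpolys. A \<noteq> 0 \<and> poly A f = 0 \<and> (\<forall>j. deg_le {i} (partial_height f i) (coeff A j))"
    using annihilatorE[OF C(1,2)] unfolding C(3) [symmetric]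
    by (intro bexI[of _ "map_poly mfps_of_mpoly C"]) auto
  have "\<exists>h A. A \<noteq> 0 \<and> annihilates A f \<and> total_degree A = h" using B' by blast
  from LeastI_ex[OF this] obtain C where C: "C \<noteq> 0" "annihilates C f" "total_degree C = total_height f"
    unfolding total_height_def by blast
  then show "\<exists>A\<in>polys_over mpolys. A \<noteq> 0 \<and> poly A f = 0 \<and> (\<forall>j. deg_le UNIV (total_height f) (coeff A j))"
    using annihilatorE[OF C(1,2)] unfolding C(3) [symmetric]
    by (intro bexI[of _ "map_poly mfps_of_mpoly C"]) auto
qed

text \<open>The smaller term of the minimum decides the family: all singletons for the partial
  heights, \<open>UNIV\<close> alone for the total height.\<close>

lemma (in char_p) algebraic_residue_data:
  fixes f :: "('n::finite, 'k) mfps"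
  assumes alg: "mfps_algebraic f"
    and N: "N = (alg_degree f + 1) * min (\<Prod>i\<in>UNIV. partial_height f i + 1)
      ((card (UNIV :: 'n set) + total_height f) choose card (UNIV :: 'n set))"
  shows "\<exists>\<I> h P. residue_data (alg_degree f) \<I> h P f \<and>
    (\<forall>s t. finite (exponent_cell \<I> h s t) \<and> (alg_degree f + 1) * card (exponent_cell \<I> h s t) \<le> N)"
proof -
  obtain A where A: "A \<in> polys_over mpolys" "A \<noteq> 0" "poly A f = 0" "degree A \<le> alg_degree f"
    using algebraic_imp_annihilator[OF alg] by blast
  show ?thesis
  proof (cases "(\<Prod>i\<in>UNIV. partial_height f i + 1) \<le> (card (UNIV :: 'n set) + total_height f) choose card (UNIV :: 'n set)")
    case True
    define h where "h = (\<lambda>I :: 'n set. partial_height f (the_elem I))"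
    have "\<exists>P. residue_data (alg_degree f) (range (\<lambda>i. {i})) h P f"
      by (rule residue_data_exists[OF A]) (use height_annihilators(1)[OF alg] in \<open>auto simp: h_def\<close>)
    moreover have "finite (exponent_cell (range (\<lambda>i. {i})) h s t) \<and>
        (alg_degree f + 1) * card (exponent_cell (range (\<lambda>i. {i})) h s t) \<le> N" for s t
      using card_exponent_cell_singletons[of h "partial_height f" s t] True
      unfolding N by (auto simp: h_def min_def simp del: mult_Suc intro!: mult_le_mono2)
    ultimately show ?thesis by blast
  next
    case False
    define h where "h = (\<lambda>I :: 'n set. total_height f)"
    have "\<exists>P. residue_data (alg_degree f) {UNIV} h P f"
      by (rule residue_data_exists[OF A]) (use height_annihilators(2)[OF alg] in \<open>auto simp: h_def\<close>)
    moreover have "finite (exponent_cell {UNIV} h s t) \<and>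
        (alg_degree f + 1) * card (exponent_cell {UNIV} h s t) \<le> N" for s t
      using card_exponent_cell_total[of h s t] False
      unfolding N by (auto simp: h_def min_def simp del: mult_Suc intro!: mult_le_mono2)
    ultimately show ?thesis by blast
  qed
qed

theorem theorem6p1:
  fixes f g :: "('n::finite, 'k::field) mfps"
    and p n d d' h h' N1 N2 :: nat
    and hs hs' :: "'n \<Rightarrow> nat"
  assumes "CHAR('k) = p" and "p > 0"
    and "card (UNIV :: 'n set) = n"
    and "mfps_algebraic f" and "mfps_algebraic g"
    and "alg_degree f = d" and "alg_degree g = d'"
    and "total_height f = h" and "total_height g = h'"
    and "partial_height f = hs" and "partial_height g = hs'"
    and "N1 = (d + 1) * min (\<Prod>i\<in>UNIV. (hs i + 1)) ((n + h) choose n)"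
    and "N2 = (d' + 1) * min (\<Prod>i\<in>UNIV. (hs' i + 1)) ((n + h') choose n)"
  shows "mfps_algebraic (hadamard f g) \<and> alg_degree (hadamard f g) \<le> p ^ (N1 * N2) - 1"
proof -
  interpret char_p p "TYPE('k)"
    using assms(1,2) prime_CHAR_semidom[where ?'a = 'k] by unfold_locales auto
  have N1: "N1 = (alg_degree f + 1) * min (\<Prod>i\<in>UNIV. partial_height f i + 1)
      ((card (UNIV :: 'n set) + total_height f) choose card (UNIV :: 'n set))"
    and N2: "N2 = (alg_degree g + 1) * min (\<Prod>i\<in>UNIV. partial_height g i + 1)
      ((card (UNIV :: 'n set) + total_height g) choose card (UNIV :: 'n set))"
    using assms by simp_all
  obtain \<I> \<eta> P where f: "residue_data (alg_degree f) \<I> \<eta> P f"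
    "\<And>s t. finite (exponent_cell \<I> \<eta> s t) \<and> (alg_degree f + 1) * card (exponent_cell \<I> \<eta> s t) \<le> N1"
    using algebraic_residue_data[OF assms(4) N1] by blast
  obtain \<I>' \<eta>' P' where g: "residue_data (alg_degree g) \<I>' \<eta>' P' g"
    "\<And>s t. finite (exponent_cell \<I>' \<eta>' s t) \<and> (alg_degree g + 1) * card (exponent_cell \<I>' \<eta>' s t) \<le> N2"
    using algebraic_residue_data[OF assms(5) N2] by blast
  \<comment> \<open>Positivity covers the case of a zero Hadamard product, where the bound must be
    at least 1.\<close>
  have "N1 * N2 > 0"
    unfolding N1 N2 by (simp add: prod_pos)
  from hadamard_annihilator[OF f g this] obtain A where
    "A \<in> polys_over mpolys" "A \<noteq> 0" "poly A (hadamard f g) = 0" "degree A \<le> p ^ (N1 * N2) - 1" by blast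
  with annihilator_imp_algebraic[of A "hadamard f g"] show ?thesis by auto
qed

end
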